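(* Let $\epsilon\in(0,1)$ and let $\nu:=|\mathcal{X}_1||\mathcal{X}_2|+\kappa+\tfrac32$. Define $\mathscr{R}_{\mathrm{in}}(n,\epsilon)$ as the set of rate pairs $(R_1,R_2)$ whose rate vector satisfies $$\mathbf{R}\in \mathbf{H}+\frac{1}{\sqrt n}\mathscr{S}(\mathbf{V},\epsilon)+\frac{\nu\log n}{n}\mathbf{1},$$ and $\mathscr{R}_{\mathrm{out}}(n,\epsilon)$ as the set of rate pairs $(R_1,R_2)$ whose rate vector satisfies $$\mathbf{R}\in \mathbf{H}+\frac{1}{\sqrt n}\mathscr{S}(\mathbf{V},\epsilon)-\frac{\log n}{n}\mathbf{1}.$$ Then for all $n$ sufficiently large, $$\mathscr{R}_{\mathrm{in}}(n,\epsilon)\subset \mathscr{R}^*_{\mathrm{SW}}(n,\epsilon)\subset\mathscr{R}_{\mathrm{out}}(n,\epsilon).$$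
   Context: Let $\mathcal{X}_1,\mathcal{X}_2$ be finite sets and $p_{X_1,X_2}$ a probability distribution on $\mathcal{X}_1\times\mathcal{X}_2$ with $p_{X_1,X_2}(x_1,x_2)>0$ for all $(x_1,x_2)$, and such that $X_1,X_2$ are not independent. The source is $(X_1^n,X_2^n)\sim\prod_{k=1}^n p_{X_1,X_2}(x_{1k},x_{2k})$. Logarithms are base 2. For $R\ge 0$, $[2^{nR}]:=\{1,\dots,\lceil 2^{nR}\rceil\}$. An $(n,2^{nR_1},2^{nR_2},\epsilon)$-SW code consists of encoders $f_j:\mathcal{X}_j^n\to[2^{nR_j}]$, $j=1,2$, and a decoder $\varphi:[2^{nR_1}]\times[2^{nR_2}]\to\mathcal{X}_1^n\times\mathcal{X}_2^n$ such that $\mathsf{P}(\varphi(f_1(X_1^n),f_2(X_2^n))\neq(X_1^n,X_2^n))\le\epsilon$. A pair $(R_1,R_2)$ is $(n,\epsilon)$-achievable if such a code exists; $\mathscr{R}^*_{\mathrm{SW}}(n,\epsilon)\subset\mathbb{R}^2$ is the set of all $(n,\epsilon)$-achievable pairs. The entropy density vector is $\mathbf{h}(X_1,X_2):=(-\log p_{X_1|X_2}(X_1|X_2),\,-\log p_{X_2|X_1}(X_2|X_1),\,-\log p_{X_1,X_2}(X_1,X_2))^T$; $\mathbf{H}:=\mathsf{E}[\mathbf{h}(X_1,X_2)]=(H(X_1|X_2),H(X_2|X_1),H(X_1,X_2))^T$ with entries $H_t$, and $\mathbf{V}:=\mathrm{Cov}(\mathbf{h}(X_1,X_2))$ (entropy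 dispersion matrix). $\kappa:=\max_{1\le t\le 3}\|\nabla^2 H_t(p_{X_1,X_2})\|_2$, the maximal spectral norm of the Hessians of $p_{X_1,X_2}\mapsto H_t(p_{X_1,X_2})$ viewed as functions of the vector $p_{X_1,X_2}\in\mathbb{R}^{|\mathcal{X}_1||\mathcal{X}_2|}$. The rate vector is $\mathbf{R}:=(R_1,R_2,R_1+R_2)^T$, and $\mathbf{1}$ is the all-ones vector. Vector inequalities are componentwise. For a positive semidefinite $\mathbf{V}\in\mathbb{R}^{3\times3}$ let $\mathbf{Z}\sim\mathcal{N}(\mathbf{0},\mathbf{V})$ (possibly degenerate) and $\mathscr{S}(\mathbf{V},\epsilon):=\{\mathbf{z}\in\mathbb{R}^3:\mathsf{P}(\mathbf{Z}\le\mathbf{z})\ge1-\epsilon\}$. Set sums $\mathbf{a}+c\mathscr{S}$ denote Minkowski translates/scalings. *)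

theory Defs
  imports "HOL-Probability.Probability"
begin

definition marg1 :: "('a::finite \<times> 'b::finite \<Rightarrow> real) \<Rightarrow> 'a \<Rightarrow> real" where
  "marg1 p x1 = (\<Sum>x2\<in>UNIV. p (x1, x2))"

definition marg2 :: "('a::finite \<times> 'b::finite \<Rightarrow> real) \<Rightarrow> 'b \<Rightarrow> real" where
  "marg2 p x2 = (\<Sum>x1\<in>UNIV. p (x1, x2))"

definition independent_pmf :: "('a::finite \<times> 'b::finite \<Rightarrow> real) \<Rightarrow> bool" where
  "independent_pmf p \<longleftrightarrow> (\<forall>x1 x2. p (x1, x2) = marg1 p x1 * marg2 p x2)"

definition ent_density :: "('a::finite \<times> 'b::finite \<Rightarrow> real) \<Rightarrow> 'a \<times> 'b \<Rightarrow> real^3" where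
  "ent_density p x = vector
     [ - log 2 (p x / marg2 p (snd x)),
       - log 2 (p x / marg1 p (fst x)),
       - log 2 (p x) ]"

definition ent_vec :: "('a::finite \<times> 'b::finite \<Rightarrow> real) \<Rightarrow> real^3" where
  "ent_vec p = (\<Sum>x\<in>UNIV. p x *\<^sub>R ent_density p x)"

definition disp_mat :: "('a::finite \<times> 'b::finite \<Rightarrow> real) \<Rightarrow> real^3^3" where
  "disp_mat p = (\<chi> i j. \<Sum>x\<in>UNIV. p x * (ent_density p x $ i - ent_vec p $ i)
                                      * (ent_density p x $ j - ent_vec p $ j))"

definition H_cond1 :: "('a::finite \<times> 'b::finite \<Rightarrow> real) \<Rightarrow> real" where
  "H_cond1 q = - (\<Sum>x\<in>UNIV. q x * log 2 (q x / marg2 q (snd x)))"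

definition H_cond2 :: "('a::finite \<times> 'b::finite \<Rightarrow> real) \<Rightarrow> real" where
  "H_cond2 q = - (\<Sum>x\<in>UNIV. q x * log 2 (q x / marg1 q (fst x)))"

definition H_joint :: "('a::finite \<times> 'b::finite \<Rightarrow> real) \<Rightarrow> real" where
  "H_joint q = - (\<Sum>x\<in>UNIV. q x * log 2 (q x))"

definition bump :: "('c \<Rightarrow> real) \<Rightarrow> 'c \<Rightarrow> real \<Rightarrow> 'c \<Rightarrow> real" where
  "bump q i t = q(i := q i + t)"

definition hessian :: "(('c::finite \<Rightarrow> real) \<Rightarrow> real) \<Rightarrow> ('c \<Rightarrow> real) \<Rightarrow> real^'c^'c" where
  "hessian f q = (\<chi> i j. deriv (\<lambda>s. deriv (\<lambda>t. f (bump (bump q j s) i t)) 0) 0)"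

definition spec_norm :: "real^'c::finite^'c \<Rightarrow> real" where
  "spec_norm M = onorm (\<lambda>v. M *v v)"

definition kappa :: "('a::finite \<times> 'b::finite \<Rightarrow> real) \<Rightarrow> real" where
  "kappa p = Max {spec_norm (hessian H_cond1 p), spec_norm (hessian H_cond2 p),
                  spec_norm (hessian H_joint p)}"

definition std_normal_measure :: "real measure" where
  "std_normal_measure = density lborel std_normal_density"

text \<open>Z ~ N(0,V) realised as Z = A W with W standard Gaussian on R^3 and A A^T = V
  (the law does not depend on the choice of A).\<close>
definition gauss_cdf :: "real^3^3 \<Rightarrow> real^3 \<Rightarrow> real" where
  "gauss_cdf V z =
    (let A = (SOME A :: real^3^3. A ** transpose A = V);
         M = PiM (UNIV :: 3 set) (\<lambda>_. std_normal_measure)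
     in measure M {w \<in> space M. \<forall>i. (A *v (\<chi> j. w j)) $ i \<le> z $ i})"

definition S_set :: "real^3^3 \<Rightarrow> real \<Rightarrow> (real^3) set" where
  "S_set V \<epsilon> = {z. gauss_cdf V z \<ge> 1 - \<epsilon>}"

definition seqs :: "nat \<Rightarrow> (nat \<Rightarrow> 'a) set" where
  "seqs n = PiE {..<n} (\<lambda>_. UNIV)"

definition msg_size :: "nat \<Rightarrow> real \<Rightarrow> nat" where
  "msg_size n R = nat \<lceil>2 powr (real n * R)\<rceil>"

definition sw_error :: "('a::finite \<times> 'b::finite \<Rightarrow> real) \<Rightarrow> nat \<Rightarrow>
    ((nat \<Rightarrow> 'a) \<Rightarrow> nat) \<Rightarrow> ((nat \<Rightarrow> 'b) \<Rightarrow> nat) \<Rightarrow>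
    (nat \<Rightarrow> nat \<Rightarrow> (nat \<Rightarrow> 'a) \<times> (nat \<Rightarrow> 'b)) \<Rightarrow> real" where
  "sw_error p n f1 f2 \<phi> =
     (\<Sum>x1\<in>seqs n. \<Sum>x2\<in>seqs n. (\<Prod>k<n. p (x1 k, x2 k)) *
        (if \<phi> (f1 x1) (f2 x2) \<noteq> (x1, x2) then 1 else 0))"

definition sw_achievable :: "('a::finite \<times> 'b::finite \<Rightarrow> real) \<Rightarrow> nat \<Rightarrow> real \<Rightarrow> real \<Rightarrow> real \<Rightarrow> bool" where
  "sw_achievable p n \<epsilon> R1 R2 \<longleftrightarrow> R1 \<ge> 0 \<and> R2 \<ge> 0 \<and>
     (\<exists>(f1 :: (nat \<Rightarrow> 'a) \<Rightarrow> nat) (f2 :: (nat \<Rightarrow> 'b) \<Rightarrow> nat) \<phi>.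
        (\<forall>x\<in>seqs n. f1 x \<in> {1..msg_size n R1}) \<and>
        (\<forall>x\<in>seqs n. f2 x \<in> {1..msg_size n R2}) \<and>
        (\<forall>m1 m2. \<phi> m1 m2 \<in> seqs n \<times> seqs n) \<and>
        sw_error p n f1 f2 \<phi> \<le> \<epsilon>)"

definition SW_region :: "('a::finite \<times> 'b::finite \<Rightarrow> real) \<Rightarrow> nat \<Rightarrow> real \<Rightarrow> (real \<times> real) set" where
  "SW_region p n \<epsilon> = {(R1, R2). sw_achievable p n \<epsilon> R1 R2}"

definition rate_vec :: "real \<Rightarrow> real \<Rightarrow> real^3" where
  "rate_vec R1 R2 = vector [R1, R2, R1 + R2]"

definition nu :: "('a::finite \<times> 'b::finite \<Rightarrow> real) \<Rightarrow> real" where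
  "nu p = real (CARD('a) * CARD('b)) + kappa p + 3/2"

definition R_in :: "('a::finite \<times> 'b::finite \<Rightarrow> real) \<Rightarrow> nat \<Rightarrow> real \<Rightarrow> (real \<times> real) set" where
  "R_in p n \<epsilon> = {(R1, R2). \<exists>z\<in>S_set (disp_mat p) \<epsilon>.
      rate_vec R1 R2 = ent_vec p + (1 / sqrt (real n)) *\<^sub>R z
                       + (nu p * log 2 (real n) / real n) *\<^sub>R vec 1}"

definition R_out :: "('a::finite \<times> 'b::finite \<Rightarrow> real) \<Rightarrow> nat \<Rightarrow> real \<Rightarrow> (real \<times> real) set" where
  "R_out p n \<epsilon> = {(R1, R2). \<exists>z\<in>S_set (disp_mat p) \<epsilon>.
      rate_vec R1 R2 = ent_vec p + (1 / sqrt (real n)) *\<^sub>R z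
                       - (log 2 (real n) / real n) *\<^sub>R vec 1}"

end

theory Submission
  imports Defs
begin

text \<open>
  Both inclusions compare the distribution function of the centred sum of the entropy densities
  with its Gaussian limit up to an error \<open>O(1/\<surd>n)\<close>: random binning with a threshold decoder and the
  Miyake--Kanaya converse, both with slack \<open>\<gamma> = (log n)/2\<close>, cost only \<open>3/\<surd>n\<close> in probability, whereas
  shifting the thresholds by a multiple of \<open>1/\<surd>n\<close> changes the Gaussian probability by at least
  a multiple of \<open>1/\<surd>n\<close>, so that slack of order \<open>(log n)/\<surd>n\<close> in the normalized thresholds absorbs all errors.

  The Berry--Esseen bound for orthants is proved by a Lindeberg replacement. Let \<open>T\<close> average a function
  over one step of the walk and let \<open>G\<^sub>t\<close> be convolution with the centred Gaussian of covariance \<open>t V\<close>.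
  Writing \<open>V = A A\<^sup>T\<close> and pulling the step back along a generalized inverse of \<open>A\<close>, the second-order
  expansion of the Cameron--Martin density \<open>exp (s \<bullet> w - |s|\<^sup>2/2)\<close> gives
  \<open>|T G\<^sub>j f - G\<^bsub>j+1\<^esub> f| \<le> C j\<^bsup>-3/2\<^esup> sup |f|\<close>. In the telescoping sum for \<open>T\<^sup>n G\<^sub>m f - G\<^bsub>n+m\<^esub> f\<close> each term is
  split by \<open>T\<^sup>k f = (T\<^sup>k f - G\<^sub>k f) + G\<^sub>k f\<close>: the first part is controlled by induction on \<open>n\<close>, the second
  by the semigroup property of \<open>G\<close>. The smoothing \<open>G\<^sub>m\<close> is then removed because every coordinate of the
  Gaussian limit has a bounded density; this uses that \<open>X\<^sub>1\<close> and \<open>X\<^sub>2\<close> are dependent, which forces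
  \<open>V\<^sub>i\<^sub>i > 0\<close>.
\<close>

section \<open>Standard Gaussian vectors\<close>

abbreviation std_normal :: "real measure" where
  "std_normal \<equiv> std_normal_measure"

interpretation std_normal: prob_space std_normal
  unfolding std_normal_measure_def by (rule prob_space_normal_density) simp

lemma sets_std_normal [simp, measurable_cong]: "sets std_normal = sets borel"
  by (simp add: std_normal_measure_def)

lemma space_std_normal [simp]: "space std_normal = UNIV"
  by (simp add: std_normal_measure_def)

lemma borel_measurable_vec_lambda [measurable (raw)]:
  fixes f :: "'a \<Rightarrow> 'n::finite \<Rightarrow> real"
  assumes "\<And>i. (\<lambda>x. f x i) \<in> borel_measurable M"
  shows "(\<lambda>x. \<chi> i. f x i) \<in> borel_measurable M"
  by (subst borel_measurable_euclidean_space)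
     (auto simp: Basis_vec_def inner_axis assms)

lemma borel_measurable_vec_nth [measurable (raw)]:
  fixes f :: "'a \<Rightarrow> real^'n::finite"
  assumes "f \<in> borel_measurable M"
  shows "(\<lambda>x. f x $ i) \<in> borel_measurable M"
  by (rule measurable_compose[OF assms borel_measurable_nth])

lemma borel_measurable_matrix_vector_mult [measurable (raw)]:
  fixes A :: "real^'n::finite^'m::finite"
  assumes "f \<in> borel_measurable M"
  shows "(\<lambda>x. A *v f x) \<in> borel_measurable M"
  by (rule measurable_compose[OF assms])
     (intro borel_measurable_continuous_onI continuous_intros)

lemma sets_borel_Collect: "Measurable.pred borel P \<Longrightarrow> {x. P x} \<in> sets borel"
  by (simp add: pred_def)

lemma nn_integral_std_normal:
  assumes [measurable]: "f \<in> borel_measurable borel"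
  shows "(\<integral>\<^sup>+x. f x \<partial>std_normal) = (\<integral>\<^sup>+x. ennreal (std_normal_density x) * f x \<partial>lborel)"
  by (simp add: std_normal_measure_def nn_integral_density)

lemma nn_integral_std_normal_shift:
  assumes [measurable]: "f \<in> borel_measurable borel"
  shows "(\<integral>\<^sup>+x. f (x + s) \<partial>std_normal)
       = (\<integral>\<^sup>+x. f x * ennreal (exp (s * x - s\<^sup>2 / 2)) \<partial>std_normal)"
proof -
  have density_shift: "std_normal_density (- s + x) = std_normal_density x * exp (s * x - s\<^sup>2 / 2)"
    for x
    by (auto simp: std_normal_density_def power2_eq_square algebra_simps diff_divide_distrib
        add_divide_distrib simp flip: exp_add)
  have "(\<integral>\<^sup>+x. f (x + s) \<partial>std_normal)
      = (\<integral>\<^sup>+x. ennreal (std_normal_density x) * f (x + s) \<partial>lborel)"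
    by (rule nn_integral_std_normal) measurable
  also have "\<dots> = (\<integral>\<^sup>+x. ennreal (std_normal_density (- s + x)) * f x \<partial>lborel)"
    by (subst nn_integral_real_affine[where c=1 and t="-s"]) auto
  also have "\<dots> = (\<integral>\<^sup>+x. f x * ennreal (exp (s * x - s\<^sup>2 / 2)) \<partial>std_normal)"
    unfolding density_shift by (simp add: nn_integral_std_normal ennreal_mult' ac_simps)
  finally show ?thesis .
qed

lemma distr_std_normal_scale:
  assumes "a > 0"
  shows "distr std_normal borel (\<lambda>x. a * x) = density lborel (normal_density 0 a)"
proof -
  have "distributed std_normal lborel (\<lambda>x. x) std_normal_density"
    by (simp add: distributed_def std_normal_measure_def distr_id2)
  from std_normal.normal_density_affine[OF this, of a 0] assms
  have "distributed std_normal lborel (\<lambda>x. a * x) (normal_density 0 a)"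
    by simp
  from distributed_distr_eq_density[OF this] show ?thesis
    by (simp cong: distr_cong)
qed

lemma std_normal_convolution:
  assumes "a > 0" "b > 0"
  shows "distr std_normal borel (\<lambda>x. a * x) \<star> distr std_normal borel (\<lambda>x. b * x)
       = distr std_normal borel (\<lambda>x. sqrt (a\<^sup>2 + b\<^sup>2) * x)"
proof -
  have "sqrt (a\<^sup>2 + b\<^sup>2) > 0"
    using assms by (simp add: sum_power2_gt_zero_iff)
  then show ?thesis
    using assms conv_normal_density_zero_mean[OF assms]
    by (simp add: distr_std_normal_scale convolution_density prob_space_normal_density
        prob_space.finite_measure ennreal_mult')
qed

lemma nn_integral_std_normal_convolution:
  assumes [measurable]: "f \<in> borel_measurable borel" and "a > 0" "b > 0"
  shows "(\<integral>\<^sup>+x. \<integral>\<^sup>+y. f (a * x + b * y) \<partial>std_normal \<partial>std_normal)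
       = (\<integral>\<^sup>+x. f (sqrt (a\<^sup>2 + b\<^sup>2) * x) \<partial>std_normal)"
proof -
  have "finite_measure (distr std_normal borel (\<lambda>x. c * x))" for c
    by (intro std_normal.finite_measure_distr) measurable
  then have "(\<integral>\<^sup>+x. \<integral>\<^sup>+y. f (a * x + b * y) \<partial>std_normal \<partial>std_normal)
      = (\<integral>\<^sup>+x. f x \<partial>(distr std_normal borel (\<lambda>x. a * x) \<star> distr std_normal borel (\<lambda>x. b * x)))"
    by (simp add: nn_integral_convolution nn_integral_distr)
  then show ?thesis
    by (simp add: std_normal_convolution assms nn_integral_distr)
qed

definition std_gauss :: "(real^'n::finite) measure" where
  "std_gauss = distr (PiM UNIV (\<lambda>_. std_normal)) borel (\<lambda>w. \<chi> i. w i)"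

lemma sets_std_gauss [simp, measurable_cong]: "sets std_gauss = sets borel"
  by (simp add: std_gauss_def)

lemma space_std_gauss [simp]: "space std_gauss = UNIV"
  by (simp add: std_gauss_def)

interpretation std_normal_prod: product_prob_space "\<lambda>_. std_normal" UNIV
  by unfold_locales

lemma measurable_vec_lambda_PiM [measurable]:
  "(\<lambda>w. \<chi> i. w i) \<in> borel_measurable (PiM (UNIV::'n::finite set) (\<lambda>_. std_normal))"
  by (rule borel_measurable_vec_lambda) measurable

interpretation std_gauss: prob_space "std_gauss :: (real^'n::finite) measure"
  unfolding std_gauss_def by (rule std_normal_prod.P.prob_space_distr) measurable

lemma std_gauss_eqI:
  fixes N :: "(real^'n::finite) measure"
  assumes sets_N: "sets N = sets borel"
    and box: "\<And>E. (\<And>i. E i \<in> sets borel) \<Longrightarrow>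
       emeasure N {v. \<forall>i. v $ i \<in> E i} = (\<Prod>i\<in>UNIV. emeasure std_normal (E i))"
  shows "N = std_gauss"
proof -
  note [measurable_cong] = sets_N
  have space_N: "space N = UNIV"
    using sets_eq_imp_space_eq[OF sets_N] by simp
  let ?P = "distr N (PiM UNIV (\<lambda>_. std_normal)) (\<lambda>v i. v $ i)"
  have coords: "(\<lambda>v i. v $ i) \<in> measurable N (PiM (UNIV::'n set) (\<lambda>_. std_normal))"
    by (rule measurable_PiM_single') auto
  have "?P = PiM UNIV (\<lambda>_. std_normal)"
  proof (rule std_normal_prod.PiM_eqI)
    fix E :: "'n \<Rightarrow> real set"
    assume E: "\<And>i. i \<in> UNIV \<Longrightarrow> E i \<in> sets std_normal"
    have "emeasure ?P (PiE UNIV E) = emeasure N ((\<lambda>v i. v $ i) -` PiE UNIV E \<inter> space N)"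
      by (rule emeasure_distr[OF coords]) (use E in \<open>auto intro!: sets_PiM_I_finite\<close>)
    also have "(\<lambda>v i. v $ i) -` PiE UNIV E \<inter> space N = {v. \<forall>i. v $ i \<in> E i}"
      by (auto simp: space_N)
    also have "emeasure N \<dots> = (\<Prod>i\<in>UNIV. emeasure std_normal (E i))"
      by (rule box) (use E in auto)
    finally show "emeasure ?P (PiE UNIV E) = (\<Prod>i\<in>UNIV. emeasure std_normal (E i))" .
  qed auto
  then have "std_gauss = distr ?P borel (\<lambda>w. \<chi> i. w i)"
    by (simp add: std_gauss_def)
  also have "\<dots> = distr N borel ((\<lambda>w. \<chi> i. w i) \<circ> (\<lambda>v i. v $ i))"
    by (rule distr_distr[OF _ coords]) measurable
  also have "\<dots> = N"
    using distr_id2[OF sets_N[symmetric]] by (simp add: comp_def)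
  finally show ?thesis ..
qed

lemma nn_integral_std_gauss_prod:
  fixes f :: "'n::finite \<Rightarrow> real \<Rightarrow> ennreal"
  assumes [measurable]: "\<And>i. f i \<in> borel_measurable borel"
  shows "(\<integral>\<^sup>+w. (\<Prod>i\<in>UNIV. f i (w $ i)) \<partial>std_gauss) = (\<Prod>i\<in>UNIV. \<integral>\<^sup>+x. f i x \<partial>std_normal)"
  unfolding std_gauss_def
  by (subst nn_integral_distr) (auto simp: std_normal_prod.product_nn_integral_prod)

lemma
  fixes f :: "'n::finite \<Rightarrow> real \<Rightarrow> real"
  assumes "\<And>i. integrable std_normal (f i)"
  shows integrable_std_gauss_prod: "integrable std_gauss (\<lambda>w. (\<Prod>i\<in>UNIV. f i (w $ i)))"
    and integral_std_gauss_prod: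
      "(\<integral>w. (\<Prod>i\<in>UNIV. f i (w $ i)) \<partial>std_gauss) = (\<Prod>i\<in>UNIV. \<integral>x. f i x \<partial>std_normal)"
proof -
  have [measurable]: "f i \<in> borel_measurable borel" for i
    using borel_measurable_integrable[OF assms, of i] by simp
  show "integrable std_gauss (\<lambda>w. (\<Prod>i\<in>UNIV. f i (w $ i)))"
    unfolding std_gauss_def
    by (subst integrable_distr_eq) (auto simp: std_normal_prod.product_integrable_prod assms)
  show "(\<integral>w. (\<Prod>i\<in>UNIV. f i (w $ i)) \<partial>std_gauss) = (\<Prod>i\<in>UNIV. \<integral>x. f i x \<partial>std_normal)"
    unfolding std_gauss_def
    by (subst integral_distr) (auto simp: std_normal_prod.product_integral_prod assms)
qed

lemma indicator_box:
  "indicator {v::real^'n::finite. \<forall>i. v $ i \<in> E i} w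
      = (\<Prod>i\<in>UNIV. indicator (E i) (w $ i) :: ennreal)"
proof (cases "\<forall>i. w $ i \<in> E i")
  case False
  then obtain i where "w $ i \<notin> E i" by auto
  then have "(\<Prod>i\<in>UNIV. indicator (E i) (w $ i) :: ennreal) = 0"
    by (intro prod_zero) (auto intro!: exI[of _ i])
  with False show ?thesis by simp
qed simp

lemma sets_borel_box [measurable]:
  assumes [measurable]: "\<And>i. E i \<in> sets borel"
  shows "{v::real^'n::finite. \<forall>i. v $ i \<in> E i} \<in> sets borel"
  by (rule sets_borel_Collect) measurable

definition cameron_martin :: "real^'n::finite \<Rightarrow> real^'n \<Rightarrow> real" where
  "cameron_martin s w = exp (s \<bullet> w - (s \<bullet> s) / 2)"

lemma cameron_martin_measurable [measurable]: "cameron_martin s \<in> borel_measurable borel"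
  unfolding cameron_martin_def by measurable

lemma cameron_martin_eq_prod:
  "ennreal (cameron_martin s w) = (\<Prod>i\<in>UNIV. ennreal (exp (s $ i * w $ i - (s $ i)\<^sup>2 / 2)))"
  by (subst prod_ennreal)
     (auto simp: cameron_martin_def inner_vec_def exp_sum[symmetric] sum_subtractf
       sum_divide_distrib power2_eq_square)

lemma distr_std_gauss_shift:
  fixes s :: "real^'n::finite"
  shows "distr std_gauss borel (\<lambda>w. w + s) = density std_gauss (cameron_martin s)"
proof -
  let ?D = "density std_gauss (cameron_martin s)"
  have "distr ?D borel (\<lambda>w. w - s) = std_gauss"
  proof (rule std_gauss_eqI)
    fix E :: "'n \<Rightarrow> real set"
    assume E [measurable]: "\<And>i. E i \<in> sets borel"
    let ?B = "{v::real^'n. \<forall>i. v $ i \<in> E i}"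
    have [measurable]: "?B \<in> sets borel" by (rule sets_borel_box[OF E])
    have "emeasure (distr ?D borel (\<lambda>w. w - s)) ?B
        = (\<integral>\<^sup>+w. indicator ?B w \<partial>distr ?D borel (\<lambda>w. w - s))"
      by simp
    also have "\<dots> = (\<integral>\<^sup>+w. ennreal (cameron_martin s w) * indicator ?B (w - s) \<partial>std_gauss)"
      by (subst nn_integral_distr) (auto simp: nn_integral_density)
    also have "\<dots> = (\<integral>\<^sup>+w. (\<Prod>i\<in>UNIV. indicator (E i) (w $ i - s $ i)
        * ennreal (exp (s $ i * w $ i - (s $ i)\<^sup>2 / 2))) \<partial>std_gauss)"
      by (simp add: cameron_martin_eq_prod indicator_box prod.distrib mult.commute)
    also have "\<dots> = (\<Prod>i\<in>UNIV. \<integral>\<^sup>+x. indicator (E i) (x - s $ i)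
        * ennreal (exp (s $ i * x - (s $ i)\<^sup>2 / 2)) \<partial>std_normal)"
      by (subst nn_integral_std_gauss_prod[symmetric]) auto
    also have "\<dots> = (\<Prod>i\<in>UNIV. \<integral>\<^sup>+x. indicator (E i) x \<partial>std_normal)"
      by (subst nn_integral_std_normal_shift[symmetric]) auto
    finally show "emeasure (distr ?D borel (\<lambda>w. w - s)) ?B = (\<Prod>i\<in>UNIV. emeasure std_normal (E i))"
      by simp
  qed simp
  then have "distr std_gauss borel (\<lambda>w. w + s)
      = distr (distr ?D borel (\<lambda>w. w - s)) borel (\<lambda>w. w + s)"
    by simp
  also have "\<dots> = distr ?D borel ((\<lambda>w. w + s) \<circ> (\<lambda>w. w - s))"
    by (rule distr_distr) auto
  also have "\<dots> = ?D"
    by (simp add: comp_def distr_id2)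
  finally show ?thesis .
qed

lemma integral_std_gauss_shift:
  fixes F :: "real^'n::finite \<Rightarrow> real"
  assumes [measurable]: "F \<in> borel_measurable borel"
  shows "(\<integral>w. F (w + s) \<partial>std_gauss) = (\<integral>w. cameron_martin s w * F w \<partial>std_gauss)"
proof -
  have "(\<integral>w. F (w + s) \<partial>std_gauss) = (\<integral>w. F w \<partial>distr std_gauss borel (\<lambda>w. w + s))"
    by (rule integral_distr[symmetric]) auto
  also have "\<dots> = (\<integral>w. cameron_martin s w * F w \<partial>std_gauss)"
    unfolding distr_std_gauss_shift by (subst integral_density) (auto simp: cameron_martin_def)
  finally show ?thesis .
qed

lemma
  fixes s :: "real^'n::finite"
  shows integral_cameron_martin: "(\<integral>w. cameron_martin s w \<partial>std_gauss) = 1"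
    and integrable_cameron_martin: "integrable std_gauss (cameron_martin s)"
proof -
  show "(\<integral>w. cameron_martin s w \<partial>std_gauss) = 1"
    using integral_std_gauss_shift[of "\<lambda>_. 1" s] std_gauss.prob_space[where 'n='n] by simp
  then show "integrable std_gauss (cameron_martin s)"
    using not_integrable_integral_eq by fastforce
qed

lemma std_gauss_convolution:
  assumes "a > 0" "b > 0"
  shows "distr std_gauss borel (\<lambda>w. a *\<^sub>R w) \<star> distr std_gauss borel (\<lambda>w. b *\<^sub>R w)
       = distr (std_gauss :: (real^'n::finite) measure) borel (\<lambda>w. sqrt (a\<^sup>2 + b\<^sup>2) *\<^sub>R w)"
    (is "?M \<star> ?N = distr _ _ (\<lambda>w. ?c *\<^sub>R w)")
proof -
  have finite: "finite_measure ?M" "finite_measure ?N"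
    by (intro std_gauss.finite_measure_distr; measurable)+
  have "distr (?M \<star> ?N) borel (\<lambda>w. (1 / ?c) *\<^sub>R w) = std_gauss" (is "?D = _")
  proof (rule std_gauss_eqI)
    fix E :: "'n \<Rightarrow> real set"
    assume E [measurable]: "\<And>i. E i \<in> sets borel"
    let ?B = "{v::real^'n. \<forall>i. v $ i \<in> E i}"
    have [measurable]: "?B \<in> sets borel" by (rule sets_borel_box[OF E])
    have "emeasure ?D ?B = (\<integral>\<^sup>+w. indicator ?B w \<partial>?D)" by simp
    also have "\<dots> = (\<integral>\<^sup>+v. \<integral>\<^sup>+w. indicator ?B ((1 / ?c) *\<^sub>R (a *\<^sub>R v + b *\<^sub>R w)) \<partial>std_gauss \<partial>std_gauss)"
      by (simp add: nn_integral_distr nn_integral_convolution finite del: nn_integral_indicator)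
    also have "\<dots> = (\<integral>\<^sup>+v. (\<Prod>i\<in>UNIV. \<integral>\<^sup>+y.
        indicator (E i) ((1 / ?c) * (a * v $ i + b * y)) \<partial>std_normal) \<partial>std_gauss)"
      unfolding indicator_box
      by (intro nn_integral_cong, subst nn_integral_std_gauss_prod[symmetric]) auto
    also have "\<dots> = (\<Prod>i\<in>UNIV. \<integral>\<^sup>+x. \<integral>\<^sup>+y.
        indicator (E i) ((1 / ?c) * (a * x + b * y)) \<partial>std_normal \<partial>std_normal)"
      by (subst nn_integral_std_gauss_prod[symmetric]) auto
    also have "\<dots> = (\<Prod>i\<in>UNIV. \<integral>\<^sup>+x. indicator (E i) ((1 / ?c) * (?c * x)) \<partial>std_normal)"
      by (intro prod.cong refl assms
          nn_integral_std_normal_convolution[where f="\<lambda>u. indicator (E _) ((1 / ?c) * u)"])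
         measurable
    also have "\<dots> = (\<Prod>i\<in>UNIV. emeasure std_normal (E i))"
      using assms by simp
    finally show "emeasure ?D ?B = (\<Prod>i\<in>UNIV. emeasure std_normal (E i))" .
  qed simp
  then have "distr std_gauss borel (\<lambda>w. ?c *\<^sub>R w) = distr ?D borel (\<lambda>w::real^'n. ?c *\<^sub>R w)" by simp
  also have "\<dots> = distr (?M \<star> ?N) borel ((\<lambda>w. ?c *\<^sub>R w) \<circ> (\<lambda>w. (1 / ?c) *\<^sub>R w))"
    by (rule distr_distr) auto
  also have "\<dots> = (?M \<star> ?N)"
    using assms by (simp add: comp_def distr_id2)
  finally show ?thesis ..
qed

definition vec_upd :: "real^'n::finite \<Rightarrow> 'n \<Rightarrow> real \<Rightarrow> real^'n" where
  "vec_upd w j t = (\<chi> i. if i = j then t else w $ i)"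

lemma vec_upd_measurable [measurable]:
  "(\<lambda>(w, t). vec_upd w j t) \<in> borel_measurable (std_gauss \<Otimes>\<^sub>M std_normal)"
  "vec_upd w j \<in> borel_measurable borel"
  unfolding vec_upd_def case_prod_beta' by measurable

lemma distr_std_gauss_vec_upd:
  fixes j :: "'n::finite"
  shows "distr (std_gauss \<Otimes>\<^sub>M std_normal) borel (\<lambda>(w, t). vec_upd w j t) = std_gauss" (is "?D = _")
proof (rule std_gauss_eqI)
  fix E :: "'n \<Rightarrow> real set"
  assume E [measurable]: "\<And>i. E i \<in> sets borel"
  let ?B = "{v::real^'n. \<forall>i. v $ i \<in> E i}"
  have [measurable]: "?B \<in> sets borel" by (rule sets_borel_box[OF E])
  have "emeasure ?D ?B = (\<integral>\<^sup>+z.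
      indicator ?B (case z of (w, t) \<Rightarrow> vec_upd w j t) \<partial>(std_gauss \<Otimes>\<^sub>M std_normal))"
    by (subst nn_integral_indicator[symmetric], simp, subst nn_integral_distr) auto
  also have "\<dots> = (\<integral>\<^sup>+w. \<integral>\<^sup>+t. indicator ?B (vec_upd w j t) \<partial>std_normal \<partial>std_gauss)"
    by (subst std_normal.nn_integral_fst[symmetric]) auto
  also have "\<dots> = (\<integral>\<^sup>+w. \<integral>\<^sup>+t. indicator (E j) t * (\<Prod>i\<in>UNIV-{j}.
      indicator (E i) (w $ i)) \<partial>std_normal \<partial>std_gauss)"
    unfolding indicator_box by (intro nn_integral_cong)
        (subst prod.remove[of _ j], auto simp: vec_upd_def)
  also have "\<dots> = (\<integral>\<^sup>+w. (\<Prod>i\<in>UNIV.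
      if i = j then emeasure std_normal (E j) else indicator (E i) (w $ i)) \<partial>std_gauss)"
    by (simp add: nn_integral_multc) (intro nn_integral_cong, subst (2) prod.remove[of _ j], auto)
  also have "\<dots> = (\<Prod>i\<in>UNIV. \<integral>\<^sup>+x.
      (if i = j then emeasure std_normal (E j) else indicator (E i) x) \<partial>std_normal)"
    by (rule nn_integral_std_gauss_prod) measurable
  also have "\<dots> = (\<Prod>i\<in>UNIV. emeasure std_normal (E i))"
  proof (rule prod.cong)
    show "(\<integral>\<^sup>+x. (if i = j then emeasure std_normal (E j) else indicator (E i) x) \<partial>std_normal)
        = emeasure std_normal (E i)" for i
      using std_normal.emeasure_space_1 by (cases "i = j") auto
  qed simp
  finally show "emeasure ?D ?B = (\<Prod>i\<in>UNIV. emeasure std_normal (E i))" .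
qed simp

lemma emeasure_std_gauss_lines:
  fixes j :: "'n::finite"
  assumes [measurable]: "S \<in> sets borel"
  shows "emeasure std_gauss S = (\<integral>\<^sup>+w. emeasure std_normal {t. vec_upd w j t \<in> S} \<partial>std_gauss)"
proof -
  have line: "(\<integral>\<^sup>+t. indicator S (vec_upd w j t) \<partial>std_normal)
      = emeasure std_normal {t. vec_upd w j t \<in> S}" for w
  proof -
    have [measurable]: "{t. vec_upd w j t \<in> S} \<in> sets borel" by (rule sets_borel_Collect) measurable
    have "indicator S (vec_upd w j t) = (indicator {t. vec_upd w j t \<in> S} t :: ennreal)" for t
      by (simp add: indicator_def)
    then show ?thesis by simp
  qed
  have "emeasure std_gauss S
      = emeasure (distr (std_gauss \<Otimes>\<^sub>M std_normal) borel (\<lambda>(w, t). vec_upd w j t)) S"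
    by (simp add: distr_std_gauss_vec_upd)
  also have "\<dots> = (\<integral>\<^sup>+z. indicator S (case z of (w, t) \<Rightarrow> vec_upd w j t) \<partial>(std_gauss \<Otimes>\<^sub>M std_normal))"
    by (subst nn_integral_indicator[symmetric], simp, subst nn_integral_distr) auto
  also have "\<dots> = (\<integral>\<^sup>+w. emeasure std_normal {t. vec_upd w j t \<in> S} \<partial>std_gauss)"
    by (subst std_normal.nn_integral_fst[symmetric]) (auto simp: line)
  finally show ?thesis .
qed

lemma integrable_std_normal_exp: "integrable std_normal (\<lambda>x. exp (c * x))"
proof -
  have "(\<integral>\<^sup>+x. ennreal (exp (c * x - c\<^sup>2 / 2)) \<partial>std_normal) = 1"
    using nn_integral_std_normal_shift[of "\<lambda>_. 1" c] std_normal.emeasure_space_1 by simp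
  then have "integrable std_normal (\<lambda>x. exp (c * x - c\<^sup>2 / 2))"
    by (intro integrableI_nonneg) auto
  from integrable_mult_right[OF this, of "exp (c\<^sup>2 / 2)"] show ?thesis
    by (simp flip: exp_add)
qed

lemma integrable_std_normal_exp_abs: "integrable std_normal (\<lambda>x. exp (c * \<bar>x\<bar>))"
proof (rule Bochner_Integration.integrable_bound)
  show "integrable std_normal (\<lambda>x. exp (c * x) + exp (- c * x))"
    by (intro Bochner_Integration.integrable_add integrable_std_normal_exp)
  have "exp (c * \<bar>x\<bar>) \<le> exp (c * x) + exp (- c * x)" for x
    by (cases "x \<ge> 0") auto
  then show "AE x in std_normal. norm (exp (c * \<bar>x\<bar>)) \<le> norm (exp (c * x) + exp (- c * x))"
    by (auto intro: order_trans[OF _ abs_ge_self])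
qed measurable

lemma integrable_std_gauss_exp_norm:
  assumes "c \<ge> 0"
  shows "integrable (std_gauss :: (real^'n::finite) measure) (\<lambda>w. exp (c * norm w))"
proof (rule Bochner_Integration.integrable_bound)
  show "integrable std_gauss (\<lambda>w::real^'n. \<Prod>i\<in>UNIV. exp (c * \<bar>w $ i\<bar>))"
    by (rule integrable_std_gauss_prod) (rule integrable_std_normal_exp_abs)
  have "c * norm w \<le> c * (\<Sum>i\<in>UNIV. \<bar>w $ i\<bar>)" for w :: "real^'n"
    by (intro mult_left_mono norm_le_l1_cart assms)
  then show "AE w in std_gauss. norm (exp (c * norm w))
      \<le> norm (\<Prod>i\<in>UNIV. exp (c * \<bar>(w::real^'n) $ i\<bar>))"
    by (simp add: exp_sum[symmetric] sum_distrib_left prod_nonneg)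
qed measurable

lemma power_le_fact_exp:
  assumes "0 \<le> (x::real)"
  shows "x ^ k \<le> fact k * exp x"
proof -
  have "x ^ k / fact k \<le> exp x"
    using sum_le_suminf[OF summable_exp_generic[of x], of "{k}"] assms
    by (simp add: exp_def field_simps)
  then show ?thesis
    by (simp add: divide_le_eq mult.commute)
qed

lemma integrable_std_gauss_norm_power: "integrable std_gauss (\<lambda>w :: real^'n::finite. norm w ^ k)"
proof (rule Bochner_Integration.integrable_bound)
  show "integrable std_gauss (\<lambda>w::real^'n. fact k * exp (1 * norm w))"
    by (intro integrable_mult_right integrable_std_gauss_exp_norm) simp
  show "AE w in std_gauss. norm (norm w ^ k) \<le> norm (fact k * exp (1 * norm (w::real^'n)))"
    by (intro AE_I2) (simp add: power_le_fact_exp)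
qed measurable

lemma integrable_std_normal_power: "integrable std_normal (\<lambda>x. x ^ k)"
  using integrable_std_normal_moment[of k]
  by (simp add: std_normal_measure_def integrable_density)

lemma std_normal_mean: "(\<integral>x. x \<partial>std_normal) = 0"
  and std_normal_second_moment: "(\<integral>x. x\<^sup>2 \<partial>std_normal) = 1"
  using integral_std_normal_moment_odd[of 0] integral_std_normal_moment_even[of 1]
  by (simp_all add: std_normal_measure_def integral_density)

lemma std_gauss_mean_nth:
  fixes i :: "'n::finite"
  shows "(\<integral>w. w $ i \<partial>std_gauss) = 0"
proof -
  let ?f = "\<lambda>l x. if l = i then x else (1::real)"
  have "(\<integral>w. w $ i \<partial>std_gauss) = (\<integral>w. (\<Prod>l\<in>UNIV. ?f l (w $ l)) \<partial>(std_gauss::(real^'n) measure))"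
    by (simp add: prod.delta)
  also have "\<dots> = (\<Prod>l\<in>UNIV. \<integral>x. ?f l x \<partial>std_normal)"
  proof (rule integral_std_gauss_prod)
    show "integrable std_normal (?f l)" for l
      using integrable_std_normal_power[of 1] by (cases "l = i") auto
  qed
  also have "\<dots> = 0"
    by (rule prod_zero) (auto intro!: exI[of _ i] simp: std_normal_mean)
  finally show ?thesis .
qed

lemma std_gauss_second_moment_nth:
  fixes i k :: "'n::finite"
  shows "(\<integral>w. w $ i * w $ k \<partial>std_gauss) = (if i = k then 1 else 0)"
proof -
  let ?f = "\<lambda>l x. (if l = i then x else 1) * (if l = k then x else (1::real))"
  have "(\<integral>w. w $ i * w $ k \<partial>std_gauss)
      = (\<integral>w. (\<Prod>l\<in>UNIV. ?f l (w $ l)) \<partial>(std_gauss::(real^'n) measure))"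
    by (simp add: prod.distrib prod.delta)
  also have "\<dots> = (\<Prod>l\<in>UNIV. \<integral>x. ?f l x \<partial>std_normal)"
  proof (rule integral_std_gauss_prod)
    show "integrable std_normal (?f l)" for l
      using integrable_std_normal_power[of 1] integrable_std_normal_power[of 2]
      by (cases "l = i"; cases "l = k") (auto simp: power2_eq_square)
  qed
  also have "\<dots> = (if i = k then 1 else 0)"
  proof (cases "i = k")
    case True
    then have "(\<integral>x. ?f l x \<partial>std_normal) = 1" for l
      using std_normal.prob_space std_normal_second_moment
      by (cases "l = i") (auto simp: power2_eq_square)
    with True show ?thesis by simp
  next
    case False
    then have "(\<integral>x. ?f i x \<partial>std_normal) = 0" by (simp add: std_normal_mean)
    with False show ?thesis by (auto intro!: prod_zero exI[of _ i])
  qed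
  finally show ?thesis .
qed

section \<open>Borel laws with three moments\<close>

definition bdd_borel :: "real \<Rightarrow> ('v::topological_space \<Rightarrow> real) \<Rightarrow> bool" where
  "bdd_borel K f \<longleftrightarrow> f \<in> borel_measurable borel \<and> (\<forall>x. \<bar>f x\<bar> \<le> K)"

lemma bdd_borel_measurable: "bdd_borel K f \<Longrightarrow> f \<in> borel_measurable borel"
  by (simp add: bdd_borel_def)

lemma bdd_borelD: "bdd_borel K f \<Longrightarrow> \<bar>f x\<bar> \<le> K"
  by (simp add: bdd_borel_def)

lemma bdd_borel_nonneg: "bdd_borel K f \<Longrightarrow> 0 \<le> K"
  using order_trans[OF abs_ge_zero bdd_borelD] .

lemma bdd_borel_compose:
  assumes "bdd_borel K f" "T \<in> borel_measurable borel"
  shows "bdd_borel K (\<lambda>x. f (T x))"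
  using assms by (auto simp: bdd_borel_def intro: measurable_compose)

lemma bdd_borel_diff:
  assumes "bdd_borel K f" "bdd_borel L g" "\<And>x. \<bar>f x - g x\<bar> \<le> B"
  shows "bdd_borel B (\<lambda>x. f x - g x)"
  using assms by (auto simp: bdd_borel_def)

locale borel_law = prob_space M for M :: "'v::ordered_euclidean_space measure" +
  assumes sets_eq_borel [simp, measurable_cong]: "sets M = sets borel"
begin


lemma integrable_bdd_borel:
  assumes "bdd_borel K f"
  shows "integrable M f"
  using assms by (intro integrable_const_bound[where B=K]) (auto simp: bdd_borel_def)

lemma abs_integral_bdd_borel_le:
  assumes "bdd_borel K f"
  shows "\<bar>\<integral>x. f x \<partial>M\<bar> \<le> K"
  using integral_abs_bound_integral[OF integrable_bdd_borel[OF assms], of "\<lambda>_. K"]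
      bdd_borelD[OF assms] prob_space
  by simp

end

definition second_moment :: "(real^'n::finite) measure \<Rightarrow> real^'n^'n" where
  "second_moment M = (\<chi> i j. \<integral>x. x $ i * x $ j \<partial>M)"

definition quad_poly :: "real \<Rightarrow> real^'n \<Rightarrow> real^'n^'n \<Rightarrow> real^'n::finite \<Rightarrow> real" where
  "quad_poly c b B x = c + b \<bullet> x + (\<Sum>i\<in>UNIV. \<Sum>j\<in>UNIV. B $ i $ j * (x $ i * x $ j))"

locale third_moment_law = borel_law M for M :: "(real^'n::finite) measure" +
  assumes integrable_norm_cubed: "integrable M (\<lambda>x. norm x ^ 3)"
begin

lemma integrable_le_norm_power:
  fixes f :: "real^'n \<Rightarrow> 'b::{banach, second_countable_topology}"
  assumes [measurable]: "f \<in> borel_measurable borel"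
    and "k \<le> 3" "\<And>x. norm (f x) \<le> norm x ^ k"
  shows "integrable M f"
proof (rule Bochner_Integration.integrable_bound)
  show "integrable M (\<lambda>x. 1 + norm x ^ 3)"
    by (intro Bochner_Integration.integrable_add integrable_norm_cubed) simp
  have "norm (f x) \<le> 1 + norm x ^ 3" for x
  proof (cases "norm x \<le> 1")
    case True
    then have "norm x ^ k \<le> 1" by (simp add: power_le_one)
    then show ?thesis using assms(3)[of x] by (simp add: add_increasing2)
  next
    case False
    then have "norm x ^ k \<le> norm x ^ 3"
      using assms(2) by (intro power_increasing) auto
    then show ?thesis using assms(3)[of x] by simp
  qed
  then show "AE x in M. norm (f x) \<le> norm (1 + norm x ^ 3)"
    by (auto intro: order_trans[OF _ abs_ge_self])
qed measurable

lemma integrable_id: "integrable M (\<lambda>x. x)"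
  by (rule integrable_le_norm_power[where k=1]) auto

lemma integrable_nth: "integrable M (\<lambda>x. x $ i)"
  by (rule integrable_le_norm_power[where k=1]) (auto simp: component_le_norm_cart)

lemma integrable_nth_mult: "integrable M (\<lambda>x. x $ i * x $ j)"
  by (rule integrable_le_norm_power[where k=2])
     (auto simp: abs_mult power2_eq_square intro!: mult_mono component_le_norm_cart)

lemma integral_nth: "(\<integral>x. x $ i \<partial>M) = (\<integral>x. x \<partial>M) $ i"
  by (rule integral_bounded_linear[OF bounded_linear_vec_nth integrable_id])

lemma
  shows integrable_quad_poly: "integrable M (quad_poly c b B)"
    and integral_quad_poly: "(\<integral>x. quad_poly c b B x \<partial>M)
      = c + b \<bullet> (\<integral>x. x \<partial>M) + (\<Sum>i\<in>UNIV. \<Sum>j\<in>UNIV. B $ i $ j * second_moment M $ i $ j)"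
  unfolding quad_poly_def second_moment_def
  using prob_space by (simp_all add: integrable_id integrable_nth_mult)

lemma third_moment_law_distr:
  fixes B :: "real^'n^'m::finite"
  shows "third_moment_law (distr M borel ((*v) B))"
proof (intro third_moment_law.intro borel_law.intro third_moment_law_axioms.intro
    borel_law_axioms.intro)
  show "prob_space (distr M borel ((*v) B))"
    by (rule prob_space_distr) measurable
  have "integrable M (\<lambda>x. norm (B *v x) ^ 3)"
  proof (rule Bochner_Integration.integrable_bound)
    show "integrable M (\<lambda>x. onorm ((*v) B) ^ 3 * norm x ^ 3)"
      by (intro integrable_mult_right integrable_norm_cubed)
    have "norm (B *v x) ^ 3 \<le> (onorm ((*v) B) * norm x) ^ 3" for x
      by (intro power_mono onorm matrix_vector_mul_bounded_linear) simp
    then show "AE x in M. norm (norm (B *v x) ^ 3) \<le> norm (onorm ((*v) B) ^ 3 * norm x ^ 3)"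
      by (auto simp: power_mult_distrib intro: order_trans[OF _ abs_ge_self])
  qed measurable
  then show "integrable (distr M borel ((*v) B)) (\<lambda>x. norm x ^ 3)"
    by (simp add: integrable_distr_eq)
qed simp

lemma mean_distr_matrix:
  fixes B :: "real^'n^'m::finite"
  shows "(\<integral>x. x \<partial>distr M borel ((*v) B)) = B *v (\<integral>x. x \<partial>M)"
  by (simp add: integral_distr
      integral_bounded_linear[OF matrix_vector_mul_bounded_linear integrable_id])

lemma second_moment_distr_matrix:
  fixes B :: "real^'n^'m::finite"
  shows "second_moment (distr M borel ((*v) B)) = B ** second_moment M ** transpose B"
proof -
  have "(\<integral>x. (B *v x) $ i * (B *v x) $ j \<partial>M)
      = (\<Sum>k\<in>UNIV. \<Sum>l\<in>UNIV. B $ i $ k * B $ j $ l * (\<integral>x. x $ k * x $ l \<partial>M))" for i j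
  proof -
    have "(B *v x) $ i * (B *v x) $ j = (\<Sum>k\<in>UNIV. \<Sum>l\<in>UNIV. B $ i $ k * B $ j $ l * (x $ k * x $ l))"
      for x
      by (simp add: matrix_vector_mult_def sum_product mult_ac)
    then show ?thesis
      by (simp add: integrable_nth_mult)
  qed
  also have "(\<Sum>k\<in>UNIV. \<Sum>l\<in>UNIV. B $ i $ k * B $ j $ l * (\<integral>x. x $ k * x $ l \<partial>M))
      = (B ** second_moment M ** transpose B) $ i $ j" for i j
    by (subst sum.swap) (simp add: matrix_matrix_mult_def transpose_def second_moment_def
        sum_distrib_left sum_distrib_right mult_ac)
  finally show ?thesis
    by (simp add: vec_eq_iff second_moment_def integral_distr)
qed

end

interpretation std_gauss: third_moment_law "std_gauss :: (real^'n::finite) measure"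
  by unfold_locales (simp_all add: integrable_std_gauss_norm_power)

lemma std_gauss_mean: "(\<integral>w. w \<partial>(std_gauss :: (real^'n::finite) measure)) = 0"
  by (simp add: vec_eq_iff std_gauss.integral_nth[symmetric] std_gauss_mean_nth)

lemma second_moment_std_gauss: "second_moment (std_gauss :: (real^'n::finite) measure) = mat 1"
  by (simp add: vec_eq_iff second_moment_def std_gauss_second_moment_nth mat_def)

section \<open>Third-order expansion of Gaussian averages\<close>

definition cameron_martin_rem :: "real^'n::finite \<Rightarrow> real^'n \<Rightarrow> real" where
  "cameron_martin_rem s w = cameron_martin s w - (1 + s \<bullet> w + ((s \<bullet> w)\<^sup>2 - s \<bullet> s) / 2)"

lemma cameron_martin_rem_measurable [measurable]: "cameron_martin_rem s \<in> borel_measurable borel"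
  unfolding cameron_martin_rem_def by measurable

lemma abs_exp_minus_quadratic_le:
  fixes v t y :: real
  assumes v: "\<bar>v\<bar> \<le> t * y" and t: "0 \<le> t" "t \<le> 1" and y: "y \<ge> 0"
  shows "\<bar>exp v - (1 + v + v\<^sup>2 / 2)\<bar> \<le> 3 * (t ^ 3 * exp (2 * y))"
proof -
  have "t * y \<le> y" using t y by (simp add: mult_left_le_one_le)
  with v have "\<bar>v\<bar> \<le> y" by linarith
  have "\<bar>exp v - (1 + v + v\<^sup>2 / 2)\<bar> \<le> exp \<bar>v\<bar> * \<bar>v\<bar> ^ 3 / 2"
    using Taylor_exp_field[of v 2] by (simp add: eval_nat_numeral)
  also have "\<dots> \<le> exp y * (t * y) ^ 3 / 2"
    using v \<open>\<bar>v\<bar> \<le> y\<close> by (intro divide_right_mono mult_mono power_mono) auto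
  also have "\<dots> = t ^ 3 * (exp y * (y ^ 3 / 2))" by (simp add: power_mult_distrib)
  also have "\<dots> \<le> t ^ 3 * (exp y * (3 * exp y))"
    using power_le_fact_exp[of y 3] t y by (intro mult_left_mono) (auto simp: fact_numeral)
  also have "\<dots> = 3 * (t ^ 3 * exp (2 * y))" by (simp flip: exp_add)
  finally show ?thesis .
qed

lemma abs_cameron_martin_rem_le_small:
  fixes s w :: "real^'n::finite"
  assumes "norm s \<le> 1"
  shows "\<bar>cameron_martin_rem s w\<bar> \<le> 4 * norm s ^ 3 * exp (2 * (norm w + 1))"
proof -
  define t y where "t = norm s" and "y = norm w + 1"
  define v where "v = s \<bullet> w - t\<^sup>2 / 2"
  have t: "0 \<le> t" "t \<le> 1" and y: "y \<ge> 1" using assms by (auto simp: t_def y_def)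
  have s_inner: "s \<bullet> s = t\<^sup>2" by (simp add: t_def power2_norm_eq_inner)
  have sw: "\<bar>s \<bullet> w\<bar> \<le> t * (y - 1)"
    using Cauchy_Schwarz_ineq2[of s w] by (simp add: t_def y_def)
  have t_sq: "t\<^sup>2 \<le> t" using t by (simp add: power2_eq_square mult_left_le)
  have "\<bar>v\<bar> \<le> t * (y - 1) + t"
    using sw t_sq zero_le_power2[of t] unfolding v_def by linarith
  then have "\<bar>v\<bar> \<le> t * y" by (simp add: algebra_simps)
  then have taylor: "\<bar>exp v - (1 + v + v\<^sup>2 / 2)\<bar> \<le> 3 * (t ^ 3 * exp (2 * y))"
    using t y by (intro abs_exp_minus_quadratic_le) auto
  have "(t\<^sup>2)\<^sup>2 / 8 - (s \<bullet> w) * t\<^sup>2 / 2 = t\<^sup>2 * (t\<^sup>2 / 8 - (s \<bullet> w) / 2)"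
    by (simp add: power2_eq_square[of "t\<^sup>2"] algebra_simps)
  then have "\<bar>(t\<^sup>2)\<^sup>2 / 8 - (s \<bullet> w) * t\<^sup>2 / 2\<bar> = t\<^sup>2 * \<bar>t\<^sup>2 / 8 - (s \<bullet> w) / 2\<bar>"
    by (simp only: abs_mult) simp
  also have "\<dots> \<le> t\<^sup>2 * (t * y)"
  proof (rule mult_left_mono)
    have "\<bar>t\<^sup>2 / 8 - (s \<bullet> w) / 2\<bar> \<le> t * (y - 1) + t"
      using sw t_sq zero_le_power2[of t] by linarith
    then show "\<bar>t\<^sup>2 / 8 - (s \<bullet> w) / 2\<bar> \<le> t * y" by (simp add: algebra_simps)
  qed simp
  also have "\<dots> \<le> t ^ 3 * exp (2 * y)"
    using t order_trans[OF exp_ge_add_one_self[of y], of "exp (2 * y)"] y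
    by (auto simp: power2_eq_square power3_eq_cube mult.assoc intro!: mult_left_mono)
  finally have mixed_terms: "\<bar>(t\<^sup>2)\<^sup>2 / 8 - (s \<bullet> w) * t\<^sup>2 / 2\<bar> \<le> t ^ 3 * exp (2 * y)" .
  have "cameron_martin_rem s w = (exp v - (1 + v + v\<^sup>2 / 2)) + ((t\<^sup>2)\<^sup>2 / 8 - (s \<bullet> w) * t\<^sup>2 / 2)"
    by (simp add: cameron_martin_rem_def cameron_martin_def v_def s_inner power2_eq_square
        field_simps)
  then show ?thesis
    using taylor mixed_terms by (simp add: t_def y_def)
qed

lemma abs_cameron_martin_rem_le_large:
  fixes s w :: "real^'n::finite"
  assumes "norm s \<ge> 1"
  shows "\<bar>cameron_martin_rem s w\<bar> \<le> cameron_martin s w + 4 * norm s ^ 3 * exp (2 * (norm w + 1))"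
proof -
  define t y where "t = norm s" and "y = norm w"
  have t: "t \<ge> 1" and y: "y \<ge> 0" using assms by (auto simp: t_def y_def)
  have powers: "1 \<le> t ^ 3" "t \<le> t ^ 3" "t\<^sup>2 \<le> t ^ 3"
    using t power_increasing[of 1 3 t] power_increasing[of 2 3 t] by auto
  have sw: "\<bar>s \<bullet> w\<bar> \<le> t * y"
    using Cauchy_Schwarz_ineq2[of s w] by (simp add: t_def y_def)
  then have "(s \<bullet> w)\<^sup>2 \<le> t\<^sup>2 * y\<^sup>2"
    by (simp add: abs_le_square_iff[symmetric] power_mult_distrib[symmetric] t_def y_def)
  then have "\<bar>((s \<bullet> w)\<^sup>2 - t\<^sup>2) / 2\<bar> \<le> t\<^sup>2 * y\<^sup>2 / 2 + t\<^sup>2 / 2"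
    using abs_triangle_ineq4[of "(s \<bullet> w)\<^sup>2" "t\<^sup>2"] by simp
  moreover have s_inner: "s \<bullet> s = t\<^sup>2"
    by (simp add: t_def power2_norm_eq_inner)
  ultimately have "\<bar>1 + s \<bullet> w + ((s \<bullet> w)\<^sup>2 - s \<bullet> s) / 2\<bar> \<le> 1 + t * y + t\<^sup>2 * y\<^sup>2 / 2 + t\<^sup>2 / 2"
    using sw unfolding s_inner by linarith
  also have "\<dots> \<le> t ^ 3 + t ^ 3 * y + t ^ 3 * y\<^sup>2 / 2 + t ^ 3 / 2"
    using powers y by (intro add_mono mult_right_mono divide_right_mono) auto
  also have "\<dots> = t ^ 3 * (3 / 2 + y + y\<^sup>2 / 2)"
    by (simp add: algebra_simps)
  also have "\<dots> \<le> t ^ 3 * (4 * exp (2 * (y + 1)))"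
  proof (rule mult_left_mono)
    have "3 / 2 + y + y\<^sup>2 / 2 \<le> 2 * exp y"
      using exp_lower_Taylor_quadratic[OF y] one_le_exp_iff[of y] y by linarith
    also have "\<dots> \<le> 4 * exp (2 * (y + 1))" using y by (intro mult_mono) auto
    finally show "3 / 2 + y + y\<^sup>2 / 2 \<le> 4 * exp (2 * (y + 1))" .
  qed (use t in simp)
  finally have "\<bar>1 + s \<bullet> w + ((s \<bullet> w)\<^sup>2 - s \<bullet> s) / 2\<bar> \<le> 4 * norm s ^ 3 * exp (2 * (norm w + 1))"
    by (simp add: t_def y_def mult.left_commute mult.assoc)
  then show ?thesis
    using exp_ge_zero[of "s \<bullet> w - s \<bullet> s / 2"]
    unfolding cameron_martin_rem_def cameron_martin_def by linarith
qed

definition cameron_martin_const :: "'n::finite itself \<Rightarrow> real" where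
  "cameron_martin_const _ = 1 + 4 * (\<integral>w. exp (2 * (norm w + 1)) \<partial>(std_gauss :: (real^'n) measure))"

lemma cameron_martin_const_ge_1: "cameron_martin_const TYPE('n::finite) \<ge> 1"
  by (simp add: cameron_martin_const_def)

lemma
  fixes s :: "real^'n::finite"
  shows integrable_cameron_martin_rem: "integrable std_gauss (cameron_martin_rem s)"
    and integral_abs_cameron_martin_rem_le:
      "(\<integral>w. \<bar>cameron_martin_rem s w\<bar> \<partial>std_gauss) \<le> cameron_martin_const TYPE('n) * norm s ^ 3"
proof -
  let ?bound = "\<lambda>w. (if norm s \<le> 1 then 0 else cameron_martin s w)
      + 4 * norm s ^ 3 * exp (2 * (norm w + 1))"
  have bound: "\<bar>cameron_martin_rem s w\<bar> \<le> ?bound w" for w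
    using abs_cameron_martin_rem_le_small[of s w] abs_cameron_martin_rem_le_large[of s w] by simp
  have int_exp: "integrable (std_gauss :: (real^'n) measure) (\<lambda>w. exp (2 * (norm w + 1)))"
    using integrable_mult_right[OF integrable_std_gauss_exp_norm[of 2], of "exp 2"]
    by (simp add: algebra_simps flip: exp_add)
  have int_bound: "integrable std_gauss ?bound"
    by (intro Bochner_Integration.integrable_add integrable_mult_right int_exp)
       (cases "norm s \<le> 1"; simp add: integrable_cameron_martin)
  show int_rem: "integrable std_gauss (cameron_martin_rem s)"
    by (rule Bochner_Integration.integrable_bound[OF int_bound])
       (auto intro!: AE_I2 order_trans[OF bound])
  have "(\<integral>w. \<bar>cameron_martin_rem s w\<bar> \<partial>std_gauss) \<le> (\<integral>w. ?bound w \<partial>std_gauss)"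
    by (intro integral_mono integrable_abs int_rem int_bound bound)
  also have "\<dots> = (if norm s \<le> 1 then 0 else 1)
      + 4 * norm s ^ 3 * (\<integral>w. exp (2 * (norm w + 1)) \<partial>(std_gauss :: (real^'n) measure))"
    using int_exp by (cases "norm s \<le> 1")
        (simp_all add: integrable_cameron_martin integral_cameron_martin)
  also have "\<dots> \<le> cameron_martin_const TYPE('n) * norm s ^ 3"
    by (auto simp: cameron_martin_const_def algebra_simps one_le_power)
  finally show "(\<integral>w. \<bar>cameron_martin_rem s w\<bar> \<partial>std_gauss)
      \<le> cameron_martin_const TYPE('n) * norm s ^ 3" .
qed

lemma (in borel_law) integrable_bdd_borel_mult:
  fixes g :: "'v \<Rightarrow> real"
  assumes F: "bdd_borel K F" and g: "integrable M g"
  shows "integrable M (\<lambda>w. F w * g w)"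
proof (rule Bochner_Integration.integrable_bound)
  note [measurable] = bdd_borel_measurable[OF F]
  show "integrable M (\<lambda>w. K * g w)" using g by simp
  show "(\<lambda>w. F w * g w) \<in> borel_measurable M" using g by measurable
  show "AE w in M. norm (F w * g w) \<le> norm (K * g w)"
    using order_trans[OF bdd_borelD[OF F] abs_ge_self[of K]]
    by (auto simp: abs_mult intro!: mult_right_mono)
qed

lemma integral_second_order_eq_quad_poly:
  fixes F :: "real^'n::finite \<Rightarrow> real"
  assumes F: "bdd_borel K F"
  obtains c b B where
    "\<And>s. integrable std_gauss (\<lambda>w. F w * (1 + s \<bullet> w + ((s \<bullet> w)\<^sup>2 - s \<bullet> s) / 2))"
    "\<And>s. (\<integral>w. F w * (1 + s \<bullet> w + ((s \<bullet> w)\<^sup>2 - s \<bullet> s) / 2) \<partial>std_gauss) = quad_poly c b B s"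
proof -
  define c where "c = (\<integral>w. F w \<partial>std_gauss)"
  define m where "m k = (\<integral>w. F w * w $ k \<partial>std_gauss)" for k
  define m2 where "m2 k l = (\<integral>w. F w * (w $ k * w $ l) \<partial>std_gauss)" for k l
  have int: "integrable std_gauss F" "integrable std_gauss (\<lambda>w. F w * w $ k)"
    "integrable std_gauss (\<lambda>w. F w * (w $ k * w $ l))" for k l
    by (simp_all add: std_gauss.integrable_bdd_borel[OF F] std_gauss.integrable_bdd_borel_mult[OF F]
        std_gauss.integrable_nth std_gauss.integrable_nth_mult)
  have expand: "F w * (1 + s \<bullet> w + ((s \<bullet> w)\<^sup>2 - s \<bullet> s) / 2) = (1 - s \<bullet> s / 2) * F w
      + (\<Sum>k\<in>UNIV. s $ k * (F w * w $ k))
      + (\<Sum>k\<in>UNIV. \<Sum>l\<in>UNIV. s $ k * s $ l / 2 * (F w * (w $ k * w $ l)))" for s w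
  proof -
    have "(\<Sum>k\<in>UNIV. s $ k * (F w * w $ k)) = F w * (s \<bullet> w)"
      by (simp add: inner_vec_def sum_distrib_left algebra_simps)
    moreover have "(\<Sum>k\<in>UNIV. \<Sum>l\<in>UNIV. s $ k * s $ l / 2 * (F w * (w $ k * w $ l)))
        = F w * ((s \<bullet> w)\<^sup>2 / 2)"
      by (simp add: inner_vec_def power2_eq_square sum_product sum_distrib_left sum_divide_distrib
          algebra_simps)
    ultimately show ?thesis by (simp add: field_simps)
  qed
  show ?thesis
  proof
    show "integrable std_gauss (\<lambda>w. F w * (1 + s \<bullet> w + ((s \<bullet> w)\<^sup>2 - s \<bullet> s) / 2))" for s
      unfolding expand by (simp add: int)
    have "(\<integral>w. F w * (1 + s \<bullet> w + ((s \<bullet> w)\<^sup>2 - s \<bullet> s) / 2) \<partial>std_gauss) = (1 - s \<bullet> s / 2) * c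
        + (\<Sum>k\<in>UNIV. s $ k * m k) + (\<Sum>k\<in>UNIV. \<Sum>l\<in>UNIV. s $ k * s $ l / 2 * m2 k l)" for s
      unfolding expand c_def m_def m2_def by (simp add: int)
    also have "\<dots> s = quad_poly c (\<chi> k. m k) (\<chi> k l. (m2 k l - (if k = l then c else 0)) / 2) s"
      for s
      by (simp add: quad_poly_def inner_vec_def algebra_simps diff_divide_distrib sum_subtractf
          sum_distrib_left if_distrib[of "\<lambda>x. _ * x"] if_distrib[of "\<lambda>x. x / _"] sum.delta'
          sum_divide_distrib cong: if_cong)
    finally show "(\<integral>w. F w * (1 + s \<bullet> w + ((s \<bullet> w)\<^sup>2 - s \<bullet> s) / 2) \<partial>std_gauss)
        = quad_poly c (\<chi> k. m k) (\<chi> k l. (m2 k l - (if k = l then c else 0)) / 2) s" for s .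
  qed
qed

lemma std_gauss_shift_expansion:
  fixes F :: "real^'n::finite \<Rightarrow> real"
  assumes F: "bdd_borel K F"
  obtains c b B where "\<And>s. \<bar>(\<integral>w. F (w + s) \<partial>std_gauss) - quad_poly c b B s\<bar>
      \<le> cameron_martin_const TYPE('n) * K * norm s ^ 3"
proof -
  obtain c b B where
    int: "\<And>s. integrable std_gauss (\<lambda>w. F w * (1 + s \<bullet> w + ((s \<bullet> w)\<^sup>2 - s \<bullet> s) / 2))"
    and quad: "\<And>s. (\<integral>w. F w * (1 + s \<bullet> w + ((s \<bullet> w)\<^sup>2 - s \<bullet> s) / 2) \<partial>std_gauss) = quad_poly c b B s"
    using integral_second_order_eq_quad_poly[OF F] by blast
  have int_rem: "integrable std_gauss (\<lambda>w. F w * cameron_martin_rem s w)" for s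
    by (rule std_gauss.integrable_bdd_borel_mult[OF F integrable_cameron_martin_rem])
  have "\<bar>(\<integral>w. F (w + s) \<partial>std_gauss) - quad_poly c b B s\<bar>
      \<le> cameron_martin_const TYPE('n) * K * norm s ^ 3" for s
  proof -
    have "cameron_martin s w * F w
        = F w * (1 + s \<bullet> w + ((s \<bullet> w)\<^sup>2 - s \<bullet> s) / 2) + F w * cameron_martin_rem s w" for w
      by (simp add: cameron_martin_rem_def algebra_simps)
    then have "\<bar>(\<integral>w. F (w + s) \<partial>std_gauss) - quad_poly c b B s\<bar>
        = \<bar>\<integral>w. F w * cameron_martin_rem s w \<partial>std_gauss\<bar>"
      by (simp add: integral_std_gauss_shift bdd_borel_measurable[OF F] int int_rem quad)
    also have "\<dots> \<le> (\<integral>w. K * \<bar>cameron_martin_rem s w\<bar> \<partial>std_gauss)"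
      by (rule integral_abs_bound_integral[OF int_rem])
         (auto simp: integrable_cameron_martin_rem abs_mult intro!: mult_right_mono
             bdd_borelD[OF F])
    also have "\<dots> \<le> K * (cameron_martin_const TYPE('n) * norm s ^ 3)"
      using integral_abs_cameron_martin_rem_le[of s] bdd_borel_nonneg[OF F]
      by (simp add: mult_left_mono)
    finally show ?thesis by (simp add: mult_ac)
  qed
  then show ?thesis by (rule that)
qed

lemma (in third_moment_law) integral_quad_poly_approx:
  assumes "integrable M g" and bound: "\<And>s. \<bar>g s - quad_poly c b B s\<bar> \<le> K * norm s ^ 3"
  shows "\<bar>(\<integral>s. g s \<partial>M) - (\<integral>s. quad_poly c b B s \<partial>M)\<bar> \<le> K * (\<integral>s. norm s ^ 3 \<partial>M)"
proof -
  have "\<bar>(\<integral>s. g s \<partial>M) - (\<integral>s. quad_poly c b B s \<partial>M)\<bar> = \<bar>\<integral>s. g s - quad_poly c b B s \<partial>M\<bar>"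
    by (simp add: assms(1) integrable_quad_poly)
  also have "\<dots> \<le> (\<integral>s. K * norm s ^ 3 \<partial>M)"
    by (rule integral_abs_bound_integral)
       (auto simp: assms(1) integrable_quad_poly integrable_norm_cubed bound)
  finally show ?thesis by simp
qed

lemma std_gauss_moment_matching:
  fixes M N :: "(real^'n::finite) measure"
  assumes "third_moment_law M" "third_moment_law N"
    and moments: "(\<integral>x. x \<partial>M) = (\<integral>x. x \<partial>N)" "second_moment M = second_moment N"
    and F: "bdd_borel K F"
  shows "\<bar>(\<integral>s. \<integral>w. F (w + s) \<partial>std_gauss \<partial>M) - (\<integral>s. \<integral>w. F (w + s) \<partial>std_gauss \<partial>N)\<bar>
    \<le> cameron_martin_const TYPE('n) * K * ((\<integral>s. norm s ^ 3 \<partial>M) + (\<integral>s. norm s ^ 3 \<partial>N))"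
proof -
  interpret M: third_moment_law M by fact
  interpret N: third_moment_law N by fact
  note [measurable] = bdd_borel_measurable[OF F]
  define g where "g s = (\<integral>w. F (w + s) \<partial>std_gauss)" for s
  have "bdd_borel K (\<lambda>w. F (w + s))" for s
    by (rule bdd_borel_compose[OF F]) measurable
  then have "\<bar>g s\<bar> \<le> K" for s
    unfolding g_def by (rule std_gauss.abs_integral_bdd_borel_le)
  then have "bdd_borel K g"
    unfolding bdd_borel_def g_def by (auto intro!: std_gauss.borel_measurable_lebesgue_integral)
  note int_g = M.integrable_bdd_borel[OF this] N.integrable_bdd_borel[OF this]
  obtain c b B where "\<And>s. \<bar>g s - quad_poly c b B s\<bar>
      \<le> cameron_martin_const TYPE('n) * K * norm s ^ 3"
    using std_gauss_shift_expansion[OF F] unfolding g_def by blast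
  note approx = M.integral_quad_poly_approx[OF int_g(1) this]
      N.integral_quad_poly_approx[OF int_g(2) this]
  have "(\<integral>s. quad_poly c b B s \<partial>M) = (\<integral>s. quad_poly c b B s \<partial>N)"
    by (simp add: M.integral_quad_poly N.integral_quad_poly moments)
  then show ?thesis
    using approx unfolding g_def by (simp add: distrib_left)
qed

section \<open>Convolution operators\<close>

definition conv_op :: "'v::ordered_euclidean_space measure \<Rightarrow> ('v \<Rightarrow> real) \<Rightarrow> 'v \<Rightarrow> real" where
  "conv_op M f x = (\<integral>y. f (x + y) \<partial>M)"

lemma bdd_borel_translate:
  fixes f :: "'v::ordered_euclidean_space \<Rightarrow> real"
  shows "bdd_borel K f \<Longrightarrow> bdd_borel K (\<lambda>y. f (x + y))"
  by (rule bdd_borel_compose) measurable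

lemma bdd_borel_indicator_atMost: "bdd_borel 1 (indicator {..z :: 'v::ordered_euclidean_space})"
  by (auto simp: bdd_borel_def indicator_def)

context borel_law
begin

lemma bdd_borel_conv_op:
  assumes f: "bdd_borel K f"
  shows "bdd_borel K (conv_op M f)"
proof -
  note [measurable] = bdd_borel_measurable[OF f]
  have "conv_op M f \<in> borel_measurable borel"
    unfolding conv_op_def by measurable
  moreover have "\<bar>conv_op M f x\<bar> \<le> K" for x
    unfolding conv_op_def by (rule abs_integral_bdd_borel_le[OF bdd_borel_translate[OF f]])
  ultimately show ?thesis by (simp add: bdd_borel_def)
qed

lemma conv_op_diff:
  assumes "bdd_borel K f" "bdd_borel L g"
  shows "conv_op M (\<lambda>y. f y - g y) x = conv_op M f x - conv_op M g x"
  unfolding conv_op_def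
  by (rule Bochner_Integration.integral_diff) (rule integrable_bdd_borel bdd_borel_translate assms)+

lemma conv_op_indicator_atMost: "conv_op M (indicator {..z}) x = measure M {..z - x}"
proof -
  have "indicator {..z} (x + y) = (indicator {..z - x} y :: real)" for y
    by (simp add: indicator_def algebra_simps)
  then show ?thesis by (simp add: conv_op_def)
qed

lemma bdd_borel_measure_atMost: "bdd_borel 1 (\<lambda>z. measure M {..z})"
  using bdd_borel_compose[OF bdd_borel_conv_op[OF bdd_borel_indicator_atMost[of 0]], of uminus]
  by (simp add: conv_op_indicator_atMost)

lemma mono_measure_atMost: "mono (\<lambda>z. measure M {..z})"
  by (intro monoI finite_measure_mono) auto

end

lemma borel_law_convolution:
  assumes "borel_law M" "borel_law N"
  shows "borel_law (M \<star> N)"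
proof -
  interpret M: borel_law M by fact
  interpret N: borel_law N by fact
  interpret pair_prob_space M N ..
  show ?thesis
    unfolding convolution_def
    by (intro borel_law.intro borel_law_axioms.intro prob_space_distr) auto
qed

lemma conv_op_convolution:
  assumes M: "borel_law M" and N: "borel_law N" and f: "bdd_borel K f"
  shows "conv_op (M \<star> N) f = conv_op M (conv_op N f)"
proof
  fix x
  interpret M: borel_law M by fact
  interpret N: borel_law N by fact
  interpret pair_prob_space M N ..
  note [measurable] = bdd_borel_measurable[OF f]
  have "integrable (M \<Otimes>\<^sub>M N) (\<lambda>(y, y'). f (x + (y + y')))"
    by (rule integrable_const_bound[where B=K]) (auto intro!: AE_I2 simp: bdd_borelD[OF f])
  from integral_fst'[OF this] show "conv_op (M \<star> N) f x = conv_op M (conv_op N f) x"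
    by (simp add: conv_op_def convolution_def integral_distr case_prod_beta' add.assoc)
qed

lemma conv_op_commute:
  assumes M: "borel_law M" and N: "borel_law N" and f: "bdd_borel K f"
  shows "conv_op M (conv_op N f) = conv_op N (conv_op M f)"
  using convolution_commutative[of M N] conv_op_convolution[OF M N f] conv_op_convolution[OF N M f]
      M N
  by (simp add: borel_law.sets_eq_borel borel_law_def prob_space.finite_measure)

lemma borel_law_return: "borel_law (return borel x)"
  by (intro borel_law.intro borel_law_axioms.intro prob_space_return) auto

lemma conv_op_return_0:
  assumes "bdd_borel K f"
  shows "conv_op (return borel 0) f = f"
  using bdd_borel_measurable[OF bdd_borel_translate[OF assms]]
  by (auto simp: conv_op_def integral_return)

primrec convolution_power :: "'v::ordered_euclidean_space measure \<Rightarrow> nat \<Rightarrow> 'v measure" where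
  "convolution_power M 0 = return borel 0"
| "convolution_power M (Suc n) = (M \<star> convolution_power M n)"

lemma borel_law_convolution_power: "borel_law M \<Longrightarrow> borel_law (convolution_power M n)"
  by (induction n) (simp_all add: borel_law_return borel_law_convolution)

lemma distr_linear_convolution:
  fixes A :: "real^'n::finite^'m::finite"
  assumes M: "borel_law M" and N: "borel_law N"
  shows "distr M borel ((*v) A) \<star> distr N borel ((*v) A) = distr (M \<star> N) borel ((*v) A)"
proof -
  interpret M: borel_law M by fact
  interpret N: borel_law N by fact
  have "sigma_finite_measure (distr N borel ((*v) A))"
    by (intro finite_measure.sigma_finite_measure N.finite_measure_distr) measurable
  then show ?thesis
    by (simp add: convolution_def pair_measure_distr distr_distr comp_def case_prod_beta'
        matrix_vector_right_distrib)
qed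

section \<open>Replacing one step of a random walk by a Gaussian step\<close>

definition gauss_law :: "real^'n::finite^'m::finite \<Rightarrow> real \<Rightarrow> (real^'m) measure" where
  "gauss_law A t = distr std_gauss borel (\<lambda>w. sqrt t *\<^sub>R (A *v w))"

lemma borel_law_gauss_law: "borel_law (gauss_law A t)"
  unfolding gauss_law_def
  by (intro borel_law.intro borel_law_axioms.intro std_gauss.prob_space_distr) auto

lemma gauss_law_0: "gauss_law A 0 = return borel 0"
  by (simp add: gauss_law_def std_gauss.distr_const)

lemma conv_op_gauss_law:
  assumes "bdd_borel K f"
  shows "conv_op (gauss_law A t) f x = (\<integral>w. f (x + sqrt t *\<^sub>R (A *v w)) \<partial>std_gauss)"
  unfolding conv_op_def gauss_law_def
  using bdd_borel_measurable[OF assms] by (simp add: integral_distr)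

lemma gauss_law_convolution:
  fixes A :: "real^'n::finite^'m::finite"
  assumes "s > 0" "t > 0"
  shows "gauss_law A s \<star> gauss_law A t = gauss_law A (s + t)"
proof -
  let ?scaled = "\<lambda>a. distr (std_gauss :: (real^'n) measure) borel (\<lambda>w. a *\<^sub>R w)"
  have scaled: "gauss_law A r = distr (?scaled (sqrt r)) borel ((*v) A)" for r
    by (simp add: gauss_law_def distr_distr comp_def matrix_vector_mult_scaleR)
  have "borel_law (?scaled a)" for a
    by (intro borel_law.intro borel_law_axioms.intro std_gauss.prob_space_distr) auto
  then show ?thesis
    using std_gauss_convolution[of "sqrt s" "sqrt t", where 'n='n] assms
    by (simp add: scaled distr_linear_convolution)
qed

lemma conv_op_gauss_law_add:
  assumes "bdd_borel K f" "s \<ge> 0" "t \<ge> 0"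
  shows "conv_op (gauss_law A s) (conv_op (gauss_law A t) f) = conv_op (gauss_law A (s + t)) f"
proof (cases "s = 0 \<or> t = 0")
  case True
  then show ?thesis
    using conv_op_return_0[OF assms(1)]
      conv_op_return_0[OF borel_law.bdd_borel_conv_op[OF borel_law_gauss_law assms(1)]]
    by (auto simp: gauss_law_0)
next
  case False
  then show ?thesis
    using assms by (simp add: conv_op_convolution[OF borel_law_gauss_law borel_law_gauss_law
        assms(1), symmetric] gauss_law_convolution)
qed

lemma conv_op_gauss_law_translate:
  assumes "bdd_borel K f" "t > 0"
  shows "conv_op (gauss_law A t) f (x + A *v y)
      = (\<integral>w. f (x + sqrt t *\<^sub>R (A *v (w + (1 / sqrt t) *\<^sub>R y))) \<partial>std_gauss)"
  using assms(2) by (simp add: conv_op_gauss_law[OF assms(1)] matrix_vector_right_distrib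
      matrix_vector_mult_scaleR scaleR_add_right add_ac)

lemma conv_op_gauss_law_Suc_eq_matrix_image:
  assumes L: "A ** L ** A = A" and j: "j > 0" and f: "bdd_borel K f"
  shows "conv_op (gauss_law A (j + 1)) f x = (\<integral>s. \<integral>w. f (x + sqrt j *\<^sub>R (A *v (w + s))) \<partial>std_gauss
      \<partial>distr std_gauss borel ((*v) ((1 / sqrt j) *\<^sub>R L ** A)))"
proof -
  note [measurable] = bdd_borel_measurable[OF f]
  have "conv_op (gauss_law A (j + 1)) f x = conv_op (gauss_law A 1) (conv_op (gauss_law A j) f) x"
    using conv_op_gauss_law_add[OF f, of 1 j A] j by (simp add: add.commute)
  also have "\<dots> = (\<integral>v. conv_op (gauss_law A j) f (x + A *v (L *v (A *v v))) \<partial>std_gauss)"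
    using L by (simp add: conv_op_gauss_law[OF
        borel_law.bdd_borel_conv_op[OF borel_law_gauss_law f]]
        matrix_vector_mul_assoc matrix_mul_assoc)
  finally show ?thesis
    by (simp add: conv_op_gauss_law_translate[OF f j] integral_distr scaleR_matrix_vector_assoc
        flip: matrix_vector_mul_assoc)
qed

lemma powr_minus_three_halves:
  assumes "x > 0"
  shows "x powr (- (3/2)) = 1 / (x * sqrt x)"
proof -
  have "x powr (3/2) = x powr 1 * x powr (1/2)"
    unfolding powr_add[symmetric] by simp
  then show ?thesis
    using assms by (simp add: powr_minus_divide powr_half_sqrt)
qed

lemma ex_generalized_inverse_matrix:
  fixes A :: "real^'n::finite^'m::finite"
  obtains L :: "real^'m^'n" where "A ** L ** A = A"
proof -
  obtain g where "linear g" and g: "\<And>v. v \<in> range ((*v) A) \<Longrightarrow> A *v g v = v"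
    using linear_exists_right_inverse_on[OF matrix_vector_mul_linear[of A] subspace_UNIV] by auto
  then have "A *v (matrix g *v (A *v w)) = A *v w" for w
    by (simp add: matrix_works)
  then have "A ** matrix g ** A = A"
    by (simp add: matrix_eq matrix_vector_mul_assoc[symmetric])
  then show ?thesis by (rule that)
qed

locale gauss_matched_law = third_moment_law M for M :: "(real^'m::finite) measure" +
  fixes A :: "real^'n::finite^'m"
  assumes mean_zero: "(\<integral>x. x \<partial>M) = 0" and covariance: "second_moment M = A ** transpose A"
begin

lemma AE_generalized_inverse:
  assumes "A ** L ** A = A"
  shows "AE x in M. A *v (L *v x) = x"
proof -
  define E where "E = mat 1 - A ** L"
  have "A *v (L *v (A *v w)) = A *v w" for w
    using assms by (simp add: matrix_vector_mul_assoc matrix_mul_assoc)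
  then have "E *v (A *v w) = 0" for w
    by (simp add: E_def matrix_vector_mult_diff_rdistrib flip: matrix_vector_mul_assoc)
  then have "E ** A = 0"
    by (simp add: matrix_eq matrix_vector_mul_assoc)
  then have "second_moment (distr M borel ((*v) E)) = 0"
    by (simp add: second_moment_distr_matrix covariance matrix_mul_assoc)
  then have "(\<integral>x. (E *v x) $ i * (E *v x) $ i \<partial>M) = 0" for i
    by (simp add: second_moment_def vec_eq_iff integral_distr)
  moreover have "integrable M (\<lambda>x. (E *v x) $ i * (E *v x) $ i)" for i
    using third_moment_law.integrable_nth_mult[OF third_moment_law_distr[of E], of i i]
    by (simp add: integrable_distr_eq)
  ultimately have "AE x in M. (E *v x) $ i * (E *v x) $ i = 0" for i
    by (subst integral_nonneg_eq_0_iff_AE[symmetric]) auto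
  then have "AE x in M. \<forall>i. (E *v x) $ i = 0"
    by (simp add: AE_all_countable)
  then show ?thesis
  proof eventually_elim
    case (elim x)
    then have "E *v x = 0" by (simp add: vec_eq_iff)
    then show ?case by (simp add: E_def matrix_vector_mult_diff_rdistrib matrix_vector_mul_assoc)
  qed
qed

lemma matched_matrix_images:
  fixes B :: "real^'m^'k::finite"
  shows "(\<integral>x. x \<partial>distr M borel ((*v) B)) = (\<integral>x. x \<partial>distr std_gauss borel ((*v) (B ** A)))"
    and "second_moment (distr M borel ((*v) B))
        = second_moment (distr std_gauss borel ((*v) (B ** A)))"
  by (simp_all add: mean_distr_matrix std_gauss.mean_distr_matrix mean_zero std_gauss_mean
      second_moment_distr_matrix std_gauss.second_moment_distr_matrix second_moment_std_gauss
      covariance matrix_transpose_mul matrix_mul_assoc)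

lemma conv_op_gauss_law_eq_matrix_image:
  assumes L: "A ** L ** A = A" and j: "j > 0" and f: "bdd_borel K f"
  shows "conv_op M (conv_op (gauss_law A j) f) x
      = (\<integral>s. \<integral>w. f (x + sqrt j *\<^sub>R (A *v (w + s))) \<partial>std_gauss
        \<partial>distr M borel ((*v) ((1 / sqrt j) *\<^sub>R L)))"
proof -
  note [measurable] = bdd_borel_measurable[OF f]
    bdd_borel_measurable[OF bdd_borel_translate[OF
        borel_law.bdd_borel_conv_op[OF borel_law_gauss_law f]]]
  have "conv_op M (conv_op (gauss_law A j) f) x
      = (\<integral>y. \<integral>w. f (x + sqrt j *\<^sub>R (A *v (w + ((1 / sqrt j) *\<^sub>R L) *v y))) \<partial>std_gauss \<partial>M)"
    unfolding conv_op_def[of M]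
  proof (rule integral_cong_AE)
    show "AE y in M. conv_op (gauss_law A j) f (x + y)
        = (\<integral>w. f (x + sqrt j *\<^sub>R (A *v (w + ((1 / sqrt j) *\<^sub>R L) *v y))) \<partial>std_gauss)"
      using AE_generalized_inverse[OF L]
    proof eventually_elim
      case (elim y)
      then show ?case
        using conv_op_gauss_law_translate[OF f j, of A x "L *v y"]
        by (simp add: scaleR_matrix_vector_assoc)
    qed
  qed measurable
  then show ?thesis by (simp add: integral_distr)
qed

text \<open>The first two moments of a step and of a Gaussian step still agree after both are pulled back
  along \<open>A\<close> by a generalized inverse \<open>L\<close>, so that a singular covariance causes no difficulty.\<close>

lemma gauss_swap:
  obtains C where "C \<ge> 0" "\<And>j K f x. j > 0 \<Longrightarrow> bdd_borel K f \<Longrightarrow>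
      \<bar>conv_op M (conv_op (gauss_law A j) f) x - conv_op (gauss_law A (j + 1)) f x\<bar>
      \<le> C * K * j powr (- (3/2))"
proof -
  obtain L :: "real^'m^'n" where L: "A ** L ** A = A" by (rule ex_generalized_inverse_matrix)
  define C where "C = cameron_martin_const TYPE('n)
    * ((\<integral>y. norm (L *v y) ^ 3 \<partial>M) + (\<integral>w. norm (L *v (A *v w)) ^ 3 \<partial>std_gauss))"
  have "C \<ge> 0"
    unfolding C_def using cameron_martin_const_ge_1[where 'n='n] by simp
  moreover have "\<bar>conv_op M (conv_op (gauss_law A j) f) x - conv_op (gauss_law A (j + 1)) f x\<bar>
      \<le> C * K * j powr (- (3/2))"
    if j: "j > 0" and f: "bdd_borel K f" for j K f x
  proof -
    define B where "B = (1 / sqrt j) *\<^sub>R L"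
    have "j powr (- (3/2)) = 1 / sqrt j ^ 3"
      using j by (simp add: powr_minus_three_halves power3_eq_cube)
    then have third_moments: "(\<integral>s. norm s ^ 3 \<partial>distr M borel ((*v) B))
        + (\<integral>s. norm s ^ 3 \<partial>distr std_gauss borel ((*v) (B ** A)))
        = j powr (- (3/2)) * ((\<integral>y. norm (L *v y) ^ 3 \<partial>M)
        + (\<integral>w. norm (L *v (A *v w)) ^ 3 \<partial>std_gauss))"
      using j by (simp add: integral_distr B_def scaleR_matrix_vector_assoc[symmetric]
          power_mult_distrib power_divide add_divide_distrib flip: matrix_vector_mul_assoc)
    have "bdd_borel K (\<lambda>w. f (x + sqrt j *\<^sub>R (A *v w)))"
      using f by (rule bdd_borel_compose) measurable
    from std_gauss_moment_matching[OF third_moment_law_distr std_gauss.third_moment_law_distr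
        matched_matrix_images(1)[of B] matched_matrix_images(2)[of B] this]
    show ?thesis
      unfolding third_moments[unfolded B_def] conv_op_gauss_law_eq_matrix_image[OF L j f]
        conv_op_gauss_law_Suc_eq_matrix_image[OF L j f] B_def C_def
      by (simp add: mult_ac)
  qed
  ultimately show ?thesis by (rule that)
qed

end

section \<open>Anti-concentration of Gaussian orthant probabilities\<close>

definition gauss_prob :: "real^'n::finite^'m::finite \<Rightarrow> real^'m \<Rightarrow> real" where
  "gauss_prob A z = measure std_gauss {w. A *v w \<le> z}"

lemma sets_borel_matrix_le [measurable]: "{w. A *v w \<le> z} \<in> sets borel"
  for A :: "real^'n::finite^'m::finite"
  unfolding less_eq_vec_def by (rule sets_borel_Collect) measurable

lemma gauss_prob_mono: "z \<le> z' \<Longrightarrow> gauss_prob A z \<le> gauss_prob A z'"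
  unfolding gauss_prob_def
  by (intro std_gauss.finite_measure_mono) auto

lemma measure_gauss_law_atMost:
  assumes "t > 0"
  shows "measure (gauss_law A t) {..z} = gauss_prob A ((1 / sqrt t) *\<^sub>R z)"
proof -
  have "(\<lambda>w. sqrt t *\<^sub>R (A *v w)) -` {..z} \<inter> space std_gauss = {w. A *v w \<le> (1 / sqrt t) *\<^sub>R z}"
    using assms by (auto simp: less_eq_vec_def field_simps)
  then show ?thesis
    unfolding gauss_law_def gauss_prob_def by (subst measure_distr) auto
qed

lemma matrix_vec_upd: "(A *v vec_upd w j t) $ i = (A *v vec_upd w j 0) $ i + A $ i $ j * t"
proof -
  have "(A *v vec_upd w j r) $ i = A $ i $ j * r + (\<Sum>k\<in>UNIV-{j}. A $ i $ k * w $ k)" for r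
    unfolding matrix_vector_mult_def vec_upd_def by (simp, subst sum.remove[of _ j], auto)
  then show ?thesis by simp
qed

lemma emeasure_std_normal_le_lborel:
  assumes "S \<in> sets borel"
  shows "emeasure std_normal S \<le> emeasure lborel S"
proof -
  have "sqrt (2 * pi) \<ge> 1" using pi_gt3 by simp
  then have "1 / sqrt (2 * pi) * exp (- x\<^sup>2 / 2) \<le> 1 * 1" for x
    by (intro mult_mono) auto
  then have "std_normal_density x \<le> 1" for x
    by (simp add: std_normal_density_def)
  then have "(\<integral>\<^sup>+x. ennreal (std_normal_density x) * indicator S x \<partial>lborel)
      \<le> (\<integral>\<^sup>+x. indicator S x \<partial>lborel)"
    by (intro nn_integral_mono) (auto simp: indicator_def)
  then show ?thesis
    using assms by (simp add: std_normal_measure_def emeasure_density)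
qed

lemma emeasure_std_normal_affine_strip_le:
  assumes "c \<noteq> 0" "a \<le> b"
  shows "emeasure std_normal {t. r + c * t \<in> {a<..b}} \<le> ennreal ((b - a) / \<bar>c\<bar>)"
proof -
  have strip [measurable]: "{t. r + c * t \<in> {a<..b}} \<in> sets borel"
    by (rule sets_borel_Collect) measurable
  have "ennreal (b - a) = (\<integral>\<^sup>+x. indicator {a<..b} x \<partial>lborel)"
    using assms by simp
  also have "\<dots> = ennreal \<bar>c\<bar> * (\<integral>\<^sup>+t. indicator {a<..b} (r + c * t) \<partial>lborel)"
    using assms by (intro nn_integral_real_affine) auto
  also have "(\<integral>\<^sup>+t. indicator {a<..b} (r + c * t) \<partial>lborel)
      = (\<integral>\<^sup>+t. indicator {t. r + c * t \<in> {a<..b}} t \<partial>lborel)"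
    by (intro nn_integral_cong) (simp add: indicator_def)
  also have "\<dots> = emeasure lborel {t. r + c * t \<in> {a<..b}}"
    using strip by simp
  finally have "ennreal (b - a) = emeasure lborel {t. r + c * t \<in> {a<..b}} * ennreal \<bar>c\<bar>"
    by (simp only: mult.commute)
  moreover have "ennreal ((b - a) / \<bar>c\<bar>) = ennreal (b - a) / ennreal \<bar>c\<bar>"
    using assms by (simp add: divide_ennreal)
  ultimately show ?thesis
    using emeasure_std_normal_le_lborel[OF strip] assms(1)
    by (simp add: ennreal_mult_divide_eq)
qed

lemma measure_std_gauss_strip_le:
  fixes A :: "real^'n::finite^'m::finite"
  assumes "A $ i $ j \<noteq> 0" "a \<le> b"
  shows "measure std_gauss {w. (A *v w) $ i \<in> {a<..b}} \<le> (b - a) / \<bar>A $ i $ j\<bar>"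
proof -
  have [measurable]: "{w. (A *v w) $ i \<in> {a<..b}} \<in> sets borel"
    by (rule sets_borel_Collect) measurable
  have "emeasure std_gauss {w. (A *v w) $ i \<in> {a<..b}}
      = (\<integral>\<^sup>+w. emeasure std_normal {t. (A *v vec_upd w j t) $ i \<in> {a<..b}} \<partial>std_gauss)"
    by (subst emeasure_std_gauss_lines[of _ j]) auto
  also have "\<dots> \<le> (\<integral>\<^sup>+w. ennreal ((b - a) / \<bar>A $ i $ j\<bar>) \<partial>(std_gauss :: (real^'n) measure))"
    by (subst matrix_vec_upd) (intro nn_integral_mono emeasure_std_normal_affine_strip_le assms)
  finally show ?thesis
    using assms std_gauss.emeasure_space_1[where 'n='n] by (simp add: std_gauss.emeasure_eq_measure)
qed

lemma gauss_prob_diff_le: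
  fixes A :: "real^'n::finite^'m::finite"
  assumes j: "\<And>i. A $ i $ j i \<noteq> 0"
  shows "gauss_prob A z' - gauss_prob A z \<le> (\<Sum>i\<in>UNIV. \<bar>z' $ i - z $ i\<bar> / \<bar>A $ i $ j i\<bar>)"
proof -
  define S where "S i = {w. (A *v w) $ i \<in> {z $ i<..max (z $ i) (z' $ i)}}" for i
  have [measurable]: "S i \<in> sets borel" for i
    unfolding S_def by (rule sets_borel_Collect) measurable
  have "{w. A *v w \<le> z'} \<subseteq> {w. A *v w \<le> z} \<union> (\<Union>i. S i)"
    unfolding S_def less_eq_vec_def by (auto simp: not_le le_max_iff_disj)
  then have "gauss_prob A z' \<le> measure std_gauss ({w. A *v w \<le> z} \<union> (\<Union>i. S i))"
    unfolding gauss_prob_def by (intro std_gauss.finite_measure_mono) auto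
  also have "\<dots> \<le> gauss_prob A z + measure std_gauss (\<Union>i. S i)"
    unfolding gauss_prob_def by (intro measure_Un_le) auto
  also have "measure std_gauss (\<Union>i. S i) \<le> (\<Sum>i\<in>UNIV. measure std_gauss (S i))"
    by (intro measure_UNION_le) auto
  also have "\<dots> \<le> (\<Sum>i\<in>UNIV. \<bar>z' $ i - z $ i\<bar> / \<bar>A $ i $ j i\<bar>)"
  proof (rule sum_mono)
    fix i
    have "measure std_gauss (S i) \<le> (max (z $ i) (z' $ i) - z $ i) / \<bar>A $ i $ j i\<bar>"
      unfolding S_def by (intro measure_std_gauss_strip_le j) simp
    also have "\<dots> \<le> \<bar>z' $ i - z $ i\<bar> / \<bar>A $ i $ j i\<bar>"
      by (simp add: divide_right_mono)
    finally show "measure std_gauss (S i) \<le> \<bar>z' $ i - z $ i\<bar> / \<bar>A $ i $ j i\<bar>" .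
  qed
  finally show ?thesis by simp
qed

definition l1_norm :: "real^'m::finite \<Rightarrow> real" where
  "l1_norm x = (\<Sum>i\<in>UNIV. \<bar>x $ i\<bar>)"

lemma l1_norm_measurable [measurable]: "l1_norm \<in> borel_measurable borel"
  unfolding l1_norm_def[abs_def] by measurable

lemma l1_norm_nonneg: "0 \<le> l1_norm x"
  by (simp add: l1_norm_def sum_nonneg)

lemma l1_norm_shift_le:
  fixes y :: "real^'m::finite" and a :: real
  assumes "c = vec a \<or> c = - vec a" "a \<ge> 0"
  shows "l1_norm (z + c - y - z) \<le> CARD('m) * a + l1_norm y"
proof -
  have "\<bar>(z + c - y) $ i - z $ i\<bar> \<le> a + \<bar>y $ i\<bar>" for i
    using assms by auto
  then have "(\<Sum>i\<in>UNIV. \<bar>(z + c - y) $ i - z $ i\<bar>) \<le> (\<Sum>i\<in>UNIV. a + \<bar>y $ i\<bar>)"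
    by (intro sum_mono)
  then show ?thesis by (simp add: l1_norm_def sum.distrib)
qed

lemma l1_norm_scaleR: "l1_norm (c *\<^sub>R x) = \<bar>c\<bar> * l1_norm x"
  by (simp add: l1_norm_def abs_mult sum_distrib_left)

lemma gauss_prob_lipschitz:
  fixes A :: "real^'n::finite^'m::finite"
  assumes rows: "\<And>i. \<exists>j. A $ i $ j \<noteq> 0"
  obtains \<Lambda> where "\<Lambda> \<ge> 0" "\<And>x y. \<bar>gauss_prob A x - gauss_prob A y\<bar> \<le> \<Lambda> * l1_norm (x - y)"
proof -
  obtain j where j: "\<And>i. A $ i $ j i \<noteq> 0" using rows by metis
  define \<Lambda> where "\<Lambda> = (\<Sum>i\<in>UNIV. 1 / \<bar>A $ i $ j i\<bar>)"
  have \<Lambda>_ge: "1 / \<bar>A $ i $ j i\<bar> \<le> \<Lambda>" for i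
    unfolding \<Lambda>_def by (rule member_le_sum[of i _ "\<lambda>i. 1 / \<bar>A $ i $ j i\<bar>"]) auto
  have one_sided: "gauss_prob A x - gauss_prob A y \<le> \<Lambda> * l1_norm (x - y)" for x y
  proof -
    have "gauss_prob A x - gauss_prob A y \<le> (\<Sum>i\<in>UNIV. 1 / \<bar>A $ i $ j i\<bar> * \<bar>x $ i - y $ i\<bar>)"
      using gauss_prob_diff_le[of A j x y, OF j] by simp
    also have "\<dots> \<le> (\<Sum>i\<in>UNIV. \<Lambda> * \<bar>x $ i - y $ i\<bar>)"
      by (intro sum_mono mult_right_mono \<Lambda>_ge) simp
    finally show ?thesis by (simp add: l1_norm_def sum_distrib_left)
  qed
  have "\<bar>gauss_prob A x - gauss_prob A y\<bar> \<le> \<Lambda> * l1_norm (x - y)" for x y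
    using one_sided[of x y] one_sided[of y x]
    by (simp add: abs_le_iff l1_norm_def abs_minus_commute)
  moreover have "\<Lambda> \<ge> 0" unfolding \<Lambda>_def by (intro sum_nonneg) auto
  ultimately show ?thesis by (rule that[rotated])
qed

lemma std_gauss_tight:
  assumes "\<eta> > 0"
  obtains R where "R > 0" "measure std_gauss {w :: real^'n::finite. norm w \<le> R} \<ge> 1 - \<eta>"
proof -
  define m where "m = (\<integral>w. norm w \<partial>(std_gauss :: (real^'n) measure))"
  have m: "m \<ge> 0" by (simp add: m_def)
  have int: "integrable std_gauss (\<lambda>w::real^'n. norm w)"
    using integrable_std_gauss_norm_power[of 1] by simp
  define R where "R = m / \<eta> + 1"
  have R: "R > 0" using m assms by (simp add: R_def add_nonneg_pos)
  have "1 - measure std_gauss {w::real^'n. norm w \<le> R} = measure std_gauss {w::real^'n. R < norm w}"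
    using std_gauss.prob_compl[of "{w::real^'n. norm w \<le> R}"]
    by (auto simp: Compl_eq_Diff_UNIV[symmetric] Collect_neg_eq[symmetric] not_le)
  also have "\<dots> \<le> measure std_gauss {w\<in>space std_gauss. norm (w::real^'n) \<ge> R}"
    by (intro std_gauss.finite_measure_mono) auto
  also have "\<dots> \<le> m / R"
    unfolding m_def using R by (intro integral_Markov_inequality_measure[OF int]) auto
  also have "\<dots> \<le> \<eta>"
    using R m assms by (simp add: R_def field_simps)
  finally have "measure std_gauss {w::real^'n. norm w \<le> R} \<ge> 1 - \<eta>" by linarith
  with R show ?thesis by (rule that)
qed

lemma abs_matrix_component_le:
  fixes A :: "real^'n::finite^'m::finite"
  assumes "norm w \<le> R"
  shows "\<bar>(A *v w) $ i\<bar> \<le> onorm ((*v) A) * R"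
proof -
  have "\<bar>(A *v w) $ i\<bar> \<le> norm (A *v w)" by (rule component_le_norm_cart)
  also have "\<dots> \<le> onorm ((*v) A) * norm w" by (intro onorm matrix_vector_mul_bounded_linear)
  also have "\<dots> \<le> onorm ((*v) A) * R"
    by (intro mult_left_mono assms onorm_pos_le matrix_vector_mul_bounded_linear)
  finally show ?thesis .
qed

section \<open>A Berry--Esseen bound for orthants\<close>

lemma sqrt_Suc_diff_ge: "1 / (2 * sqrt (Suc n)) \<le> sqrt (Suc n) - sqrt n"
proof -
  define a b where "a = sqrt (real n)" and "b = sqrt (real (Suc n))"
  have ab: "0 \<le> a" "a \<le> b" "0 < b" "b\<^sup>2 = a\<^sup>2 + 1" by (auto simp: a_def b_def)
  then have "(b - a) * (2 * b) \<ge> (b - a) * (b + a)" by (intro mult_left_mono) auto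
  also have "(b - a) * (b + a) = 1" using ab by (simp add: power2_eq_square algebra_simps)
  finally show ?thesis using ab
    by (simp add: a_def[symmetric] b_def[symmetric] divide_le_eq del: of_nat_Suc)
qed

lemma sum_inverse_sqrt_le: "(\<Sum>k=1..n. 1 / sqrt (real k)) \<le> 2 * sqrt n"
proof (induction n)
  case (Suc n)
  have "1 / sqrt (Suc n) \<le> 2 * sqrt (Suc n) - 2 * sqrt n"
    using sqrt_Suc_diff_ge[of n] by (simp add: field_simps)
  with Suc show ?case by simp
qed simp

lemma powr_minus_three_halves_le_telescope:
  assumes "n \<ge> 1"
  shows "real (Suc n) powr (- (3/2)) \<le> 2 / sqrt n - 2 / sqrt (Suc n)"
proof -
  define a b where "a = sqrt (real n)" and "b = sqrt (real (Suc n))"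
  have ab: "0 < a" "a \<le> b" "0 < b" "real (Suc n) = b * b" using assms by (auto simp: a_def b_def)
  have "real (Suc n) powr (- (3/2)) = 1 / b / (b * b)"
    unfolding powr_minus_three_halves[OF of_nat_0_less_iff[THEN iffD2, OF zero_less_Suc]]
        b_def[symmetric]
    by (simp add: ab(4) del: of_nat_Suc)
  also have "\<dots> \<le> 2 * (b - a) / (a * b)"
    using ab sqrt_Suc_diff_ge[of n]
    by (intro frac_le mult_right_mono) (auto simp: a_def[symmetric] b_def[symmetric])
  also have "\<dots> = 2 / a - 2 / b" using ab by (simp add: field_simps)
  finally show ?thesis by (simp add: a_def b_def)
qed

lemma sum_powr_minus_three_halves_le:
  fixes M N :: nat
  assumes "M \<ge> 1"
  shows "(\<Sum>j=M..N. real j powr (- (3/2))) \<le> 3 / sqrt M"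
proof (cases "M \<le> N")
  case True
  then have "(\<Sum>j=M..N. real j powr (- (3/2))) \<le> 3 / sqrt M - 2 / sqrt N"
  proof (induction N rule: dec_induct)
    case base
    have "real M powr (- (3/2)) \<le> 1 / sqrt M"
      using assms by (simp add: powr_minus_three_halves divide_left_mono)
    then show ?case by simp
  next
    case (step N)
    then show ?case using powr_minus_three_halves_le_telescope[of N] assms by simp
  qed
  then show ?thesis by (rule order_trans) simp
qed simp

lemma inverse_sqrt_mult_powr_le:
  fixes M n k :: nat
  assumes M: "M \<ge> 1" and k: "k < n"
  defines "J \<equiv> real (n - 1 - k + M)"
  shows "1 / sqrt k * J powr (- (3/2)) \<le> 3/2 / sqrt n * J powr (- (3/2))
    + 2 / (n * sqrt M) * (1 / sqrt k)"
proof (cases "2 * k \<ge> n")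
  case True
  have "sqrt n \<le> sqrt (2 * real k)" using True by simp
  also have "\<dots> = sqrt 2 * sqrt k" by (rule real_sqrt_mult)
  also have "\<dots> \<le> 3/2 * sqrt k"
    by (intro mult_right_mono real_le_lsqrt) (auto simp: power2_eq_square)
  finally have "1 / sqrt k \<le> 3/2 / sqrt n" using k True by (simp add: field_simps)
  then have "1 / sqrt k * J powr (- (3/2)) \<le> 3/2 / sqrt n * J powr (- (3/2))"
    by (intro mult_right_mono) auto
  then show ?thesis by (rule order_trans) simp
next
  case False
  have J: "real n / 2 \<le> J" "real M \<le> J" "J > 0" using False k M by (auto simp: J_def)
  have "real n / 2 * sqrt M \<le> J * sqrt J" using J by (intro mult_mono) auto
  then have "1 / (J * sqrt J) \<le> 1 / (real n / 2 * sqrt M)"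
    using J k M by (intro divide_left_mono) auto
  then have "J powr (- (3/2)) \<le> 1 / (real n / 2 * sqrt M)"
    using J by (simp add: powr_minus_three_halves)
  then have "1 / sqrt k * J powr (- (3/2)) \<le> 1 / sqrt k * (2 / (n * sqrt M))"
    by (intro mult_left_mono) auto
  then show ?thesis by (simp add: mult.commute add_increasing)
qed

text \<open>The term \<open>k = 0\<close> vanishes because \<open>1 / sqrt 0 = 0\<close>.\<close>

lemma sum_inverse_sqrt_mult_powr_le:
  fixes M n :: nat
  assumes M: "M \<ge> 1" and n: "n \<ge> 1"
  shows "(\<Sum>k<n. 1 / sqrt k * real (n - 1 - k + M) powr (- (3/2))) \<le> 9 / (sqrt M * sqrt n)"
proof -
  define g where "g j = real j powr (- (3/2))" for j :: nat
  have "(\<Sum>k<n. 1 / sqrt k * g (n - 1 - k + M))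
      \<le> (\<Sum>k<n. 3/2 / sqrt n * g (n - 1 - k + M) + 2 / (n * sqrt M) * (1 / sqrt k))"
    unfolding g_def by (intro sum_mono inverse_sqrt_mult_powr_le M) simp
  also have "\<dots> = 3/2 / sqrt n * (\<Sum>k<n. g (n - 1 - k + M)) + 2 / (n * sqrt M) * (\<Sum>k<n. 1 / sqrt k)"
    by (simp only: sum.distrib sum_distrib_left)
  also have "\<dots> \<le> 3/2 / sqrt n * (3 / sqrt M) + 2 / (n * sqrt M) * (2 * sqrt n)"
  proof (intro add_mono mult_left_mono)
    have "(\<Sum>k<n. g (n - 1 - k + M)) = (\<Sum>j\<in>(\<lambda>k. n - 1 - k + M) ` {..<n}. g j)"
      by (subst sum.reindex) (auto simp: inj_on_def)
    also have "\<dots> \<le> (\<Sum>j=M..n+M. g j)" by (intro sum_mono2) (auto simp: g_def)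
    also have "\<dots> \<le> 3 / sqrt M" unfolding g_def by (rule sum_powr_minus_three_halves_le[OF M])
    finally show "(\<Sum>k<n. g (n - 1 - k + M)) \<le> 3 / sqrt M" .
    have "(\<Sum>k<n. 1 / sqrt k) \<le> (\<Sum>k\<in>insert 0 {1..n}. 1 / sqrt (real k))" by (intro sum_mono2) auto
    also have "\<dots> \<le> 2 * sqrt n" using sum_inverse_sqrt_le[of n] by simp
    finally show "(\<Sum>k<n. 1 / sqrt k) \<le> 2 * sqrt n" .
  qed auto
  also have "\<dots> = (9/2 + 4) / (sqrt M * sqrt n)"
    using n M real_sqrt_mult_self[of "real n"] by (simp add: field_simps)
  also have "\<dots> \<le> 9 / (sqrt M * sqrt n)" by (intro divide_right_mono) auto
  finally show ?thesis unfolding g_def .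
qed

lemma (in borel_law) smoothing_one_sided:
  assumes int: "integrable M (\<lambda>y. h (z + c - y))" "integrable M (\<lambda>y. g (z + c - y))"
      "integrable M e"
    and [measurable]: "\<Omega> \<in> sets borel"
    and close: "\<And>x. \<bar>h x - g x\<bar> \<le> \<Delta>"
    and smoothed: "(\<integral>y. h (z + c - y) \<partial>M) \<le> (\<integral>y. g (z + c - y) \<partial>M) + D"
    and dominated: "\<And>y. y \<in> \<Omega> \<Longrightarrow> h z \<le> h (z + c - y)"
    and varies: "\<And>y. \<bar>g (z + c - y) - g z\<bar> \<le> e y"
  shows "measure M \<Omega> * (h z - g z) \<le> D + (1 - measure M \<Omega>) * \<Delta> + 2 * (\<integral>y. e y \<partial>M)"
proof -
  have int_ind: "integrable M (\<lambda>y. indicator \<Omega> y :: real)"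
    by (rule integrable_const_bound[where B=1]) (auto simp: indicator_def)
  have e_nonneg: "0 \<le> e y" for y
    using order_trans[OF abs_ge_zero varies] .
  have "indicator \<Omega> y * h z + (1 - indicator \<Omega> y) * (g z - \<Delta>) - e y \<le> h (z + c - y)" for y
    using dominated[of y] e_nonneg[of y] close[of "z + c - y"] varies[of y]
    by (cases "y \<in> \<Omega>") (simp, simp add: abs_le_iff)
  then have "(\<integral>y. indicator \<Omega> y * h z + (1 - indicator \<Omega> y) * (g z - \<Delta>) - e y \<partial>M)
      \<le> (\<integral>y. h (z + c - y) \<partial>M)"
    using int int_ind by (intro integral_mono) auto
  also have "\<dots> \<le> (\<integral>y. g z + e y \<partial>M) + D"
  proof -
    have "(\<integral>y. g (z + c - y) \<partial>M) \<le> (\<integral>y. g z + e y \<partial>M)"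
    proof (rule integral_mono)
      show "g (z + c - y) \<le> g z + e y" for y using varies[of y] by linarith
    qed (use int in auto)
    with smoothed show ?thesis by linarith
  qed
  finally show ?thesis
    using int int_ind prob_space by (simp add: algebra_simps)
qed

text \<open>Shifting by \<open>\<plusminus>a\<close> in every coordinate lets monotonicity absorb the noise on the event \<open>\<Omega>\<close>.\<close>

lemma smoothing_two_sided:
  fixes M :: "(real^'m::finite) measure"
  assumes M: "borel_law M" and "mono h"
    and int: "\<And>z. integrable M (\<lambda>y. h (z - y))" "\<And>z. integrable M (\<lambda>y. g (z - y))" "integrable M e"
    and close: "\<And>x. \<bar>h x - g x\<bar> \<le> \<Delta>"
    and smoothed: "\<And>z. \<bar>(\<integral>y. h (z - y) \<partial>M) - (\<integral>y. g (z - y) \<partial>M)\<bar> \<le> D"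
    and varies: "\<And>c y. c = vec a \<or> c = - vec a \<Longrightarrow> \<bar>g (z + c - y) - g z\<bar> \<le> e y"
  defines "\<Omega> \<equiv> {y. \<forall>i. \<bar>y $ i\<bar> \<le> a}"
  shows "measure M \<Omega> * \<bar>h z - g z\<bar> \<le> D + (1 - measure M \<Omega>) * \<Delta> + 2 * (\<integral>y. e y \<partial>M)"
proof -
  interpret borel_law M by fact
  have [measurable]: "\<Omega> \<in> sets borel"
    unfolding \<Omega>_def by (rule sets_borel_Collect) measurable
  have upper: "measure M \<Omega> * (h z - g z) \<le> D + (1 - measure M \<Omega>) * \<Delta> + 2 * (\<integral>y. e y \<partial>M)"
  proof (rule smoothing_one_sided)
    show "h z \<le> h (z + vec a - y)" if "y \<in> \<Omega>" for y
      using that by (intro monoD[OF \<open>mono h\<close>]) (auto simp: \<Omega>_def less_eq_vec_def abs_le_iff)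
  qed (use int close varies smoothed[of "z + vec a"] in \<open>auto simp: abs_le_iff\<close>)
  have "measure M \<Omega> * (- h z - (- g z)) \<le> D + (1 - measure M \<Omega>) * \<Delta> + 2 * (\<integral>y. e y \<partial>M)"
  proof (rule smoothing_one_sided)
    show "- h z \<le> - h (z + - vec a - y)" if "y \<in> \<Omega>" for y
    proof -
      have "- a \<le> y $ i" for i using that unfolding \<Omega>_def abs_le_iff by (simp add: minus_le_iff)
      then have "z + - vec a - y \<le> z" by (simp add: less_eq_vec_def)
      from monoD[OF \<open>mono h\<close> this] show ?thesis by simp
    qed
    show "\<bar>- g (z + - vec a - y) - - g z\<bar> \<le> e y" for y
      using varies[OF disjI2[OF refl], of y] by linarith
    show "\<bar>- h x - - g x\<bar> \<le> \<Delta>" for x using close[of x] by linarith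
  qed (use int smoothed[of "z - vec a"] in \<open>auto simp: abs_le_iff\<close>)
  with upper show ?thesis by (auto simp: abs_if algebra_simps)
qed

text \<open>The event that the noise exceeds \<open>a\<close> costs a quarter of the uniform distance of \<open>h\<close> and \<open>g\<close>,
  which is moved to the left-hand side.\<close>

lemma smoothing_inequality:
  fixes M :: "(real^'m::finite) measure" and h g :: "real^'m \<Rightarrow> real" and a :: real
  assumes M: "borel_law M" and h: "bdd_borel 1 h" "mono h" and g: "bdd_borel 1 g"
    and lipschitz: "\<And>x y. \<bar>g x - g y\<bar> \<le> \<Lambda> * l1_norm (x - y)" "\<Lambda> \<ge> 0"
    and noise: "measure M {y. \<forall>i. \<bar>y $ i\<bar> \<le> a} \<ge> 3/4" "integrable M l1_norm" "a \<ge> 0"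
    and smoothed: "\<And>z. \<bar>(\<integral>y. h (z - y) \<partial>M) - (\<integral>y. g (z - y) \<partial>M)\<bar> \<le> D"
  shows "\<bar>h z - g z\<bar> \<le> 2 * D + 4 * \<Lambda> * (CARD('m) * a + (\<integral>y. l1_norm y \<partial>M))"
proof -
  interpret borel_law M by fact
  define e where "e y = \<Lambda> * (CARD('m) * a + l1_norm y)" for y :: "real^'m"
  define q where "q = measure M {y :: real^'m. \<forall>i. \<bar>y $ i\<bar> \<le> a}"
  define \<Delta> where "\<Delta> = (SUP z. \<bar>h z - g z\<bar>)"
  have "\<bar>h x - g x\<bar> \<le> 2" for x
    using bdd_borelD[OF h(1), of x] bdd_borelD[OF g, of x] by linarith
  then have bdd: "bdd_above (range (\<lambda>x. \<bar>h x - g x\<bar>))" by (intro bdd_aboveI[of _ 2]) auto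
  have close: "\<bar>h x - g x\<bar> \<le> \<Delta>" for x
    unfolding \<Delta>_def by (rule cSUP_upper[OF _ bdd]) simp
  have "bdd_borel 1 (\<lambda>y. f (z - y))" if "bdd_borel 1 f" for f and z :: "real^'m"
    using that by (rule bdd_borel_compose) measurable
  then have int: "integrable M (\<lambda>y. h (z - y))" "integrable M (\<lambda>y. g (z - y))" "integrable M e"
    for z
    unfolding e_def using h g noise(2) by (auto intro!: integrable_bdd_borel integrable_mult_right)
  have varies: "\<bar>g (z + c - y) - g z\<bar> \<le> e y" if "c = vec a \<or> c = - vec a" for c z y
    using order_trans[OF lipschitz(1)
        mult_left_mono[OF l1_norm_shift_le[OF that noise(3)] lipschitz(2)]]
    by (simp add: e_def)
  have q: "3/4 \<le> q" using noise(1) by (simp add: q_def)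
  have self_bound: "\<bar>h z - g z\<bar> \<le> 4/3 * (D + \<Delta> / 4 + 2 * (\<integral>y. e y \<partial>M))" for z
  proof -
    have "q * \<bar>h z - g z\<bar> \<le> D + (1 - q) * \<Delta> + 2 * (\<integral>y. e y \<partial>M)"
      unfolding q_def using varies
      by (intro smoothing_two_sided[where h=h and g=g and e=e, OF M h(2) int close smoothed])
    moreover have "3/4 * \<bar>h z - g z\<bar> \<le> q * \<bar>h z - g z\<bar>"
      using q by (intro mult_right_mono) auto
    moreover have "(1 - q) * \<Delta> \<le> 1/4 * \<Delta>"
      using q order_trans[OF abs_ge_zero close] by (intro mult_right_mono) auto
    ultimately show ?thesis by simp
  qed
  have "\<Delta> \<le> 4/3 * (D + \<Delta> / 4 + 2 * (\<integral>y. e y \<partial>M))"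
    unfolding \<Delta>_def by (rule cSUP_least) (use self_bound in \<open>auto simp: \<Delta>_def\<close>)
  moreover have "(\<integral>y. e y \<partial>M) = \<Lambda> * (CARD('m) * a + (\<integral>y. l1_norm y \<partial>M))"
    using noise(2) prob_space by (simp add: e_def)
  ultimately show ?thesis
    using close[of z] by (simp add: algebra_simps)
qed

lemma integral_measure_atMost_diff:
  assumes "borel_law N"
  shows "(\<integral>y. measure N {..z - y} \<partial>M) = conv_op M (conv_op N (indicator {..z})) 0"
  by (simp add: conv_op_def[of M] borel_law.conv_op_indicator_atMost[OF assms])

lemma integrable_std_gauss_l1_norm:
  fixes A :: "real^'n::finite^'m::finite"
  shows "integrable std_gauss (\<lambda>w. l1_norm (A *v w))"
  using third_moment_law.integrable_nth[OF std_gauss.third_moment_law_distr[of A]]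
  by (simp add: l1_norm_def integrable_distr_eq)

lemma
  assumes "t \<ge> 0"
  shows integrable_gauss_law_l1_norm: "integrable (gauss_law A t) l1_norm"
    and integral_gauss_law_l1_norm:
      "(\<integral>y. l1_norm y \<partial>gauss_law A t) = sqrt t * (\<integral>w. l1_norm (A *v w) \<partial>std_gauss)"
  unfolding gauss_law_def using assms integrable_std_gauss_l1_norm[of A]
  by (simp_all add: integrable_distr_eq integral_distr l1_norm_scaleR)

lemma measure_gauss_law_cube_ge:
  fixes A :: "real^'n::finite^'m::finite"
  assumes "t \<ge> 0"
  shows "measure std_gauss {w :: real^'n. norm w \<le> R}
    \<le> measure (gauss_law A t) {y. \<forall>i. \<bar>y $ i\<bar> \<le> sqrt t * (onorm ((*v) A) * R)}"
    (is "_ \<le> measure _ ?cube")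
proof -
  have [measurable]: "?cube \<in> sets borel"
    by (rule sets_borel_Collect) measurable
  have "measure std_gauss {w :: real^'n. norm w \<le> R}
      \<le> measure std_gauss ((\<lambda>w. sqrt t *\<^sub>R (A *v w)) -` ?cube \<inter> space std_gauss)"
    using assms by (intro std_gauss.finite_measure_mono measurable_sets[where A=borel])
       (auto simp: abs_mult intro!: mult_left_mono abs_matrix_component_le)
  then show ?thesis
    by (simp add: gauss_law_def measure_distr)
qed

lemma gauss_law_atMost_lipschitz:
  assumes "t > 0" and lipschitz: "\<And>x y. \<bar>gauss_prob A x - gauss_prob A y\<bar> \<le> \<Lambda> * l1_norm (x - y)"
  shows "\<bar>measure (gauss_law A t) {..x} - measure (gauss_law A t) {..y}\<bar>
      \<le> \<Lambda> / sqrt t * l1_norm (x - y)"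
proof -
  have "l1_norm ((1 / sqrt t) *\<^sub>R x - (1 / sqrt t) *\<^sub>R y) = l1_norm (x - y) / sqrt t"
    using \<open>t > 0\<close> by (simp add: l1_norm_scaleR flip: scaleR_diff_right)
  then show ?thesis
    using lipschitz[of "(1 / sqrt t) *\<^sub>R x" "(1 / sqrt t) *\<^sub>R y"] \<open>t > 0\<close>
    by (simp add: measure_gauss_law_atMost)
qed

context gauss_matched_law
begin

abbreviation walk_op :: "nat \<Rightarrow> (real^'m \<Rightarrow> real) \<Rightarrow> real^'m \<Rightarrow> real" where
  "walk_op n \<equiv> conv_op (convolution_power M n)"

abbreviation gauss_op :: "real \<Rightarrow> (real^'m \<Rightarrow> real) \<Rightarrow> real^'m \<Rightarrow> real" where
  "gauss_op t \<equiv> conv_op (gauss_law A t)"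

lemma borel_law_walk: "borel_law (convolution_power M n)"
  by (intro borel_law_convolution_power borel_law_axioms)

lemma bdd_borel_walk_op: "bdd_borel K f \<Longrightarrow> bdd_borel K (walk_op n f)"
  by (rule borel_law.bdd_borel_conv_op[OF borel_law_walk])

lemma bdd_borel_gauss_op: "bdd_borel K f \<Longrightarrow> bdd_borel K (gauss_op t f)"
  by (rule borel_law.bdd_borel_conv_op[OF borel_law_gauss_law])

lemma walk_op_Suc: "bdd_borel K f \<Longrightarrow> walk_op (Suc n) f = conv_op M (walk_op n f)"
  by (simp add: conv_op_convolution[OF borel_law_axioms borel_law_walk])

lemma walk_op_gauss_op: "bdd_borel K f \<Longrightarrow> walk_op n (gauss_op t f) = gauss_op t (walk_op n f)"
  by (rule conv_op_commute[OF borel_law_walk borel_law_gauss_law])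

definition desmoothing_const :: "real \<Rightarrow> real \<Rightarrow> real" where
  "desmoothing_const \<Lambda> R
    = \<Lambda> * (CARD('m) * (onorm ((*v) A) * R) + (\<integral>w. l1_norm (A *v w) \<partial>std_gauss))"

lemma desmoothing_const_nonneg: "\<Lambda> \<ge> 0 \<Longrightarrow> R > 0 \<Longrightarrow> desmoothing_const \<Lambda> R \<ge> 0"
  unfolding desmoothing_const_def using l1_norm_nonneg
  by (intro mult_nonneg_nonneg add_nonneg_nonneg integral_nonneg_AE onorm_pos_le
      matrix_vector_mul_bounded_linear)
     auto

lemma walk_cdf_minus_gauss_cdf_le_smoothed:
  fixes m n :: nat
  assumes "m \<ge> 1" "n \<ge> 1"
    and lipschitz: "\<Lambda> \<ge> 0" "\<And>x y. \<bar>gauss_prob A x - gauss_prob A y\<bar> \<le> \<Lambda> * l1_norm (x - y)"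
    and R: "R > 0" "measure std_gauss {w :: real^'n. norm w \<le> R} \<ge> 3/4"
    and smoothed: "\<And>z. \<bar>walk_op n (gauss_op m (indicator {..z})) 0
        - gauss_op (n + m) (indicator {..z}) 0\<bar> \<le> D"
  shows "\<bar>measure (convolution_power M n) {..z} - measure (gauss_law A n) {..z}\<bar>
    \<le> 2 * D + 4 * desmoothing_const \<Lambda> R * sqrt m / sqrt n"
proof -
  define a where "a = sqrt m * (onorm ((*v) A) * R)"
  note walk = borel_law_walk[of n] and gauss_n = borel_law_gauss_law[of A n]
  have "\<bar>measure (convolution_power M n) {..z} - measure (gauss_law A n) {..z}\<bar>
      \<le> 2 * D + 4 * (\<Lambda> / sqrt n) * (CARD('m) * a + (\<integral>y. l1_norm y \<partial>gauss_law A m))"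
  proof (rule smoothing_inequality[OF borel_law_gauss_law
      borel_law.bdd_borel_measure_atMost[OF walk] borel_law.mono_measure_atMost[OF walk]
      borel_law.bdd_borel_measure_atMost[OF gauss_n]])
    show "\<bar>measure (gauss_law A n) {..x} - measure (gauss_law A n) {..y}\<bar>
        \<le> \<Lambda> / sqrt n * l1_norm (x - y)" for x y
      using \<open>n \<ge> 1\<close> by (intro gauss_law_atMost_lipschitz lipschitz(2)) simp
    show "measure (gauss_law A m) {y. \<forall>i. \<bar>y $ i\<bar> \<le> a} \<ge> 3/4"
      using R(2) measure_gauss_law_cube_ge[of m R A] by (simp add: a_def)
    show "\<bar>(\<integral>y. measure (convolution_power M n) {..z - y} \<partial>gauss_law A m)
        - (\<integral>y. measure (gauss_law A n) {..z - y} \<partial>gauss_law A m)\<bar> \<le> D" for z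
      using smoothed[of z]
      by (simp add: integral_measure_atMost_diff walk gauss_n
          walk_op_gauss_op[OF bdd_borel_indicator_atMost]
          conv_op_gauss_law_add[OF bdd_borel_indicator_atMost] add.commute)
  qed (use lipschitz(1) R(1) in
      \<open>auto simp: a_def integrable_gauss_law_l1_norm intro!: mult_nonneg_nonneg onorm_pos_le\<close>)
  then show ?thesis
    by (simp add: desmoothing_const_def integral_gauss_law_l1_norm a_def algebra_simps
        add_divide_distrib)
qed

context
  fixes C :: real
  assumes C_nonneg: "C \<ge> 0"
    and swap: "\<And>j K f x. j > 0 \<Longrightarrow> bdd_borel K f \<Longrightarrow>
      \<bar>conv_op M (gauss_op j f) x - gauss_op (j + 1) f x\<bar> \<le> C * K * j powr (- (3/2))"
begin

lemma walk_op_swap_le: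
  assumes f: "bdd_borel 1 f" and "J > 0" and diff: "\<And>y. \<bar>walk_op k f y - gauss_op k f y\<bar> \<le> b"
  shows "\<bar>walk_op (Suc k) (gauss_op J f) x - walk_op k (gauss_op (J + 1) f) x\<bar>
    \<le> C * b * J powr (- (3/2)) + C * (J + k) powr (- (3/2))"
proof -
  define g h where "g = walk_op k f" and "h = gauss_op k f"
  have g: "bdd_borel 1 g" and h: "bdd_borel 1 h"
    unfolding g_def h_def by (intro bdd_borel_walk_op bdd_borel_gauss_op f)+
  have gh: "bdd_borel b (\<lambda>y. g y - h y)"
    by (rule bdd_borel_diff[OF g h]) (use diff in \<open>simp add: g_def h_def\<close>)
  have gauss_split: "gauss_op t g y = gauss_op t (\<lambda>y. g y - h y) y + gauss_op t h y" for t y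
    using borel_law.conv_op_diff[OF borel_law_gauss_law g h, of A t y] by simp
  have "conv_op M (gauss_op J g) x
      = conv_op M (gauss_op J (\<lambda>y. g y - h y)) x + conv_op M (gauss_op J h) x"
    using conv_op_diff[OF bdd_borel_gauss_op[OF g, of J] bdd_borel_gauss_op[OF h, of J], of x]
    by (simp add: gauss_split[of J])
  then have split: "conv_op M (gauss_op J g) x - gauss_op (J + 1) g x
      = (conv_op M (gauss_op J (\<lambda>y. g y - h y)) x - gauss_op (J + 1) (\<lambda>y. g y - h y) x)
      + (conv_op M (gauss_op J h) x - gauss_op (J + 1) h x)"
    using gauss_split[of "J + 1" x] by simp
  have semigroup: "gauss_op J h = gauss_op (J + k) f" "gauss_op (J + 1) h = gauss_op (J + k + 1) f"
    unfolding h_def using \<open>J > 0\<close> by (simp_all add: conv_op_gauss_law_add[OF f] add_ac)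
  have "walk_op (Suc k) (gauss_op J f) x - walk_op k (gauss_op (J + 1) f) x
      = conv_op M (gauss_op J g) x - gauss_op (J + 1) g x"
    unfolding g_def by (subst walk_op_Suc[OF bdd_borel_gauss_op[OF f]])
        (simp only: walk_op_gauss_op[OF f])
  then show ?thesis
    using swap[OF \<open>J > 0\<close> gh, of x] swap[OF _ f, of "J + k" x] \<open>J > 0\<close>
    unfolding split semigroup by simp
qed

lemma walk_op_gauss_op_diff_le:
  fixes m :: nat
  assumes f: "bdd_borel 1 f" and m: "m \<ge> 1"
    and diff: "\<And>k y. k < n \<Longrightarrow> \<bar>walk_op k f y - gauss_op k f y\<bar> \<le> b k"
  shows "\<bar>walk_op n (gauss_op m f) x - gauss_op (n + m) f x\<bar>
    \<le> (\<Sum>k<n. C * b k * real (n - 1 - k + m) powr (- (3/2)))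
      + n * (C * real (n - 1 + m) powr (- (3/2)))"
proof -
  define a where "a k = walk_op k (gauss_op (real (n - k + m)) f) x" for k
  have "walk_op n (gauss_op m f) x - gauss_op (n + m) f x = a n - a 0"
    by (simp add: a_def conv_op_return_0[OF bdd_borel_gauss_op[OF f]])
  also have "\<dots> = (\<Sum>k<n. a (Suc k) - a k)" by (rule sum_lessThan_telescope[symmetric])
  also have "\<bar>\<dots>\<bar> \<le> (\<Sum>k<n. \<bar>a (Suc k) - a k\<bar>)" by (rule sum_abs)
  also have "\<dots> \<le> (\<Sum>k<n. C * b k * real (n - 1 - k + m) powr (- (3/2))
        + C * real (n - 1 + m) powr (- (3/2)))"
  proof (rule sum_mono)
    fix k assume "k \<in> {..<n}"
    then have k: "k < n" by simp
    define J where "J = real (n - 1 - k + m)"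
    have J: "real (n - Suc k + m) = J" "real (n - k + m) = J + 1" "real (n - 1 + m) = J + k" "J > 0"
      using k m by (auto simp: J_def of_nat_diff)
    show "\<bar>a (Suc k) - a k\<bar> \<le> C * b k * real (n - 1 - k + m) powr (- (3/2))
        + C * real (n - 1 + m) powr (- (3/2))"
      unfolding a_def J J_def[symmetric] by (rule walk_op_swap_le[OF f J(4) diff[OF k]])
  qed
  finally show ?thesis by (simp only: sum.distrib sum_constant card_lessThan)
qed

lemma walk_op_gauss_op_diff_le_inverse_sqrt:
  fixes m :: nat
  assumes f: "bdd_borel 1 f" and m: "m \<ge> 1" and n: "n \<ge> 1" and "B \<ge> 0"
    and diff: "\<And>k y. k < n \<Longrightarrow> \<bar>walk_op k f y - gauss_op k f y\<bar> \<le> B / sqrt k"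
  shows "\<bar>walk_op n (gauss_op m f) x - gauss_op (n + m) f x\<bar> \<le> (9 * C * B / sqrt m + C) / sqrt n"
proof -
  have "\<bar>walk_op n (gauss_op m f) x - gauss_op (n + m) f x\<bar>
    \<le> (\<Sum>k<n. C * (B / sqrt k) * real (n - 1 - k + m) powr (- (3/2)))
      + n * (C * real (n - 1 + m) powr (- (3/2)))"
    by (rule walk_op_gauss_op_diff_le[OF f m diff])
  also have "(\<Sum>k<n. C * (B / sqrt k) * real (n - 1 - k + m) powr (- (3/2)))
      = C * B * (\<Sum>k<n. 1 / sqrt k * real (n - 1 - k + m) powr (- (3/2)))"
    by (simp add: sum_distrib_left)
  also have "\<dots> \<le> C * B * (9 / (sqrt m * sqrt n))"
    using C_nonneg \<open>B \<ge> 0\<close> by (intro mult_left_mono sum_inverse_sqrt_mult_powr_le m n) auto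
  also have "n * (C * real (n - 1 + m) powr (- (3/2))) \<le> n * (C * real n powr (- (3/2)))"
    using C_nonneg m n by (intro mult_left_mono powr_mono2') auto
  also have "\<dots> = C / sqrt n"
    using n by (simp add: powr_minus_three_halves)
  finally show ?thesis by (simp add: add_divide_distrib mult_ac)
qed

lemma walk_cdf_minus_gauss_cdf_step:
  fixes m n :: nat
  assumes m: "m \<ge> 1" and n: "n \<ge> 1"
    and lipschitz: "\<Lambda> \<ge> 0" "\<And>x y. \<bar>gauss_prob A x - gauss_prob A y\<bar> \<le> \<Lambda> * l1_norm (x - y)"
    and R: "R > 0" "measure std_gauss {w :: real^'n. norm w \<le> R} \<ge> 3/4"
    and "B \<ge> 0"
    and IH: "\<And>k z. k < n \<Longrightarrow>
      \<bar>measure (convolution_power M k) {..z} - measure (gauss_law A (real k)) {..z}\<bar> \<le> B / sqrt k"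
  shows "\<bar>measure (convolution_power M n) {..z} - measure (gauss_law A (real n)) {..z}\<bar>
    \<le> (18 * C * B / sqrt m + 2 * C + 4 * desmoothing_const \<Lambda> R * sqrt m) / sqrt n"
proof -
  have "\<bar>walk_op k (indicator {..z}) y - gauss_op k (indicator {..z}) y\<bar> \<le> B / sqrt k" if "k < n"
    for k y z
    using IH[OF that] by (simp add: borel_law.conv_op_indicator_atMost borel_law_walk
        borel_law_gauss_law)
  then have "\<bar>walk_op n (gauss_op m (indicator {..z})) 0 - gauss_op (n + m) (indicator {..z}) 0\<bar>
      \<le> (9 * C * B / sqrt m + C) / sqrt n" for z
    by (intro walk_op_gauss_op_diff_le_inverse_sqrt[OF bdd_borel_indicator_atMost m n \<open>B \<ge> 0\<close>]) auto
  note walk_cdf_minus_gauss_cdf_le_smoothed[OF m n lipschitz R this]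
  moreover have "2 * ((9 * C * B / sqrt m + C) / sqrt n) + x / sqrt n
      = (18 * C * B / sqrt m + 2 * C + x) / sqrt n" for x
    by (simp add: add_divide_distrib)
  ultimately show ?thesis by (simp only:)
qed

lemma walk_cdf_minus_gauss_cdf_le:
  fixes m :: nat
  assumes m: "m \<ge> 1"
    and lipschitz: "\<Lambda> \<ge> 0" "\<And>x y. \<bar>gauss_prob A x - gauss_prob A y\<bar> \<le> \<Lambda> * l1_norm (x - y)"
    and R: "R > 0" "measure std_gauss {w :: real^'n. norm w \<le> R} \<ge> 3/4"
    and B: "B \<ge> 0" "18 * C * B / sqrt m + 2 * C + 4 * desmoothing_const \<Lambda> R * sqrt m \<le> B"
  shows "\<bar>measure (convolution_power M n) {..z} - measure (gauss_law A (real n)) {..z}\<bar>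
      \<le> B / sqrt n"
proof (induction n arbitrary: z rule: less_induct)
  case (less n)
  show ?case
  proof (cases "n = 0")
    case True
    then show ?thesis by (simp add: gauss_law_0)
  next
    case False
    then have "\<bar>measure (convolution_power M n) {..z} - measure (gauss_law A n) {..z}\<bar>
        \<le> (18 * C * B / sqrt m + 2 * C + 4 * desmoothing_const \<Lambda> R * sqrt m) / sqrt n"
      by (intro walk_cdf_minus_gauss_cdf_step[OF m _ lipschitz R B(1)] less.IH) auto
    also have "\<dots> \<le> B / sqrt n" using B(2) by (rule divide_right_mono) simp
    finally show ?thesis .
  qed
qed

end

theorem berry_esseen_orthants:
  assumes nondegenerate: "\<And>i. second_moment M $ i $ i \<noteq> 0"
  obtains B where "B \<ge> 0"
    "\<And>n z. \<bar>measure (convolution_power M n) {..z} - measure (gauss_law A (real n)) {..z}\<bar>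
      \<le> B / sqrt n"
proof -
  have "\<exists>j. A $ i $ j \<noteq> 0" for i
    by (rule ccontr) (use nondegenerate[of i] in \<open>simp add: covariance matrix_matrix_mult_def\<close>)
  then obtain \<Lambda> where \<Lambda>: "\<Lambda> \<ge> 0" "\<And>x y. \<bar>gauss_prob A x - gauss_prob A y\<bar> \<le> \<Lambda> * l1_norm (x - y)"
    using gauss_prob_lipschitz by blast
  obtain C where C: "C \<ge> 0" "\<And>j K f x. j > 0 \<Longrightarrow> bdd_borel K f \<Longrightarrow>
      \<bar>conv_op M (gauss_op j f) x - gauss_op (j + 1) f x\<bar> \<le> C * K * j powr (- (3/2))"
    using gauss_swap by blast
  obtain R where R: "R > 0" "measure std_gauss {w :: real^'n. norm w \<le> R} \<ge> 3/4"
    using std_gauss_tight[of "1/4", where 'n='n] by auto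
  define m where "m = nat \<lceil>(36 * C)\<^sup>2\<rceil> + 1"
  have m: "m \<ge> 1" by (simp add: m_def)
  have "(36 * C)\<^sup>2 \<le> real m" unfolding m_def by linarith
  then have "36 * C \<le> sqrt m" by (rule real_le_rsqrt)
  then have sqrt_m: "18 * C / sqrt m \<le> 1/2" using m by (simp add: divide_le_eq)
  define B where "B = 4 * C + 8 * desmoothing_const \<Lambda> R * sqrt m"
  have B: "B \<ge> 0"
    unfolding B_def using C(1) desmoothing_const_nonneg[OF \<Lambda>(1) R(1)] by simp
  have "18 * C / sqrt m * B \<le> 1/2 * B" using sqrt_m B by (rule mult_right_mono)
  moreover have "2 * C + 4 * desmoothing_const \<Lambda> R * sqrt m = 1/2 * B" by (simp add: B_def)
  ultimately have "18 * C * B / sqrt m + 2 * C + 4 * desmoothing_const \<Lambda> R * sqrt m \<le> B" by simp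
  from walk_cdf_minus_gauss_cdf_le[OF C m \<Lambda> R B this] B show ?thesis
    by (intro that) auto
qed

end

section \<open>Increments of Gaussian orthant probabilities\<close>

lemma emeasure_std_normal_interval_ge:
  assumes "a \<le> b" "- L \<le> a" "b \<le> L"
  shows "ennreal ((b - a) * std_normal_density L) \<le> emeasure std_normal {a<..<b}"
proof -
  have "std_normal_density L \<le> std_normal_density t" if "t \<in> {a<..<b}" for t
  proof -
    have "\<bar>t\<bar> \<le> \<bar>L\<bar>" using that assms by auto
    then show ?thesis
      by (simp add: std_normal_density_def divide_right_mono abs_le_square_iff)
  qed
  then have "(\<integral>\<^sup>+t. ennreal (std_normal_density L) * indicator {a<..<b} t \<partial>lborel)
      \<le> (\<integral>\<^sup>+t. ennreal (std_normal_density t) * indicator {a<..<b} t \<partial>lborel)"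
    by (intro nn_integral_mono) (auto simp: indicator_def intro: ennreal_leI)
  also have "\<dots> = emeasure std_normal {a<..<b}"
    unfolding std_normal_measure_def by (rule emeasure_density[symmetric]) auto
  finally show ?thesis
    using assms by (simp add: nn_integral_cmult ennreal_mult' mult.commute)
qed

lemma interval_subset_neighbourhood_diff_above:
  fixes J J' :: "real set"
  assumes J: "t0 \<in> J" "- K \<le> t0" "\<And>t. t \<in> J \<Longrightarrow> t \<le> K" and "0 \<le> \<rho>"
    and neighbourhood: "\<And>t s. t \<in> J \<Longrightarrow> \<bar>s\<bar> \<le> \<rho> \<Longrightarrow> t + s \<in> J'"
  obtains a where "- K \<le> a" "a \<le> K" "{a<..<a + \<rho>} \<subseteq> J' - J"
proof
  have bdd: "bdd_above J" by (rule bdd_aboveI) (rule J(3))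
  have le_Sup: "t \<le> Sup J" if "t \<in> J" for t using that bdd by (rule cSup_upper)
  show "- K \<le> Sup J" using le_Sup[OF J(1)] J(2) by simp
  show "Sup J \<le> K" using J by (auto intro!: cSup_least)
  show "{Sup J<..<Sup J + \<rho>} \<subseteq> J' - J"
  proof
    fix t assume t: "t \<in> {Sup J<..<Sup J + \<rho>}"
    then have "t - \<rho> < Sup J" by simp
    then obtain x where x: "x \<in> J" "t - \<rho> < x" using less_cSup_iff[OF _ bdd] J(1) by auto
    then have "x + (t - x) \<in> J'" using t le_Sup[OF x(1)] by (intro neighbourhood) auto
    then show "t \<in> J' - J" using t le_Sup by force
  qed
qed

lemma interval_subset_neighbourhood_diff:
  fixes J J' :: "real set"
  assumes J: "t0 \<in> J" "\<bar>t0\<bar> \<le> K" and bounded: "(\<forall>t\<in>J. t \<le> K) \<or> (\<forall>t\<in>J. - K \<le> t)" and "0 \<le> \<rho>"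
    and neighbourhood: "\<And>t s. t \<in> J \<Longrightarrow> \<bar>s\<bar> \<le> \<rho> \<Longrightarrow> t + s \<in> J'"
  obtains a where "- (K + \<rho>) \<le> a" "a \<le> K" "{a<..<a + \<rho>} \<subseteq> J' - J"
  using bounded
proof
  assume "\<forall>t\<in>J. t \<le> K"
  then show ?thesis
    using interval_subset_neighbourhood_diff_above[OF J(1) _ _ \<open>0 \<le> \<rho>\<close> neighbourhood, of K]
      J(2) \<open>0 \<le> \<rho>\<close> that
    by (force simp: abs_le_iff)
next
  assume below: "\<forall>t\<in>J. - K \<le> t"
  have "- t0 \<in> uminus ` J" "- K \<le> - t0" using J by auto
  moreover have "t \<le> K" if "t \<in> uminus ` J" for t
    using that below by (auto simp: minus_le_iff)
  moreover have "t + s \<in> uminus ` J'" if "t \<in> uminus ` J" "\<bar>s\<bar> \<le> \<rho>" for t s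
    using that neighbourhood[of "- t" "- s"] by (force simp: image_iff)
  ultimately obtain a where a: "- K \<le> a" "a \<le> K" "{a<..<a + \<rho>} \<subseteq> uminus ` J' - uminus ` J"
    using interval_subset_neighbourhood_diff_above[of "- t0" "uminus ` J" K \<rho> "uminus ` J'"] \<open>0 \<le> \<rho>\<close>
    by blast
  have "{- (a + \<rho>)<..<- (a + \<rho>) + \<rho>} \<subseteq> J' - J"
  proof
    fix t assume "t \<in> {- (a + \<rho>)<..<- (a + \<rho>) + \<rho>}"
    then have "- t \<in> {a<..<a + \<rho>}" by auto
    with a(3) have "- t \<in> uminus ` J' - uminus ` J" by blast
    then show "t \<in> J' - J" by (auto simp: image_iff)
  qed
  then show ?thesis using a(1,2) \<open>0 \<le> \<rho>\<close> by (intro that[of "- (a + \<rho>)"]) auto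
qed

lemma measure_std_gauss_ge_lines:
  fixes E S :: "(real^'n::finite) set"
  assumes [measurable]: "E \<in> sets borel" "S \<in> sets borel" and "\<kappa> \<ge> 0"
    and line: "\<And>w. w \<in> E \<Longrightarrow> ennreal \<kappa> \<le> emeasure std_normal {t. vec_upd w j t \<in> S}"
  shows "\<kappa> * measure std_gauss E \<le> measure std_gauss S"
proof -
  have "ennreal \<kappa> * emeasure std_gauss E = (\<integral>\<^sup>+w. ennreal \<kappa> * indicator E w \<partial>std_gauss)"
    by (simp add: nn_integral_cmult)
  also have "\<dots> \<le> (\<integral>\<^sup>+w. emeasure std_normal {t. vec_upd w j t \<in> S} \<partial>std_gauss)"
    using line by (intro nn_integral_mono) (auto simp: indicator_def)
  also have "\<dots> = emeasure std_gauss S"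
    by (rule emeasure_std_gauss_lines[symmetric]) measurable
  finally show ?thesis
    using \<open>\<kappa> \<ge> 0\<close> by (simp add: std_gauss.emeasure_eq_measure ennreal_mult'[symmetric])
qed

definition line_slice :: "real^'n::finite^'m::finite \<Rightarrow> real^'n \<Rightarrow> 'n \<Rightarrow> real^'m \<Rightarrow> real set" where
  "line_slice A w l z = {t. A *v vec_upd w l t \<le> z}"

lemma sets_line_slice: "line_slice A w l z \<in> sets borel"
  unfolding line_slice_def less_eq_vec_def by (rule sets_borel_Collect) measurable

lemma line_slice_one_side_bounded:
  fixes A :: "real^'n::finite^'m::finite"
  assumes "A $ i $ l \<noteq> 0" "norm w \<le> R" "z $ i \<le> onorm ((*v) A) * R"
    and K: "2 * (onorm ((*v) A) * R) / \<bar>A $ i $ l\<bar> \<le> K"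
  shows "(\<forall>t\<in>line_slice A w l z. t \<le> K) \<or> (\<forall>t\<in>line_slice A w l z. - K \<le> t)"
proof -
  define r where "r = onorm ((*v) A) * R"
  have "norm (vec_upd w l 0) \<le> norm w" by (rule norm_le_componentwise_cart) (simp add: vec_upd_def)
  then have base: "\<bar>(A *v vec_upd w l 0) $ i\<bar> \<le> r"
    unfolding r_def using assms(2) by (intro abs_matrix_component_le) simp
  have active: "A $ i $ l * t \<le> 2 * r" if "t \<in> line_slice A w l z" for t
  proof -
    have "(A *v vec_upd w l 0) $ i + A $ i $ l * t \<le> z $ i"
      using that unfolding line_slice_def less_eq_vec_def matrix_vec_upd[of A w l t, symmetric]
      by simp
    then show ?thesis using base assms(3) by (simp add: r_def)
  qed
  show ?thesis
  proof (cases "A $ i $ l > 0")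
    case True
    then have "t \<le> 2 * r / \<bar>A $ i $ l\<bar>" if "t \<in> line_slice A w l z" for t
      using active[OF that] by (simp add: pos_le_divide_eq mult.commute)
    then show ?thesis using K unfolding r_def by (meson order_trans)
  next
    case False
    then have "A $ i $ l < 0" using assms(1) by simp
    then have "- t \<le> 2 * r / \<bar>A $ i $ l\<bar>" if "t \<in> line_slice A w l z" for t
      using active[OF that] by (simp add: field_simps)
    then show ?thesis using K unfolding r_def by (meson order_trans minus_le_iff)
  qed
qed

lemma line_slice_neighbourhood:
  fixes A :: "real^'n::finite^'m::finite"
  assumes t: "t \<in> line_slice A w l z" and s: "onorm ((*v) A) * \<bar>s\<bar> \<le> \<delta>"
  shows "t + s \<in> line_slice A w l (z + \<delta> *\<^sub>R 1)"
proof -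
  have "(A *v vec_upd w l (t + s)) $ k \<le> z $ k + \<delta>" for k
  proof -
    have "(A *v vec_upd w l (t + s)) $ k = (A *v vec_upd w l t) $ k + A $ k $ l * s"
      unfolding matrix_vec_upd[of A w l "t + s"] matrix_vec_upd[of A w l t]
      by (simp add: algebra_simps)
    moreover have "(A *v vec_upd w l t) $ k \<le> z $ k"
      using t by (simp add: line_slice_def less_eq_vec_def)
    moreover have "A $ k $ l * s \<le> \<bar>A $ k $ l\<bar> * \<bar>s\<bar>"
      by (metis abs_ge_self abs_mult)
    moreover have "\<bar>A $ k $ l\<bar> * \<bar>s\<bar> \<le> onorm ((*v) A) * \<bar>s\<bar>"
      by (intro mult_right_mono matrix_component_le_onorm) simp
    ultimately show ?thesis using s by linarith
  qed
  then show ?thesis by (simp add: line_slice_def less_eq_vec_def)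
qed

text \<open>The slice is bounded on one side, because \<open>z $ i\<close> is not too large; raising \<open>z\<close> by \<open>\<delta>\<close> enlarges
  it by a neighbourhood of radius proportional to \<open>\<delta>\<close>.\<close>

lemma emeasure_line_slice_increment_ge:
  fixes A :: "real^'n::finite^'m::finite"
  assumes "A $ i $ l \<noteq> 0" and w: "A *v w \<le> z" "norm w \<le> R" and z_i: "z $ i \<le> onorm ((*v) A) * R"
    and K: "R \<le> K" "2 * (onorm ((*v) A) * R) / \<bar>A $ i $ l\<bar> \<le> K" and \<delta>: "0 \<le> \<delta>" "\<delta> \<le> 1"
  shows "ennreal (\<delta> / (1 + onorm ((*v) A)) * std_normal_density (K + 1))
    \<le> emeasure std_normal (line_slice A w l (z + \<delta> *\<^sub>R 1) - line_slice A w l z)"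
proof -
  define b \<rho> where "b = onorm ((*v) A)" and "\<rho> = \<delta> / (1 + b)"
  have b: "b \<ge> 0" unfolding b_def by (intro onorm_pos_le matrix_vector_mul_bounded_linear)
  have \<rho>: "0 \<le> \<rho>" "\<rho> \<le> 1" "b * \<rho> \<le> \<delta>"
    using \<delta> b by (auto simp: \<rho>_def divide_le_eq mult_le_cancel_left1 field_simps)
  have "vec_upd w l (w $ l) = w" by (simp add: vec_upd_def vec_eq_iff)
  then have mem: "w $ l \<in> line_slice A w l z" using w by (simp add: line_slice_def)
  have mem_le: "\<bar>w $ l\<bar> \<le> K" using component_le_norm_cart[of w l] w(2) K by linarith
  have neighbourhood: "t + s \<in> line_slice A w l (z + \<delta> *\<^sub>R 1)" if t: "t \<in> line_slice A w l z"
    and s: "\<bar>s\<bar> \<le> \<rho>" for t s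
    using mult_left_mono[OF s b] \<rho>(3) by (intro line_slice_neighbourhood t) (simp add: b_def)
  obtain a where a: "- (K + \<rho>) \<le> a" "a \<le> K"
    "{a<..<a + \<rho>} \<subseteq> line_slice A w l (z + \<delta> *\<^sub>R 1) - line_slice A w l z"
    using interval_subset_neighbourhood_diff[OF mem mem_le
        line_slice_one_side_bounded[OF assms(1) w(2) z_i K(2)] \<rho>(1) neighbourhood] .
  have "ennreal ((a + \<rho> - a) * std_normal_density (K + 1)) \<le> emeasure std_normal {a<..<a + \<rho>}"
    using a \<rho> by (intro emeasure_std_normal_interval_ge) auto
  also have "\<dots> \<le> emeasure std_normal (line_slice A w l (z + \<delta> *\<^sub>R 1) - line_slice A w l z)"
    by (intro emeasure_mono a(3)) (simp add: sets.Diff sets_line_slice)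
  finally show ?thesis by (simp add: \<rho>_def b_def)
qed

lemma ex_component_less_if_gauss_prob_less:
  fixes A :: "real^'n::finite^'m::finite"
  assumes "gauss_prob A z < measure std_gauss {w :: real^'n. norm w \<le> R}"
  obtains i where "z $ i < onorm ((*v) A) * R"
proof (rule ccontr)
  assume "\<not> thesis"
  then have "onorm ((*v) A) * R \<le> z $ i" for i using that by (meson not_le)
  then have "(A *v w) $ i \<le> z $ i" if "norm w \<le> R" for w i
    using abs_matrix_component_le[OF that, of A i] by (meson abs_ge_self order_trans)
  then have "measure std_gauss {w :: real^'n. norm w \<le> R} \<le> gauss_prob A z"
    unfolding gauss_prob_def by (intro std_gauss.finite_measure_mono) (auto simp: less_eq_vec_def)
  with assms show False by simp
qed

lemma gauss_prob_ge_imp_bounded_below: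
  fixes A :: "real^'n::finite^'m::finite"
  assumes "\<alpha> > 0"
  obtains a where "a \<ge> 0" "\<And>z i. \<alpha> \<le> gauss_prob A z \<Longrightarrow> - a \<le> z $ i"
proof -
  obtain R where R: "R > 0" "measure std_gauss {w :: real^'n. norm w \<le> R} \<ge> 1 - \<alpha> / 2"
    using std_gauss_tight[of "\<alpha> / 2"] assms by auto
  define a where "a = onorm ((*v) A) * R"
  have "a \<ge> 0"
    unfolding a_def using R by (intro mult_nonneg_nonneg onorm_pos_le
        matrix_vector_mul_bounded_linear) simp
  moreover have "- a \<le> z $ i" if "\<alpha> \<le> gauss_prob A z" for z i
  proof (rule ccontr)
    assume "\<not> - a \<le> z $ i"
    then have "\<not> (A *v w) $ i \<le> z $ i" if "norm w \<le> R" for w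
      using abs_matrix_component_le[OF that, of A i] unfolding a_def by linarith
    then have "\<not> A *v w \<le> z" if "norm w \<le> R" for w
      using that unfolding less_eq_vec_def by blast
    then have "gauss_prob A z \<le> measure std_gauss (space std_gauss - {w :: real^'n. norm w \<le> R})"
      unfolding gauss_prob_def by (intro std_gauss.finite_measure_mono) auto
    also have "\<dots> = 1 - measure std_gauss {w :: real^'n. norm w \<le> R}"
      by (rule std_gauss.prob_compl) auto
    finally show False using R(2) that assms by linarith
  qed
  ultimately show ?thesis by (rule that)
qed

lemma measure_Int_norm_le_ge:
  fixes S :: "(real^'n::finite) set"
  assumes [measurable]: "S \<in> sets borel" and "measure std_gauss {w :: real^'n. norm w \<le> R} \<ge> 1 - \<eta>"
  shows "measure std_gauss (S \<inter> {w. norm w \<le> R}) \<ge> measure std_gauss S - \<eta>"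
proof -
  let ?N = "{w :: real^'n. norm w \<le> R}"
  have "measure std_gauss S \<le> measure std_gauss (S \<inter> ?N \<union> (space std_gauss - ?N))"
    by (intro std_gauss.finite_measure_mono) auto
  also have "\<dots> \<le> measure std_gauss (S \<inter> ?N) + measure std_gauss (space std_gauss - ?N)"
    by (intro measure_Un_le) auto
  also have "measure std_gauss (space std_gauss - ?N) = 1 - measure std_gauss ?N"
    by (intro std_gauss.prob_compl) auto
  finally show ?thesis using assms(2) by linarith
qed

lemma gauss_prob_increment_ge:
  fixes A :: "real^'n::finite^'m::finite"
  assumes "A $ i $ l \<noteq> 0" and z_i: "z $ i \<le> onorm ((*v) A) * R"
    and K: "R \<le> K" "2 * (onorm ((*v) A) * R) / \<bar>A $ i $ l\<bar> \<le> K" and \<delta>: "0 \<le> \<delta>" "\<delta> \<le> 1"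
  shows "gauss_prob A z + \<delta> / (1 + onorm ((*v) A)) * std_normal_density (K + 1)
      * measure std_gauss ({w. A *v w \<le> z} \<inter> {w. norm w \<le> R}) \<le> gauss_prob A (z + \<delta> *\<^sub>R 1)"
proof -
  define S where "S = {w. A *v w \<le> z + \<delta> *\<^sub>R 1} - {w. A *v w \<le> z}"
  have "\<delta> / (1 + onorm ((*v) A)) * std_normal_density (K + 1)
      * measure std_gauss ({w. A *v w \<le> z} \<inter> {w. norm w \<le> R}) \<le> measure std_gauss S"
  proof (rule measure_std_gauss_ge_lines)
    have "{t. vec_upd w l t \<in> S} = line_slice A w l (z + \<delta> *\<^sub>R 1) - line_slice A w l z" for w
      by (auto simp: S_def line_slice_def)
    then show "ennreal (\<delta> / (1 + onorm ((*v) A)) * std_normal_density (K + 1))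
        \<le> emeasure std_normal {t. vec_upd w l t \<in> S}" if "w \<in> {w. A *v w \<le> z} \<inter> {w. norm w \<le> R}"
          for w
      using emeasure_line_slice_increment_ge[OF assms(1) _ _ z_i K \<delta>, of w] that by simp
    show "0 \<le> \<delta> / (1 + onorm ((*v) A)) * std_normal_density (K + 1)"
      using \<delta> onorm_pos_le[OF matrix_vector_mul_bounded_linear, of A]
      by (intro mult_nonneg_nonneg divide_nonneg_nonneg) auto
  qed (simp_all add: S_def sets.Diff sets_borel_matrix_le)
  moreover have "measure std_gauss S = gauss_prob A (z + \<delta> *\<^sub>R 1) - gauss_prob A z"
    unfolding S_def gauss_prob_def using \<delta>(1)
    by (intro std_gauss.finite_measure_Diff) (auto simp: less_eq_vec_def intro: order_trans)
  ultimately show ?thesis by simp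
qed

lemma gauss_prob_increment:
  fixes A :: "real^'n::finite^'m::finite"
  assumes rows: "\<And>i. \<exists>j. A $ i $ j \<noteq> 0" and \<alpha>: "0 < \<alpha>" and \<beta>: "\<beta> < 1"
  obtains c where "c > 0" "\<And>z \<delta>. \<lbrakk>0 \<le> \<delta>; \<delta> \<le> 1; \<alpha> \<le> gauss_prob A z; gauss_prob A z \<le> \<beta>\<rbrakk> \<Longrightarrow>
    gauss_prob A z + c * \<delta> \<le> gauss_prob A (z + \<delta> *\<^sub>R 1)"
proof -
  obtain j where j: "\<And>i. A $ i $ j i \<noteq> 0" using rows by metis
  define b where "b = onorm ((*v) A)"
  have b: "b \<ge> 0" unfolding b_def by (intro onorm_pos_le matrix_vector_mul_bounded_linear)
  obtain R where R: "R > 0" "measure std_gauss {w :: real^'n. norm w \<le> R}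
      \<ge> 1 - min (\<alpha> / 2) ((1 - \<beta>) / 2)"
    using std_gauss_tight[of "min (\<alpha> / 2) ((1 - \<beta>) / 2)"] \<alpha> \<beta> by auto
  define K where "K = R + (\<Sum>i\<in>UNIV. 2 * (b * R) / \<bar>A $ i $ j i\<bar>)"
  have "2 * (b * R) / \<bar>A $ i $ j i\<bar> \<le> (\<Sum>i\<in>UNIV. 2 * (b * R) / \<bar>A $ i $ j i\<bar>)" for i
    by (rule member_le_sum[of i _ "\<lambda>i. 2 * (b * R) / \<bar>A $ i $ j i\<bar>"]) (use b R in auto)
  then have K: "2 * (b * R) / \<bar>A $ i $ j i\<bar> \<le> K" for i
    using R by (simp add: K_def add_increasing)
  have "R \<le> K" unfolding K_def using b R by (simp add: sum_nonneg)
  define \<kappa> where "\<kappa> = std_normal_density (K + 1) / (1 + b)"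
  have \<kappa>: "\<kappa> > 0" using b by (simp add: \<kappa>_def normal_density_pos)
  have "gauss_prob A z + \<kappa> * (\<alpha> / 2) * \<delta> \<le> gauss_prob A (z + \<delta> *\<^sub>R 1)"
    if \<delta>: "0 \<le> \<delta>" "\<delta> \<le> 1" and prob: "\<alpha> \<le> gauss_prob A z" "gauss_prob A z \<le> \<beta>" for z \<delta>
  proof -
    let ?E = "{w. A *v w \<le> z} \<inter> {w. norm w \<le> R}"
    have "gauss_prob A z < measure std_gauss {w :: real^'n. norm w \<le> R}"
      using prob R(2) \<beta> min.cobounded2[of "\<alpha> / 2" "(1 - \<beta>) / 2"] by argo
    then obtain i where i: "z $ i < b * R"
      unfolding b_def by (rule ex_component_less_if_gauss_prob_less)
    have "gauss_prob A z - min (\<alpha> / 2) ((1 - \<beta>) / 2) \<le> measure std_gauss ?E"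
      unfolding gauss_prob_def by (intro measure_Int_norm_le_ge R) measurable
    then have "\<alpha> / 2 \<le> measure std_gauss ?E" using prob by linarith
    then have "\<kappa> * \<delta> * (\<alpha> / 2) \<le> \<kappa> * \<delta> * measure std_gauss ?E"
      using \<kappa> \<delta> by (intro mult_left_mono) auto
    then show ?thesis
      using gauss_prob_increment_ge[OF j less_imp_le[OF i[unfolded b_def]] \<open>R \<le> K\<close> K[unfolded b_def]
          \<delta>]
      by (simp add: \<kappa>_def b_def mult_ac)
  qed
  moreover have "\<kappa> * (\<alpha> / 2) > 0" using \<kappa> \<alpha> by simp
  ultimately show ?thesis by (rule that[rotated])
qed

lemma gauss_prob_quantile_shift:
  fixes A :: "real^'n::finite^'m::finite"
  assumes "\<And>i. \<exists>j. A $ i $ j \<noteq> 0" and "0 < \<alpha>" "\<beta> < 1"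
  obtains \<rho> L where "\<rho> > 0"
    "\<And>x y z. \<lbrakk>0 \<le> x; x \<le> \<rho>; \<alpha> \<le> y; y + x \<le> \<beta>; y \<le> gauss_prob A z\<rbrakk> \<Longrightarrow>
      y + x \<le> gauss_prob A (z + (L * x) *\<^sub>R 1)"
proof -
  obtain c where c: "c > 0" "\<And>z \<delta>. \<lbrakk>0 \<le> \<delta>; \<delta> \<le> 1; \<alpha> \<le> gauss_prob A z; gauss_prob A z \<le> \<beta>\<rbrakk> \<Longrightarrow>
      gauss_prob A z + c * \<delta> \<le> gauss_prob A (z + \<delta> *\<^sub>R 1)"
    using gauss_prob_increment[OF assms] by blast
  have "y + x \<le> gauss_prob A (z + (1 / c * x) *\<^sub>R 1)"
    if x: "0 \<le> x" "x \<le> c" and y: "\<alpha> \<le> y" "y + x \<le> \<beta>" "y \<le> gauss_prob A z" for x y z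
  proof (cases "gauss_prob A z \<le> \<beta>")
    case True
    then show ?thesis using c(2)[of "1 / c * x" z] c(1) x y by simp
  next
    case False
    have "gauss_prob A z \<le> gauss_prob A (z + (1 / c * x) *\<^sub>R 1)"
      using c(1) x by (intro gauss_prob_mono) (simp add: less_eq_vec_def)
    with False y(2) show ?thesis by linarith
  qed
  with c(1) show ?thesis by (rule that)
qed

section \<open>Random binning\<close>

definition binnings :: "'x set \<Rightarrow> nat \<Rightarrow> ('x \<Rightarrow> nat) set" where
  "binnings X M = (\<Pi>\<^sub>E x\<in>X. {1..M})"

lemma finite_binnings: "finite X \<Longrightarrow> finite (binnings X M)"
  unfolding binnings_def by (intro finite_PiE) auto

lemma binnings_nonempty: "M > 0 \<Longrightarrow> binnings X M \<noteq> {}"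
  by (auto simp: binnings_def PiE_eq_empty_iff)

lemma card_binnings: "finite X \<Longrightarrow> card (binnings X M) = M ^ card X"
  by (simp add: binnings_def card_PiE)

definition colliding :: "'x set \<Rightarrow> nat \<Rightarrow> 'x \<Rightarrow> 'x \<Rightarrow> ('x \<Rightarrow> nat) set" where
  "colliding X M x y = {f \<in> binnings X M. f x = f y}"

lemma finite_colliding: "finite X \<Longrightarrow> finite (colliding X M x y)"
  by (simp add: colliding_def finite_binnings)

lemma colliding_insert_eq_image:
  assumes "x \<in> X" "y \<notin> X"
  shows "colliding (insert y X) M x y = (\<lambda>g. g(y := g x)) ` binnings X M"
  unfolding colliding_def
proof (intro equalityI subsetI)
  fix f assume f: "f \<in> {f \<in> binnings (insert y X) M. f x = f y}"
  have "f a = ((restrict f X)(y := restrict f X x)) a" for a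
    using f assms PiE_arb[of f "insert y X" "\<lambda>_. {1..M}" a] unfolding binnings_def
    by (cases "a = y"; cases "a \<in> X") auto
  then have "f = (restrict f X)(y := restrict f X x)" by blast
  moreover have "restrict f X \<in> binnings X M"
    using f by (auto simp: binnings_def)
  ultimately show "f \<in> (\<lambda>g. g(y := g x)) ` binnings X M" by blast
next
  fix f assume "f \<in> (\<lambda>g. g(y := g x)) ` binnings X M"
  then show "f \<in> {f \<in> binnings (insert y X) M. f x = f y}"
    using assms by (auto simp: binnings_def PiE_iff extensional_def)
qed

lemma card_colliding:
  assumes X: "finite X" "x \<in> X" "y \<in> X" "x \<noteq> y" and M: "M > 0"
  shows "real (card (colliding X M x y)) = card (binnings X M) / M"
proof -
  define X' where "X' = X - {y}"
  have X': "X = insert y X'" "x \<in> X'" "y \<notin> X'" "finite X'"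
    unfolding X'_def using X by auto
  have inj: "inj_on (\<lambda>g. g(y := g x)) (binnings X' M)"
  proof (rule inj_onI)
    fix g h assume mem: "g \<in> binnings X' M" "h \<in> binnings X' M" and eq: "g(y := g x) = h(y := h x)"
    have "g y = h y" using mem[unfolded binnings_def, THEN PiE_arb, OF X'(3)] by simp
    moreover have "g a = h a" if "a \<noteq> y" for a using fun_cong[OF eq, of a] that by simp
    ultimately have "g a = h a" for a by (cases "a = y") simp_all
    then show "g = h" by blast
  qed
  have "card (colliding X M x y) = M ^ card X'"
    unfolding X'(1) colliding_insert_eq_image[OF X'(2,3)] card_image[OF inj]
    by (rule card_binnings[OF X'(4)])
  moreover have "card (binnings X M) = M * M ^ card X'"
    using X'(3,4) by (simp add: X'(1) card_binnings)
  ultimately show ?thesis using M by simp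
qed

definition confusable :: "('x \<times> 'y) set \<Rightarrow> 'x \<times> 'y \<Rightarrow> ('x \<Rightarrow> nat) \<Rightarrow> ('y \<Rightarrow> nat) \<Rightarrow> bool" where
  "confusable T x f g \<longleftrightarrow> (\<exists>y\<in>T. y \<noteq> x \<and> f (fst y) = f (fst x) \<and> g (snd y) = g (snd x))"

lemma confusable_cases [consumes 1, case_names first second both]:
  assumes "confusable T x f g"
  obtains a where "(a, snd x) \<in> T" "a \<noteq> fst x" "f a = f (fst x)"
  | b where "(fst x, b) \<in> T" "b \<noteq> snd x" "g b = g (snd x)"
  | y where "y \<in> T" "fst y \<noteq> fst x" "snd y \<noteq> snd x" "f (fst y) = f (fst x)" "g (snd y) = g (snd x)"
proof -
  obtain y where y: "y \<in> T" "y \<noteq> x" "f (fst y) = f (fst x)" "g (snd y) = g (snd x)"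
    using assms by (auto simp: confusable_def)
  show ?thesis
  proof (cases "fst y = fst x"; cases "snd y = snd x")
    assume "fst y = fst x" "snd y = snd x"
    with y(2) show ?thesis by (simp add: prod_eq_iff)
  next
    assume same_fst: "fst y = fst x" "snd y \<noteq> snd x"
    then have "(fst x, snd y) \<in> T" using y(1) by (metis prod.collapse)
    with same_fst y(4) show ?thesis by (intro that(2))
  next
    assume same_snd: "fst y \<noteq> fst x" "snd y = snd x"
    then have "(fst y, snd x) \<in> T" using y(1) by (metis prod.collapse)
    with same_snd y(3) show ?thesis by (intro that(1))
  next
    assume "fst y \<noteq> fst x" "snd y \<noteq> snd x"
    with y show ?thesis by (intro that(3))
  qed
qed

lemma confusable_binnings_subset:
  "{(f, g) \<in> binnings X M \<times> binnings Y N. confusable T x f g}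
    \<subseteq> (\<Union>a\<in>{a. (a, snd x) \<in> T} - {fst x}. colliding X M a (fst x) \<times> binnings Y N)
    \<union> (\<Union>b\<in>{b. (fst x, b) \<in> T} - {snd x}. binnings X M \<times> colliding Y N b (snd x))
    \<union> (\<Union>y\<in>{y \<in> T. fst y \<noteq> fst x \<and> snd y \<noteq> snd x}.
    colliding X M (fst y) (fst x) \<times> colliding Y N (snd y) (snd x))"
    (is "_ \<subseteq> ?bound")
proof -
  have "(f, g) \<in> ?bound" if "confusable T x f g" "f \<in> binnings X M" "g \<in> binnings Y N" for f g
    using that(1)
  proof (cases rule: confusable_cases)
    case (first a)
    then have "a \<in> {a. (a, snd x) \<in> T} - {fst x}" "f \<in> colliding X M a (fst x)"
      using that by (auto simp: colliding_def)
    with that show ?thesis by blast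
  next
    case (second b)
    then have "b \<in> {b. (fst x, b) \<in> T} - {snd x}" "g \<in> colliding Y N b (snd x)"
      using that by (auto simp: colliding_def)
    with that show ?thesis by blast
  next
    case (both y)
    then have "f \<in> colliding X M (fst y) (fst x)" "g \<in> colliding Y N (snd y) (snd x)"
      using that by (auto simp: colliding_def)
    with both show ?thesis by blast
  qed
  then show ?thesis by blast
qed

lemma card_confusable_binnings_le:
  assumes X: "finite X" and Y: "finite Y" and T: "T \<subseteq> X \<times> Y" "x \<in> T" and M: "M > 0" and N: "N > 0"
  shows "real (card {(f, g) \<in> binnings X M \<times> binnings Y N. confusable T x f g})
    \<le> card (binnings X M \<times> binnings Y N)
      * (card {a. (a, snd x) \<in> T} / M + card {b. (fst x, b) \<in> T} / N + card T / (real M * N))"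
proof -
  let ?F = "binnings X M" and ?G = "binnings Y N"
  define A1 A2 A3 where "A1 = {a. (a, snd x) \<in> T} - {fst x}"
    and "A2 = {b. (fst x, b) \<in> T} - {snd x}"
    and "A3 = {y \<in> T. fst y \<noteq> fst x \<and> snd y \<noteq> snd x}"
  define FC GC where "FC a = colliding X M a (fst x)" and "GC b = colliding Y N b (snd x)" for a b
  have "{a. (a, snd x) \<in> T} \<subseteq> X" "{b. (fst x, b) \<in> T} \<subseteq> Y" using T by auto
  then have fin: "finite {a. (a, snd x) \<in> T}" "finite {b. (fst x, b) \<in> T}" "finite T"
    using X Y T by (auto intro: finite_subset)
  then have fin_A: "finite A1" "finite A2" "finite A3" by (simp_all add: A1_def A2_def A3_def)
  have card_FC: "real (card (FC a)) = card ?F / M" if "a \<in> A1 \<union> fst ` A3" for a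
    unfolding FC_def using that T M by (intro card_colliding X) (auto simp: A1_def A3_def)
  have card_GC: "real (card (GC b)) = card ?G / N" if "b \<in> A2 \<union> snd ` A3" for b
    unfolding GC_def using that T N by (intro card_colliding Y) (auto simp: A2_def A3_def)
  have "card {(f, g) \<in> ?F \<times> ?G. confusable T x f g}
      \<le> card ((\<Union>a\<in>A1. FC a \<times> ?G) \<union> (\<Union>b\<in>A2. ?F \<times> GC b) \<union> (\<Union>y\<in>A3. FC (fst y) \<times> GC (snd y)))"
    unfolding A1_def A2_def A3_def FC_def GC_def using fin
    by (intro card_mono confusable_binnings_subset)
        (simp_all add: X Y finite_binnings finite_colliding)
  also have "\<dots> \<le> (\<Sum>a\<in>A1. card (FC a \<times> ?G)) + (\<Sum>b\<in>A2. card (?F \<times> GC b))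
      + (\<Sum>y\<in>A3. card (FC (fst y) \<times> GC (snd y)))"
    using fin_A by (intro order_trans[OF card_Un_le] add_mono card_UN_le)
  finally have "real (card {(f, g) \<in> ?F \<times> ?G. confusable T x f g})
      \<le> (\<Sum>a\<in>A1. real (card (FC a)) * card ?G)
      + (\<Sum>b\<in>A2. card ?F * real (card (GC b)))
      + (\<Sum>y\<in>A3. real (card (FC (fst y))) * real (card (GC (snd y))))"
    unfolding card_cartesian_product of_nat_mult[symmetric] of_nat_sum[symmetric]
        of_nat_add[symmetric] of_nat_le_iff .
  also have "\<dots> = card ?F * card ?G * (card A1 / M + card A2 / N + card A3 / (real M * N))"
    by (simp add: card_FC card_GC algebra_simps)
  also have "\<dots> \<le> card ?F * card ?G
      * (card {a. (a, snd x) \<in> T} / M + card {b. (fst x, b) \<in> T} / N + card T / (real M * N))"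
    using fin
    by (intro mult_left_mono add_mono divide_right_mono of_nat_mono card_mono)
        (auto simp: A1_def A2_def A3_def)
  finally show ?thesis by (simp add: card_cartesian_product)
qed

definition bin_decoder ::
  "('x \<times> 'y) set \<Rightarrow> 'x \<times> 'y \<Rightarrow> ('x \<Rightarrow> nat) \<Rightarrow> ('y \<Rightarrow> nat) \<Rightarrow> nat \<Rightarrow> nat \<Rightarrow> 'x \<times> 'y" where
  "bin_decoder T d f g i j =
    (if \<exists>y\<in>T. f (fst y) = i \<and> g (snd y) = j
     then SOME y. y \<in> T \<and> f (fst y) = i \<and> g (snd y) = j
     else d)"

lemma bin_decoder_mem_bins:
  assumes "\<exists>y\<in>T. f (fst y) = i \<and> g (snd y) = j"
  shows "bin_decoder T d f g i j \<in> T
    \<and> f (fst (bin_decoder T d f g i j)) = i \<and> g (snd (bin_decoder T d f g i j)) = j"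
  unfolding bin_decoder_def if_P[OF assms]
  using someI_ex[OF assms[unfolded Bex_def]] .

lemma bin_decoder_mem: "T \<subseteq> S \<Longrightarrow> d \<in> S \<Longrightarrow> bin_decoder T d f g i j \<in> S"
  using bin_decoder_mem_bins[of T f i g j d] by (auto simp: bin_decoder_def)

lemma bin_decoder_error_imp_confusable:
  assumes "x \<in> T" "bin_decoder T d f g (f (fst x)) (g (snd x)) \<noteq> x"
  shows "confusable T x f g"
  using assms bin_decoder_mem_bins[of T f "f (fst x)" g "g (snd x)" d]
  by (auto simp: confusable_def)

lemma exists_le_average:
  fixes h :: "'i \<Rightarrow> real" and b :: real
  assumes "finite I" "I \<noteq> {}" "(\<Sum>i\<in>I. h i) \<le> card I * b"
  obtains i where "i \<in> I" "h i \<le> b"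
proof (rule ccontr)
  assume "\<not> thesis"
  then have "(\<Sum>i\<in>I. b) < (\<Sum>i\<in>I. h i)"
    using that assms by (intro sum_strict_mono) (auto simp: not_le[symmetric])
  with assms(3) show False by simp
qed

definition decoding_error ::
  "('x \<times> 'y) set \<Rightarrow> 'x \<times> 'y \<Rightarrow> ('x \<Rightarrow> nat) \<times> ('y \<Rightarrow> nat) \<Rightarrow> 'x \<times> 'y \<Rightarrow> bool" where
  "decoding_error T d fg x \<longleftrightarrow>
    bin_decoder T d (fst fg) (snd fg) (fst fg (fst x)) (snd fg (snd x)) \<noteq> x"

lemma card_decoding_errors_le:
  fixes \<beta> :: real
  assumes X: "finite X" and Y: "finite Y" and T: "T \<subseteq> X \<times> Y" and M: "M > 0" and N: "N > 0"
    and collisions: "\<And>x. x \<in> T \<Longrightarrow>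
      card {a. (a, snd x) \<in> T} / M + card {b. (fst x, b) \<in> T} / N + card T / (real M * N) \<le> \<beta>"
      "\<beta> \<ge> 0"
  defines "FG \<equiv> binnings X M \<times> binnings Y N"
  shows "real (card {fg \<in> FG. decoding_error T d fg x}) \<le> card FG * (of_bool (x \<notin> T) + \<beta>)"
proof (cases "x \<in> T")
  case True
  have "{fg \<in> FG. decoding_error T d fg x} \<subseteq> {(f, g) \<in> FG. confusable T x f g}"
    using bin_decoder_error_imp_confusable[OF True, of d] by (auto simp: decoding_error_def)
  then have "card {fg \<in> FG. decoding_error T d fg x} \<le> card {(f, g) \<in> FG. confusable T x f g}"
    using X Y by (intro card_mono) (auto simp: FG_def finite_binnings intro: finite_subset[of _ FG])
  also have "real \<dots> \<le> card FG * \<beta>"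
    unfolding FG_def
    using order_trans[OF card_confusable_binnings_le[OF X Y T True M N]
        mult_left_mono[OF collisions(1)[OF True]]]
    by simp
  finally show ?thesis using True by simp
next
  case False
  have "card {fg \<in> FG. decoding_error T d fg x} \<le> card FG"
    using X Y by (intro card_mono) (auto simp: FG_def finite_binnings)
  then have "real (card {fg \<in> FG. decoding_error T d fg x}) \<le> real (card FG) * 1" by simp
  also have "\<dots> \<le> card FG * (of_bool (x \<notin> T) + \<beta>)"
    using False collisions(2) by (intro mult_left_mono) auto
  finally show ?thesis .
qed

lemma random_binning:
  fixes P :: "'x \<times> 'y \<Rightarrow> real" and \<beta> :: real
  assumes X: "finite X" and Y: "finite Y" and T: "T \<subseteq> X \<times> Y" and M: "M > 0" and N: "N > 0"
    and P: "\<And>x. P x \<ge> 0" "(\<Sum>x\<in>X \<times> Y. P x) = 1"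
    and collisions: "\<And>x. x \<in> T \<Longrightarrow>
      card {a. (a, snd x) \<in> T} / M + card {b. (fst x, b) \<in> T} / N + card T / (real M * N) \<le> \<beta>"
      "\<beta> \<ge> 0"
  obtains f g where "f \<in> binnings X M" "g \<in> binnings Y N"
    "(\<Sum>x\<in>X \<times> Y. P x * of_bool (bin_decoder T d f g (f (fst x)) (g (snd x)) \<noteq> x))
      \<le> (\<Sum>x\<in>X \<times> Y - T. P x) + \<beta>"
proof -
  define FG where "FG = binnings X M \<times> binnings Y N"
  have FG: "finite FG" "FG \<noteq> {}"
    using X Y M N by (auto simp: FG_def finite_binnings binnings_nonempty)
  have "(\<Sum>fg\<in>FG. \<Sum>x\<in>X \<times> Y. P x * of_bool (decoding_error T d fg x))
      = (\<Sum>x\<in>X \<times> Y. P x * real (card {fg \<in> FG. decoding_error T d fg x}))"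
    using FG by (subst sum.swap) (simp add: sum_distrib_left[symmetric] Int_def)
  also have "\<dots> \<le> (\<Sum>x\<in>X \<times> Y. P x * (card FG * (of_bool (x \<notin> T) + \<beta>)))"
    unfolding FG_def by (intro sum_mono mult_left_mono card_decoding_errors_le X Y T M N P
        collisions)
  also have "\<dots> = card FG * ((\<Sum>x\<in>X \<times> Y. P x * of_bool (x \<notin> T)) + (\<Sum>x\<in>X \<times> Y. P x) * \<beta>)"
    by (simp add: sum_distrib_left sum_distrib_right sum.distrib algebra_simps)
  also have "(\<Sum>x\<in>X \<times> Y. P x * of_bool (x \<notin> T)) = (\<Sum>x\<in>X \<times> Y - T. P x)"
    using X Y by (intro sum.mono_neutral_cong_right) auto
  finally have "(\<Sum>fg\<in>FG. \<Sum>x\<in>X \<times> Y. P x * of_bool (decoding_error T d fg x))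
      \<le> card FG * ((\<Sum>x\<in>X \<times> Y - T. P x) + \<beta>)"
    by (simp add: P)
  from exists_le_average[OF FG this] obtain fg where "fg \<in> FG"
    "(\<Sum>x\<in>X \<times> Y. P x * of_bool (decoding_error T d fg x)) \<le> (\<Sum>x\<in>X \<times> Y - T. P x) + \<beta>" .
  then show ?thesis by (auto simp: FG_def decoding_error_def intro: that)
qed

section \<open>Memoryless sources\<close>

definition seq_pairs :: "nat \<Rightarrow> ((nat \<Rightarrow> 'a) \<times> (nat \<Rightarrow> 'b)) set" where
  "seq_pairs n = seqs n \<times> seqs n"

definition seq_prob :: "('a \<times> 'b \<Rightarrow> real) \<Rightarrow> nat \<Rightarrow> (nat \<Rightarrow> 'a) \<times> (nat \<Rightarrow> 'b) \<Rightarrow> real" where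
  "seq_prob p n x = (\<Prod>k<n. p (fst x k, snd x k))"

definition seq_density ::
  "('a::finite \<times> 'b::finite \<Rightarrow> real) \<Rightarrow> nat \<Rightarrow> (nat \<Rightarrow> 'a) \<times> (nat \<Rightarrow> 'b) \<Rightarrow> real^3" where
  "seq_density p n x = (\<Sum>k<n. ent_density p (fst x k, snd x k))"

definition typical ::
  "('a::finite \<times> 'b::finite \<Rightarrow> real) \<Rightarrow> nat \<Rightarrow> real^3 \<Rightarrow> ((nat \<Rightarrow> 'a) \<times> (nat \<Rightarrow> 'b)) set" where
  "typical p n t = {x \<in> seq_pairs n. seq_density p n x \<le> t}"

definition seq_cdf :: "('a::finite \<times> 'b::finite \<Rightarrow> real) \<Rightarrow> nat \<Rightarrow> real^3 \<Rightarrow> real" where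
  "seq_cdf p n t = (\<Sum>x\<in>typical p n t. seq_prob p n x)"

lemma finite_seqs: "finite (seqs n :: (nat \<Rightarrow> 'a::finite) set)"
  unfolding seqs_def by (intro finite_PiE) auto

lemma finite_seq_pairs: "finite (seq_pairs n :: ((nat \<Rightarrow> 'a::finite) \<times> (nat \<Rightarrow> 'b::finite)) set)"
  by (simp add: seq_pairs_def finite_seqs)

lemma typical_subset: "typical p n t \<subseteq> seq_pairs n"
  by (auto simp: typical_def)

lemma finite_typical: "finite (typical p n t)"
  using typical_subset finite_seq_pairs by (rule finite_subset)

lemma undefined_mem_seqs: "(\<lambda>_. undefined) \<in> seqs n"
  by (simp add: seqs_def PiE_def extensional_def)

lemma sum_seqs_prod:
  fixes f :: "nat \<Rightarrow> 'a::finite \<Rightarrow> real"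
  shows "(\<Sum>x\<in>seqs n. \<Prod>k<n. f k (x k)) = (\<Prod>k<n. \<Sum>a\<in>UNIV. f k a)"
  unfolding seqs_def by (rule prod_sum_PiE[symmetric]) auto

lemma sum_seqs_Suc:
  fixes F :: "(nat \<Rightarrow> 'a::finite) \<Rightarrow> real"
  shows "(\<Sum>x\<in>seqs (Suc n). F x) = (\<Sum>x\<in>seqs n. \<Sum>a\<in>UNIV. F (x(n := a)))"
proof -
  have "seqs (Suc n) = (\<lambda>(y, g). g(n := y)) ` (UNIV \<times> (seqs n :: (nat \<Rightarrow> 'a) set))"
    unfolding seqs_def lessThan_Suc by (rule PiE_insert_eq)
  moreover have "inj_on (\<lambda>(y, g). g(n := y)) (UNIV \<times> (seqs n :: (nat \<Rightarrow> 'a) set))"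
    unfolding seqs_def by (rule inj_combinator) simp
  ultimately have "(\<Sum>x\<in>seqs (Suc n). F x) = (\<Sum>(y, g)\<in>UNIV \<times> seqs n. F (g(n := y)))"
    by (simp add: sum.reindex case_prod_unfold)
  also have "\<dots> = (\<Sum>y\<in>UNIV. \<Sum>g\<in>seqs n. F (g(n := y)))" by (simp add: sum.cartesian_product)
  also have "\<dots> = (\<Sum>x\<in>seqs n. \<Sum>a\<in>UNIV. F (x(n := a)))" by (rule sum.swap)
  finally show ?thesis .
qed

lemma sum_seq_pairs:
  "(\<Sum>x\<in>seq_pairs n. F x) = (\<Sum>x1\<in>seqs n. \<Sum>x2\<in>seqs n. F (x1, x2))"
  by (simp add: seq_pairs_def sum.cartesian_product)

lemma sum_seq_pairs_Suc:
  fixes F :: "(nat \<Rightarrow> 'a::finite) \<times> (nat \<Rightarrow> 'b::finite) \<Rightarrow> real"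
  shows "(\<Sum>x\<in>seq_pairs (Suc n). F x)
      = (\<Sum>x\<in>seq_pairs n. \<Sum>c\<in>UNIV. F ((fst x)(n := fst c), (snd x)(n := snd c)))"
proof -
  have "(\<Sum>c\<in>UNIV. G c) = (\<Sum>a\<in>UNIV. \<Sum>b\<in>UNIV. G (a, b))" for G :: "'a \<times> 'b \<Rightarrow> real"
    by (simp add: sum.cartesian_product)
  then show ?thesis
    unfolding sum_seq_pairs sum_seqs_Suc by (simp add: sum.swap[of _ "seqs n" "UNIV :: 'a set"])
qed

lemma sw_error_eq_sum_seq_pairs:
  "sw_error p n f g \<phi> = (\<Sum>x\<in>seq_pairs n. seq_prob p n x * of_bool (\<phi> (f (fst x)) (g (snd x)) \<noteq> x))"
  by (simp add: sw_error_def sum_seq_pairs seq_prob_def of_bool_def)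

lemma powr_minus_sum_log:
  fixes g :: "nat \<Rightarrow> real"
  assumes "\<And>k. g k > 0"
  shows "2 powr (- (\<Sum>k<n. - log 2 (g k))) = (\<Prod>k<n. g k)"
  using assms by (induction n) (auto simp: powr_add powr_diff powr_minus field_simps)

lemma card_le_powr:
  fixes f :: "'x \<Rightarrow> real"
  assumes A: "finite A" and f: "\<And>x. x \<in> A \<Longrightarrow> f x \<ge> 0" "sum f A \<le> m" and m: "m > 0"
    and P: "\<And>x. x \<in> A \<Longrightarrow> P x \<Longrightarrow> 2 powr (- r) * m \<le> f x"
  shows "real (card {x\<in>A. P x}) \<le> 2 powr r"
proof -
  have "real (card {x\<in>A. P x}) * (2 powr (- r) * m) = (\<Sum>x\<in>{x\<in>A. P x}. 2 powr (- r) * m)" by simp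
  also have "\<dots> \<le> sum f {x\<in>A. P x}" using P by (intro sum_mono) auto
  also have "\<dots> \<le> sum f A" using A f(1) by (intro sum_mono2) auto
  also have "\<dots> \<le> m" by (rule f(2))
  finally have "real (card {x\<in>A. P x}) * 2 powr (- r) \<le> 1" using m
    by (simp add: mult.assoc[symmetric])
  then show ?thesis by (simp add: powr_minus field_simps)
qed

locale positive_source =
  fixes p :: "'a::finite \<times> 'b::finite \<Rightarrow> real"
  assumes pos: "\<And>x. p x > 0" and total: "(\<Sum>x\<in>UNIV. p x) = 1"
begin

abbreviation seq_marg1 :: "nat \<Rightarrow> (nat \<Rightarrow> 'a) \<Rightarrow> real" where
  "seq_marg1 n x1 \<equiv> \<Prod>k<n. marg1 p (x1 k)"

abbreviation seq_marg2 :: "nat \<Rightarrow> (nat \<Rightarrow> 'b) \<Rightarrow> real" where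
  "seq_marg2 n x2 \<equiv> \<Prod>k<n. marg2 p (x2 k)"

lemma marg1_pos: "marg1 p a > 0" and marg2_pos: "marg2 p b > 0"
  unfolding marg1_def marg2_def by (auto intro!: sum_pos pos)

lemma seq_prob_pos: "seq_prob p n x > 0"
  unfolding seq_prob_def by (intro prod_pos) (simp add: pos)

lemma seq_prob_nonneg: "seq_prob p n x \<ge> 0"
  by (rule less_imp_le[OF seq_prob_pos])

lemma seq_cdf_mono: "t \<le> t' \<Longrightarrow> seq_cdf p n t \<le> seq_cdf p n t'"
  unfolding seq_cdf_def
  by (intro sum_mono2 finite_typical seq_prob_nonneg) (auto simp: typical_def)

lemma seq_marg1_pos: "seq_marg1 n x1 > 0" and seq_marg2_pos: "seq_marg2 n x2 > 0"
  by (auto intro!: prod_pos marg1_pos marg2_pos)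

lemma sum_marg1: "(\<Sum>a\<in>UNIV. marg1 p a) = 1"
  unfolding marg1_def using total by (simp add: sum.cartesian_product)

lemma sum_marg2: "(\<Sum>b\<in>UNIV. marg2 p b) = 1"
  unfolding marg2_def using sum_marg1[unfolded marg1_def] by (subst sum.swap)

lemma sum_seq_prob_fst: "(\<Sum>x1\<in>seqs n. seq_prob p n (x1, x2)) = seq_marg2 n x2"
  unfolding seq_prob_def marg2_def using sum_seqs_prod[of "\<lambda>k a. p (a, x2 k)" n] by simp

lemma sum_seq_prob_snd: "(\<Sum>x2\<in>seqs n. seq_prob p n (x1, x2)) = seq_marg1 n x1"
  unfolding seq_prob_def marg1_def using sum_seqs_prod[of "\<lambda>k a. p (x1 k, a)" n] by simp

lemma sum_seq_marg1: "(\<Sum>x1\<in>seqs n. seq_marg1 n x1) = 1"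
  using sum_seqs_prod[of "\<lambda>k. marg1 p" n] by (simp add: sum_marg1)

lemma sum_seq_marg2: "(\<Sum>x2\<in>seqs n. seq_marg2 n x2) = 1"
  using sum_seqs_prod[of "\<lambda>k. marg2 p" n] by (simp add: sum_marg2)

lemma sum_seq_prob: "(\<Sum>x\<in>seq_pairs n. seq_prob p n x) = 1"
  by (simp add: sum_seq_pairs sum_seq_prob_snd sum_seq_marg1)

lemma sum_seq_prob_Diff:
  "S \<subseteq> seq_pairs n \<Longrightarrow> (\<Sum>x\<in>seq_pairs n - S. seq_prob p n x) = 1 - (\<Sum>x\<in>S. seq_prob p n x)"
  using sum_diff[OF finite_seq_pairs, of S n "seq_prob p n"] by (simp add: sum_seq_prob)

lemma seq_prob_eq_powr_density1:
  "seq_prob p n x = 2 powr (- (seq_density p n x $ 1)) * seq_marg2 n (snd x)"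
proof -
  have "2 powr (- (seq_density p n x $ 1)) = (\<Prod>k<n. p (fst x k, snd x k) / marg2 p (snd x k))"
    unfolding seq_density_def ent_density_def
    by (simp add: powr_minus_sum_log pos marg2_pos del: sum_negf)
  then show ?thesis
    using less_imp_neq[OF marg2_pos] by (simp add: seq_prob_def flip: prod.distrib)
qed

lemma seq_prob_eq_powr_density2:
  "seq_prob p n x = 2 powr (- (seq_density p n x $ 2)) * seq_marg1 n (fst x)"
proof -
  have "2 powr (- (seq_density p n x $ 2)) = (\<Prod>k<n. p (fst x k, snd x k) / marg1 p (fst x k))"
    unfolding seq_density_def ent_density_def
    by (simp add: powr_minus_sum_log pos marg1_pos del: sum_negf)
  then show ?thesis
    using less_imp_neq[OF marg1_pos] by (simp add: seq_prob_def flip: prod.distrib)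
qed

lemma seq_prob_eq_powr_density3: "seq_prob p n x = 2 powr (- (seq_density p n x $ 3))"
  unfolding seq_prob_def seq_density_def ent_density_def
  by (simp add: powr_minus_sum_log pos del: sum_negf)

lemma card_typical_fst_le: "real (card {x1. (x1, x2) \<in> typical p n t}) \<le> 2 powr (t $ 1)"
proof (cases "x2 \<in> seqs n")
  case True
  have "real (card {x1 \<in> seqs n. (x1, x2) \<in> typical p n t}) \<le> 2 powr (t $ 1)"
  proof (rule card_le_powr[where f="\<lambda>x1. seq_prob p n (x1, x2)", OF finite_seqs seq_prob_nonneg _
      seq_marg2_pos])
    show "2 powr (- (t $ 1)) * seq_marg2 n x2 \<le> seq_prob p n (x1, x2)" if "(x1, x2) \<in> typical p n t"
      for x1
      using that seq_marg2_pos[of x2 n]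
      by (auto simp: seq_prob_eq_powr_density1 typical_def less_eq_vec_def intro!: mult_right_mono)
  qed (simp add: sum_seq_prob_fst)
  moreover have "{x1. (x1, x2) \<in> typical p n t} = {x1 \<in> seqs n. (x1, x2) \<in> typical p n t}"
    by (auto simp: typical_def seq_pairs_def)
  ultimately show ?thesis by simp
qed (simp add: typical_def seq_pairs_def)

lemma card_typical_snd_le: "real (card {x2. (x1, x2) \<in> typical p n t}) \<le> 2 powr (t $ 2)"
proof (cases "x1 \<in> seqs n")
  case True
  have "real (card {x2 \<in> seqs n. (x1, x2) \<in> typical p n t}) \<le> 2 powr (t $ 2)"
  proof (rule card_le_powr[where f="\<lambda>x2. seq_prob p n (x1, x2)", OF finite_seqs seq_prob_nonneg _
      seq_marg1_pos])
    show "2 powr (- (t $ 2)) * seq_marg1 n x1 \<le> seq_prob p n (x1, x2)" if "(x1, x2) \<in> typical p n t"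
      for x2
      using that seq_marg1_pos[of x1 n]
      by (auto simp: seq_prob_eq_powr_density2 typical_def less_eq_vec_def intro!: mult_right_mono)
  qed (simp add: sum_seq_prob_snd)
  moreover have "{x2. (x1, x2) \<in> typical p n t} = {x2 \<in> seqs n. (x1, x2) \<in> typical p n t}"
    by (auto simp: typical_def seq_pairs_def)
  ultimately show ?thesis by simp
qed (simp add: typical_def seq_pairs_def)

lemma card_typical_le: "real (card (typical p n t)) \<le> 2 powr (t $ 3)"
  unfolding typical_def
proof (rule card_le_powr[where f="seq_prob p n", OF finite_seq_pairs seq_prob_nonneg _
    zero_less_one])
  show "2 powr (- (t $ 3)) * 1 \<le> seq_prob p n x" if "seq_density p n x \<le> t" for x
    using that by (simp add: seq_prob_eq_powr_density3 less_eq_vec_def)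
qed (simp add: sum_seq_prob)

end

section \<open>One-shot Slepian--Wolf coding bounds\<close>

lemma rate_vec_nth [simp]:
  "rate_vec R1 R2 $ 1 = R1" "rate_vec R1 R2 $ 2 = R2" "rate_vec R1 R2 $ 3 = R1 + R2"
  by (simp_all add: rate_vec_def)

lemma powr_le_msg_size: "2 powr (real n * R) \<le> real (msg_size n R)"
  unfolding msg_size_def by (rule real_nat_ceiling_ge)

lemma msg_size_pos: "msg_size n R > 0"
  using less_le_trans[OF _ powr_le_msg_size, of 0 n R] by simp

lemma msg_size_le:
  assumes "R \<ge> 0"
  shows "real (msg_size n R) \<le> 2 * 2 powr (real n * R)"
proof -
  have "2 powr (real n * R) \<ge> 1"
    using assms by (intro ge_one_powr_ge_zero) auto
  moreover have "real (msg_size n R) = of_int \<lceil>2 powr (real n * R)\<rceil>"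
    by (simp add: msg_size_def)
  ultimately show ?thesis
    using of_int_ceiling_le_add_one[of "2 powr (real n * R)"] by linarith
qed

lemma divide_le_powr_minus:
  fixes r s m :: real
  assumes "r \<le> 2 powr (s - \<gamma>)" "2 powr s \<le> m"
  shows "r / m \<le> 2 powr (- \<gamma>)"
proof -
  have "r / m \<le> 2 powr (s - \<gamma>) / 2 powr s"
    using assms by (intro frac_le) auto
  also have "\<dots> = 2 powr (- \<gamma>)"
    by (simp add: powr_diff powr_minus_divide)
  finally show ?thesis .
qed

lemma sum_le_powr_by_fibres:
  fixes P :: "'x \<Rightarrow> real" and g :: "'x \<Rightarrow> 'k"
  assumes D: "finite D" "finite K" "g ` D \<subseteq> K"
    and P: "\<And>x. x \<in> D \<Longrightarrow> P x \<le> 2 powr (- (a + 2 + \<gamma>)) * m (g x)"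
    and m: "\<And>k. m k \<ge> 0" "sum m K = 1"
    and fibre: "\<And>k. real (card {x\<in>D. g x = k}) \<le> 4 * 2 powr a"
  shows "sum P D \<le> 2 powr (- \<gamma>)"
proof -
  let ?b = "2 powr (- (a + 2 + \<gamma>))"
  have "sum P D \<le> (\<Sum>x\<in>D. ?b * m (g x))" using P by (rule sum_mono)
  also have "\<dots> = (\<Sum>k\<in>K. \<Sum>x\<in>{x\<in>D. g x = k}. ?b * m (g x))" by (rule sum.group[OF D, symmetric])
  also have "\<dots> = (\<Sum>k\<in>K. real (card {x\<in>D. g x = k}) * (?b * m k))" by simp
  also have "\<dots> \<le> (\<Sum>k\<in>K. (4 * 2 powr a) * (?b * m k))"
    by (intro sum_mono mult_right_mono fibre mult_nonneg_nonneg m) simp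
  also have "\<dots> = 4 * 2 powr a * ?b" using m(2)
    by (simp add: sum_distrib_left[symmetric] mult.assoc[symmetric])
  also have "\<dots> = 2 powr 2 * 2 powr a * ?b" by simp
  also have "\<dots> = 2 powr (2 + a + - (a + 2 + \<gamma>))" by (simp only: powr_add)
  finally show ?thesis by simp
qed

lemma card_le_if_inj_on_Pair:
  assumes inj: "inj_on (\<lambda>x. (u x, v x)) D" and "u ` D \<subseteq> {1..M::nat}"
    and S: "S \<subseteq> D" "\<And>x. x \<in> S \<Longrightarrow> v x = c"
  shows "card S \<le> M"
proof -
  have "inj_on u S"
  proof (rule inj_onI)
    fix x y assume "x \<in> S" "y \<in> S" "u x = u y"
    then show "x = y" using S by (intro inj_onD[OF inj]) auto
  qed
  then have "card S \<le> card {1..M}"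
    using assms by (intro card_inj_on_le) auto
  then show ?thesis by simp
qed

lemma sum_UNION_le:
  fixes f :: "'x \<Rightarrow> real"
  assumes "finite I" "\<And>i. i \<in> I \<Longrightarrow> finite (E i)" "\<And>x. f x \<ge> 0"
  shows "sum f (\<Union>i\<in>I. E i) \<le> (\<Sum>i\<in>I. sum f (E i))"
proof -
  have "sum f (\<Union>i\<in>I. E i) \<le> (\<Sum>(i, x)\<in>Sigma I E. f x)"
    using assms by (intro sum_le_included[where i=snd]) (auto intro!: bexI)
  then show ?thesis
    using assms by (simp add: sum.Sigma)
qed

context positive_source
begin

lemma achievability_bound:
  assumes R: "R1 \<ge> 0" "R2 \<ge> 0"
    and \<epsilon>: "1 - seq_cdf p n (real n *\<^sub>R rate_vec R1 R2 - \<gamma> *\<^sub>R 1) + 3 * 2 powr (- \<gamma>) \<le> \<epsilon>"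
  shows "sw_achievable p n \<epsilon> R1 R2"
proof -
  define t where "t = real n *\<^sub>R rate_vec R1 R2 - \<gamma> *\<^sub>R 1"
  define d :: "(nat \<Rightarrow> 'a) \<times> (nat \<Rightarrow> 'b)" where "d = (\<lambda>_. undefined, \<lambda>_. undefined)"
  let ?M = "msg_size n R1" and ?N = "msg_size n R2" and ?T = "typical p n t"
  have collisions: "card {a. (a, snd x) \<in> ?T} / ?M + card {b. (fst x, b) \<in> ?T} / ?N
      + card ?T / (real ?M * ?N) \<le> 3 * 2 powr (- \<gamma>)" for x
  proof -
    have "2 powr (n * (R1 + R2)) \<le> real ?M * real ?N"
      by (simp add: distrib_left powr_add mult_mono powr_le_msg_size)
    then have "card ?T / (real ?M * ?N) \<le> 2 powr (- \<gamma>)"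
      using card_typical_le[of n t] by (intro divide_le_powr_minus) (auto simp: t_def)
    moreover have "card {a. (a, snd x) \<in> ?T} / ?M \<le> 2 powr (- \<gamma>)"
      using card_typical_fst_le[of "snd x" n t] powr_le_msg_size[of n R1]
      by (intro divide_le_powr_minus) (auto simp: t_def)
    moreover have "card {b. (fst x, b) \<in> ?T} / ?N \<le> 2 powr (- \<gamma>)"
      using card_typical_snd_le[of "fst x" n t] powr_le_msg_size[of n R2]
      by (intro divide_le_powr_minus) (auto simp: t_def)
    ultimately show ?thesis by linarith
  qed
  obtain f g where code: "f \<in> binnings (seqs n) ?M" "g \<in> binnings (seqs n) ?N"
    and "(\<Sum>x\<in>seqs n \<times> seqs n. seq_prob p n x
        * of_bool (bin_decoder ?T d f g (f (fst x)) (g (snd x)) \<noteq> x))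
      \<le> (\<Sum>x\<in>seqs n \<times> seqs n - ?T. seq_prob p n x) + 3 * 2 powr (- \<gamma>)"
    using random_binning[OF finite_seqs finite_seqs typical_subset[unfolded seq_pairs_def]
        msg_size_pos msg_size_pos seq_prob_nonneg
        sum_seq_prob[unfolded seq_pairs_def] collisions, of d] by auto
  then have "sw_error p n f g (bin_decoder ?T d f g) \<le> 1 - seq_cdf p n t + 3 * 2 powr (- \<gamma>)"
    by (simp add: sw_error_eq_sum_seq_pairs seq_pairs_def[symmetric]
        sum_seq_prob_Diff[OF typical_subset] seq_cdf_def)
  also have "\<dots> \<le> \<epsilon>" using \<epsilon> by (simp add: t_def)
  finally have "sw_error p n f g (bin_decoder ?T d f g) \<le> \<epsilon>" .
  moreover have "bin_decoder ?T d f g i j \<in> seqs n \<times> seqs n" for i j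
    by (rule bin_decoder_mem[OF typical_subset[unfolded seq_pairs_def]])
        (simp add: d_def undefined_mem_seqs)
  ultimately show ?thesis
    unfolding sw_achievable_def using R code
    by (auto simp: binnings_def intro!: exI[of _ f] exI[of _ g] exI[of _ "bin_decoder ?T d f g"])
qed

text \<open>A code is injective on the set \<open>D\<close> it decodes correctly, so the elements of \<open>D\<close> with a given
  second component number at most \<open>msg_size n R1\<close>, and similarly for the other two components.\<close>

lemma atypical1_decodable_mass_le:
  assumes D: "D \<subseteq> seq_pairs n" and f: "\<forall>x\<in>seqs n. f x \<in> {1..msg_size n R1}" and "R1 \<ge> 0"
    and inj: "inj_on (\<lambda>x. (f (fst x), g (snd x))) D"
  shows "(\<Sum>x\<in>{x \<in> D. n * R1 + 2 + \<gamma> < seq_density p n x $ 1}. seq_prob p n x) \<le> 2 powr (- \<gamma>)"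
    (is "sum _ ?D' \<le> _")
proof (rule sum_le_powr_by_fibres[where g=snd and m="seq_marg2 n" and a="n * R1", OF _ finite_seqs])
  show "finite ?D'" using finite_subset[OF D finite_seq_pairs] by simp
  show "snd ` ?D' \<subseteq> seqs n" using D by (auto simp: seq_pairs_def)
  show "seq_prob p n x \<le> 2 powr (- (n * R1 + 2 + \<gamma>)) * seq_marg2 n (snd x)" if "x \<in> ?D'" for x
    using that seq_marg2_pos by (auto simp: seq_prob_eq_powr_density1 less_imp_le
        intro!: mult_right_mono)
  show "real (card {x \<in> ?D'. snd x = b}) \<le> 4 * 2 powr (n * R1)" for b
  proof -
    have "card {x \<in> ?D'. snd x = b} \<le> msg_size n R1"
      using D f by (intro card_le_if_inj_on_Pair[OF inj, where c="g b"]) (auto simp: seq_pairs_def)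
    then show ?thesis using msg_size_le[OF \<open>R1 \<ge> 0\<close>, of n] powr_ge_zero[of 2 "n * R1"] by simp
  qed
qed (use seq_marg2_pos in \<open>auto simp: less_imp_le sum_seq_marg2\<close>)

lemma atypical2_decodable_mass_le:
  assumes D: "D \<subseteq> seq_pairs n" and g: "\<forall>x\<in>seqs n. g x \<in> {1..msg_size n R2}" and "R2 \<ge> 0"
    and inj: "inj_on (\<lambda>x. (f (fst x), g (snd x))) D"
  shows "(\<Sum>x\<in>{x \<in> D. n * R2 + 2 + \<gamma> < seq_density p n x $ 2}. seq_prob p n x) \<le> 2 powr (- \<gamma>)"
    (is "sum _ ?D' \<le> _")
proof (rule sum_le_powr_by_fibres[where g=fst and m="seq_marg1 n" and a="n * R2", OF _ finite_seqs])
  show "finite ?D'" using finite_subset[OF D finite_seq_pairs] by simp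
  show "fst ` ?D' \<subseteq> seqs n" using D by (auto simp: seq_pairs_def)
  show "seq_prob p n x \<le> 2 powr (- (n * R2 + 2 + \<gamma>)) * seq_marg1 n (fst x)" if "x \<in> ?D'" for x
    using that seq_marg1_pos by (auto simp: seq_prob_eq_powr_density2 less_imp_le
        intro!: mult_right_mono)
  show "real (card {x \<in> ?D'. fst x = a}) \<le> 4 * 2 powr (n * R2)" for a
  proof -
    have swapped: "inj_on (\<lambda>x. (g (snd x), f (fst x))) D"
      using inj by (auto simp: inj_on_def)
    have "card {x \<in> ?D'. fst x = a} \<le> msg_size n R2"
      using D g by (intro card_le_if_inj_on_Pair[OF swapped, where c="f a"])
          (auto simp: seq_pairs_def)
    then show ?thesis using msg_size_le[OF \<open>R2 \<ge> 0\<close>, of n] powr_ge_zero[of 2 "n * R2"] by simp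
  qed
qed (use seq_marg1_pos in \<open>auto simp: less_imp_le sum_seq_marg1\<close>)

lemma atypical3_decodable_mass_le:
  assumes D: "D \<subseteq> seq_pairs n" and f: "\<forall>x\<in>seqs n. f x \<in> {1..msg_size n R1}" and "R1 \<ge> 0"
    and g: "\<forall>x\<in>seqs n. g x \<in> {1..msg_size n R2}" and "R2 \<ge> 0"
    and inj: "inj_on (\<lambda>x. (f (fst x), g (snd x))) D"
  shows "(\<Sum>x\<in>{x \<in> D. n * (R1 + R2) + 2 + \<gamma> < seq_density p n x $ 3}. seq_prob p n x) \<le> 2 powr (- \<gamma>)"
    (is "sum _ ?D' \<le> _")
proof (rule sum_le_powr_by_fibres[where g="\<lambda>_. ()" and K="{()}"
      and m="\<lambda>_. 1" and a="n * (R1 + R2)"])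
  show "finite ?D'" using finite_subset[OF D finite_seq_pairs] by simp
  show "seq_prob p n x \<le> 2 powr (- (n * (R1 + R2) + 2 + \<gamma>)) * 1" if "x \<in> ?D'" for x
    using that by (auto simp: seq_prob_eq_powr_density3)
  have "card ?D' \<le> card ({1..msg_size n R1} \<times> {1..msg_size n R2})"
  proof (rule card_inj_on_le)
    show "inj_on (\<lambda>x. (f (fst x), g (snd x))) ?D'"
      using inj by (rule inj_on_subset) auto
    show "(\<lambda>x. (f (fst x), g (snd x))) ` ?D' \<subseteq> {1..msg_size n R1} \<times> {1..msg_size n R2}"
      using D f g unfolding seq_pairs_def by fastforce
  qed simp
  then have "real (card ?D') \<le> real (msg_size n R1) * real (msg_size n R2)"
    unfolding of_nat_mult[symmetric] of_nat_le_iff by simp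
  also have "\<dots> \<le> (2 * 2 powr (n * R1)) * (2 * 2 powr (n * R2))"
    by (intro mult_mono msg_size_le \<open>R1 \<ge> 0\<close> \<open>R2 \<ge> 0\<close>) auto
  also have "\<dots> = 4 * 2 powr (n * (R1 + R2))" by (simp add: distrib_left powr_add)
  finally show "real (card {x \<in> ?D'. () = u}) \<le> 4 * 2 powr (n * (R1 + R2))" for u by simp
qed auto

lemma decodable_mass_le:
  assumes D: "D \<subseteq> seq_pairs n" and inj: "inj_on (\<lambda>x. (f (fst x), g (snd x))) D"
    and f: "\<forall>x\<in>seqs n. f x \<in> {1..msg_size n R1}" "R1 \<ge> 0"
    and g: "\<forall>x\<in>seqs n. g x \<in> {1..msg_size n R2}" "R2 \<ge> 0"
  shows "(\<Sum>x\<in>D. seq_prob p n x) \<le> seq_cdf p n (real n *\<^sub>R rate_vec R1 R2 + (2 + \<gamma>) *\<^sub>R 1)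
      + 3 * 2 powr (- \<gamma>)"
proof -
  define t where "t = real n *\<^sub>R rate_vec R1 R2 + (2 + \<gamma>) *\<^sub>R 1"
  define atypical where "atypical i = {x \<in> D. t $ i < seq_density p n x $ i}" for i
  let ?P = "sum (seq_prob p n)"
  have finite: "finite (atypical i)" for i
    using finite_subset[OF D finite_seq_pairs] by (simp add: atypical_def)
  have "?P (atypical 1) \<le> 2 powr (- \<gamma>)"
    using atypical1_decodable_mass_le[OF D f inj, of \<gamma>] by (simp add: atypical_def t_def add.assoc)
  moreover have "?P (atypical 2) \<le> 2 powr (- \<gamma>)"
    using atypical2_decodable_mass_le[OF D g inj, of \<gamma>] by (simp add: atypical_def t_def add.assoc)
  moreover have "?P (atypical 3) \<le> 2 powr (- \<gamma>)"
    using atypical3_decodable_mass_le[OF D f g inj, of \<gamma>]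
    by (simp add: atypical_def t_def add.assoc)
  ultimately have "?P (atypical i) \<le> 2 powr (- \<gamma>)" for i
    using exhaust_3[of i] by metis
  then have "(\<Sum>i\<in>UNIV. ?P (atypical i)) \<le> (\<Sum>i\<in>(UNIV :: 3 set). 2 powr (- \<gamma>))"
    by (intro sum_mono)
  then have atypical: "(\<Sum>i\<in>UNIV. ?P (atypical i)) \<le> 3 * 2 powr (- \<gamma>)"
    by simp
  have "?P D \<le> ?P (typical p n t \<union> (\<Union>i. atypical i))"
  proof (rule sum_mono2)
    have "x \<in> typical p n t" if "x \<in> D" "\<And>i. x \<notin> atypical i" for x
      using that D by (auto simp: typical_def atypical_def less_eq_vec_def not_less)
    then show "D \<subseteq> typical p n t \<union> (\<Union>i. atypical i)" by blast
  qed (use finite finite_typical seq_prob_nonneg in auto)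
  also have "\<dots> \<le> ?P (typical p n t) + ?P (\<Union>i. atypical i)"
    using finite by (subst sum_Un) (auto simp: finite_typical sum_nonneg seq_prob_nonneg)
  also have "?P (\<Union>i. atypical i) \<le> (\<Sum>i\<in>UNIV. ?P (atypical i))"
    by (rule sum_UNION_le) (use finite seq_prob_nonneg in auto)
  finally show ?thesis
    using atypical unfolding seq_cdf_def t_def by linarith
qed

lemma converse_bound:
  assumes "sw_achievable p n \<epsilon> R1 R2"
  shows "1 - \<epsilon> \<le> seq_cdf p n (real n *\<^sub>R rate_vec R1 R2 + (2 + \<gamma>) *\<^sub>R 1) + 3 * 2 powr (- \<gamma>)"
proof -
  obtain f g \<phi> where R: "R1 \<ge> 0" "R2 \<ge> 0"
    and f: "\<forall>x\<in>seqs n. f x \<in> {1..msg_size n R1}" and g: "\<forall>x\<in>seqs n. g x \<in> {1..msg_size n R2}"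
    and \<epsilon>: "sw_error p n f g \<phi> \<le> \<epsilon>"
    using assms unfolding sw_achievable_def by blast
  define D where "D = {x \<in> seq_pairs n. \<phi> (f (fst x)) (g (snd x)) = x}"
  have D: "D \<subseteq> seq_pairs n" by (auto simp: D_def)
  have inj: "inj_on (\<lambda>x. (f (fst x), g (snd x))) D"
    unfolding D_def by (rule inj_onI) (metis (mono_tags, lifting) mem_Collect_eq prod.inject)
  have "sw_error p n f g \<phi> = (\<Sum>x\<in>seq_pairs n - D. seq_prob p n x)"
    unfolding sw_error_eq_sum_seq_pairs
    by (rule sum.mono_neutral_cong_right) (auto simp: finite_seq_pairs D_def)
  then have "1 - \<epsilon> \<le> (\<Sum>x\<in>D. seq_prob p n x)"
    using \<epsilon> by (simp add: sum_seq_prob_Diff[OF D])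
  also note decodable_mass_le[OF D inj f R(1) g R(2), of \<gamma>]
  finally show ?thesis .
qed

end

section \<open>Normal approximation of the source\<close>

lemma gram_matrix_square_root:
  fixes v :: "'m::finite \<Rightarrow> 'v::euclidean_space"
  obtains A :: "real^'m^'m" where "A ** transpose A = (\<chi> i j. v i \<bullet> v j)"
proof -
  obtain B where B: "pairwise orthogonal B" "\<And>x. x \<in> B \<Longrightarrow> norm x = 1" "independent B"
      "card B = dim (span (range v))" "span B = span (range v)"
    using orthonormal_basis_subspace[OF subspace_span[of "range v"]] by metis
  have "finite B" using B(3) by (rule independent_imp_finite)
  have "card B \<le> card (range v)" unfolding B(4) dim_span by (rule dim_le_card') simp
  also have "\<dots> \<le> CARD('m)" by (rule card_image_le) simp
  finally obtain e :: "'v \<Rightarrow> 'm" where e: "inj_on e B"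
    using card_le_inj[OF \<open>finite B\<close>, of "UNIV :: 'm set"] by auto
  define A :: "real^'m^'m" where "A = (\<chi> i k. if k \<in> e ` B then v i \<bullet> inv_into B e k else 0)"
  have "(A ** transpose A) $ i $ j = v i \<bullet> v j" for i j
  proof -
    have "(A ** transpose A) $ i $ j = (\<Sum>k\<in>UNIV. A $ i $ k * A $ j $ k)"
      by (simp add: matrix_matrix_mult_def transpose_def)
    also have "\<dots> = (\<Sum>k\<in>e ` B. (v i \<bullet> inv_into B e k) * (v j \<bullet> inv_into B e k))"
      by (rule sum.mono_neutral_cong_right) (auto simp: A_def)
    also have "\<dots> = (\<Sum>b\<in>B. (v i \<bullet> b) * (v j \<bullet> b))"
      by (subst sum.reindex[OF e]) (auto simp: e)
    also have "\<dots> = (\<Sum>b\<in>B. (v i \<bullet> b) *\<^sub>R b) \<bullet> v j"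
      unfolding inner_sum_left inner_scaleR_left by (simp add: inner_commute)
    also have "(\<Sum>b\<in>B. (v i \<bullet> b) *\<^sub>R b) = v i"
      by (rule orthonormal_basis_expand) (use B \<open>finite B\<close> in \<open>auto intro: span_base\<close>)
    finally show ?thesis .
  qed
  then show ?thesis by (intro that[of A]) (simp add: vec_eq_iff)
qed

definition finite_law ::
  "('c::finite \<Rightarrow> real) \<Rightarrow> ('c \<Rightarrow> 'v::ordered_euclidean_space) \<Rightarrow> 'v measure" where
  "finite_law q d = distr (point_measure UNIV (\<lambda>c. ennreal (q c))) borel d"

lemma integral_finite_law:
  fixes f :: "'v::ordered_euclidean_space \<Rightarrow> 'b::{banach, second_countable_topology}"
  assumes "f \<in> borel_measurable borel" "\<And>c. q c \<ge> 0"
  shows "(\<integral>y. f y \<partial>finite_law q d) = (\<Sum>c\<in>UNIV. q c *\<^sub>R f (d c))"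
  using assms unfolding finite_law_def
  by (subst integral_distr) (auto simp: lebesgue_integral_point_measure_finite)

lemma borel_law_finite_law:
  assumes "\<And>c. q c \<ge> 0" "(\<Sum>c\<in>UNIV. q c) = 1"
  shows "borel_law (finite_law q d)"
proof (intro borel_law.intro borel_law_axioms.intro)
  have "prob_space (point_measure UNIV (\<lambda>c. ennreal (q c)))"
    using assms by (intro prob_spaceI)
        (simp add: space_point_measure emeasure_point_measure_finite sum_ennreal)
  then show "prob_space (finite_law q d)"
    unfolding finite_law_def by (rule prob_space.prob_space_distr) simp
qed (simp add: finite_law_def)

lemma third_moment_law_finite_law:
  assumes "\<And>c. q c \<ge> 0" "(\<Sum>c\<in>UNIV. q c) = 1"
  shows "third_moment_law (finite_law q d)"
  using assms unfolding third_moment_law_def third_moment_law_axioms_def finite_law_def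
  by (auto simp: borel_law_finite_law[unfolded finite_law_def] integrable_distr_eq
      integrable_point_measure_finite)

lemma conv_op_convolution_power_finite_law:
  fixes p :: "'a::finite \<times> 'b::finite \<Rightarrow> real" and d :: "'a \<times> 'b \<Rightarrow> 'v::ordered_euclidean_space"
  assumes p: "\<And>c. p c \<ge> 0" "(\<Sum>c\<in>UNIV. p c) = 1" and f: "bdd_borel K f"
  shows "conv_op (convolution_power (finite_law p d) n) f v
    = (\<Sum>x\<in>seq_pairs n. seq_prob p n x * f (v + (\<Sum>k<n. d (fst x k, snd x k))))"
proof (induction n arbitrary: v)
  case 0
  then show ?case using fun_cong[OF conv_op_return_0[OF f]]
    by (simp add: seq_pairs_def seqs_def seq_prob_def)
next
  case (Suc n)
  note step = borel_law_finite_law[OF p, of d]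
  note walk = borel_law_convolution_power[OF step, of n]
  have "conv_op (convolution_power (finite_law p d) (Suc n)) f v
      = (\<Sum>c\<in>UNIV. p c * conv_op (convolution_power (finite_law p d) n) f (v + d c))"
    using bdd_borel_measurable[OF bdd_borel_translate[OF borel_law.bdd_borel_conv_op[OF walk f]]]
    by (simp add: conv_op_convolution[OF step walk f] conv_op_def[of "finite_law p d"]
        integral_finite_law p)
  also have "\<dots> = (\<Sum>x\<in>seq_pairs n. \<Sum>c\<in>UNIV.
      p c * (seq_prob p n x * f (v + d c + (\<Sum>k<n. d (fst x k, snd x k)))))"
    unfolding Suc by (simp add: sum_distrib_left sum.swap[of _ UNIV])
  also have "\<dots> = (\<Sum>x\<in>seq_pairs (Suc n).
      seq_prob p (Suc n) x * f (v + (\<Sum>k<Suc n. d (fst x k, snd x k))))"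
    unfolding sum_seq_pairs_Suc by (simp add: seq_prob_def mult_ac add_ac)
  finally show ?case .
qed

lemma gauss_cdf_eq_gauss_prob:
  "gauss_cdf V z = gauss_prob (SOME A :: real^3^3. A ** transpose A = V) z"
proof -
  define A where "A = (SOME A :: real^3^3. A ** transpose A = V)"
  have "gauss_prob A z = measure (PiM UNIV (\<lambda>_. std_normal))
      ((\<lambda>w. \<chi> i. w i) -` {w. A *v w \<le> z} \<inter> space (PiM UNIV (\<lambda>_. std_normal)))"
    unfolding gauss_prob_def std_gauss_def by (rule measure_distr) auto
  also have "(\<lambda>w. \<chi> i. w i) -` {w. A *v w \<le> z} \<inter> space (PiM UNIV (\<lambda>_. std_normal))
     = {w \<in> space (PiM UNIV (\<lambda>_. std_normal)). \<forall>i. (A *v (\<chi> j. w j)) $ i \<le> z $ i}"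
    by (auto simp: less_eq_vec_def)
  finally show ?thesis unfolding gauss_cdf_def Let_def A_def by simp
qed

context positive_source
begin

lemma independent_pmf_if_product:
  assumes product: "\<And>a b. p (a, b) = u a * v b"
  shows "independent_pmf p"
proof -
  have marg: "marg1 p a = u a * (\<Sum>b\<in>UNIV. v b)" "marg2 p b = (\<Sum>a\<in>UNIV. u a) * v b" for a b
    by (simp_all add: marg1_def marg2_def product sum_distrib_left sum_distrib_right)
  have "(\<Sum>a\<in>UNIV. u a) * (\<Sum>b\<in>UNIV. v b) = 1"
    using sum_marg1 by (simp add: marg sum_distrib_right)
  then have "marg1 p a * marg2 p b = u a * v b * 1" for a b
    unfolding marg by (simp add: mult_ac)
  then show ?thesis by (simp add: independent_pmf_def product)
qed

lemma independent_if_ent_density_constant: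
  assumes const: "\<And>x. ent_density p x $ i = h"
  shows "independent_pmf p"
proof -
  note marg_nonzero = less_imp_neq[OF marg1_pos] less_imp_neq[OF marg2_pos]
  consider "i = 1" | "i = 2" | "i = 3" using exhaust_3 by blast
  then show ?thesis
  proof cases
    assume "i = 1"
    then have "p (a, b) / marg2 p b = 2 powr (- h)" for a b
      using const[of "(a, b)", symmetric] pos marg2_pos by (simp add: ent_density_def)
    then have "p (a, b) = 2 powr (- h) * marg2 p b" for a b
      using marg_nonzero(2)[of b] by (simp add: divide_eq_eq)
    then show ?thesis by (rule independent_pmf_if_product)
  next
    assume "i = 2"
    then have "p (a, b) / marg1 p a = 2 powr (- h)" for a b
      using const[of "(a, b)", symmetric] pos marg1_pos by (simp add: ent_density_def)
    then have "p (a, b) = marg1 p a * 2 powr (- h)" for a b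
      using marg_nonzero(1)[of a] by (simp add: divide_eq_eq mult.commute)
    then show ?thesis by (rule independent_pmf_if_product)
  next
    assume "i = 3"
    then have "p (a, b) = 2 powr (- h) * 1" for a b
      using const[of "(a, b)", symmetric] pos by (simp add: ent_density_def)
    then show ?thesis by (rule independent_pmf_if_product)
  qed
qed

lemma ent_density_nonneg: "0 \<le> ent_density p x $ i"
proof -
  have "p (fst x, snd x) \<le> marg1 p (fst x)"
    unfolding marg1_def by (rule member_le_sum[of "snd x" _ "\<lambda>b. p (fst x, b)"])
        (auto intro: less_imp_le pos)
  moreover have "p (fst x, snd x) \<le> marg2 p (snd x)"
    unfolding marg2_def by (rule member_le_sum[of "fst x" _ "\<lambda>a. p (a, snd x)"])
        (auto intro: less_imp_le pos)
  moreover have "p x \<le> 1"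
    using member_le_sum[of x UNIV p] total less_imp_le[OF pos] by simp
  ultimately show ?thesis
    using exhaust_3[of i] pos[of x] marg1_pos[of "fst x"] marg2_pos[of "snd x"]
    by (auto simp: ent_density_def)
qed

end

locale dependent_source = positive_source p for p :: "'a::finite \<times> 'b::finite \<Rightarrow> real" +
  assumes dependent: "\<not> independent_pmf p"
begin

abbreviation deviation :: "'a \<times> 'b \<Rightarrow> real^3" where
  "deviation x \<equiv> ent_density p x - ent_vec p"

lemma ex_deviation_nonzero: "\<exists>x. deviation x $ i \<noteq> 0"
  using independent_if_ent_density_constant[of i "ent_vec p $ i"] dependent by auto

lemma sum_deviation: "(\<Sum>x\<in>UNIV. p x *\<^sub>R deviation x) = 0"
  by (simp add: scaleR_diff_right sum_subtractf ent_vec_def total flip: scaleR_sum_left)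

lemma disp_mat_diag_pos: "disp_mat p $ i $ i > 0"
proof -
  obtain x where "deviation x $ i \<noteq> 0" using ex_deviation_nonzero by blast
  then have "0 < deviation x $ i * deviation x $ i"
    using not_real_square_gt_zero by blast
  then have "0 < p x * (deviation x $ i * deviation x $ i)"
    by (rule mult_pos_pos[OF pos])
  then have "0 < (\<Sum>x\<in>UNIV. p x * (deviation x $ i * deviation x $ i))"
    by (intro sum_pos2[of _ x]) (auto intro!: mult_nonneg_nonneg[OF less_imp_le[OF pos]])
  then show ?thesis by (simp add: disp_mat_def mult.assoc)
qed

lemma ent_vec_pos: "ent_vec p $ i > 0"
proof -
  obtain x where "ent_density p x $ i \<noteq> 0"
    using independent_if_ent_density_constant[of i 0] dependent by auto
  then have "0 < p x * ent_density p x $ i"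
    using ent_density_nonneg[of x i] pos[of x] by simp
  then have "0 < (\<Sum>x\<in>UNIV. p x * ent_density p x $ i)"
    by (intro sum_pos2[of _ x])
        (auto intro!: mult_nonneg_nonneg ent_density_nonneg less_imp_le[OF pos])
  then show ?thesis by (simp add: ent_vec_def)
qed

definition disp_root :: "real^3^3" where
  "disp_root = (SOME A. A ** transpose A = disp_mat p)"

lemma disp_root: "disp_root ** transpose disp_root = disp_mat p"
proof -
  define v :: "3 \<Rightarrow> real^('a \<times> 'b)" where "v i = (\<chi> x. sqrt (p x) * deviation x $ i)" for i
  have square: "sqrt (p x) * y * (sqrt (p x) * z) = p x * y * z" for x and y z :: real
    using real_sqrt_mult_self[of "p x"] pos[of x] by (simp add: algebra_simps)
  have "(\<chi> i j. v i \<bullet> v j) = disp_mat p"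
    by (simp only: vec_eq_iff v_def inner_vec_def inner_real_def vec_lambda_beta square disp_mat_def
        vector_minus_component) simp
  moreover obtain A :: "real^3^3" where "A ** transpose A = (\<chi> i j. v i \<bullet> v j)"
    by (rule gram_matrix_square_root)
  ultimately have "A ** transpose A = disp_mat p" by simp
  then show ?thesis unfolding disp_root_def by (rule someI)
qed

lemma disp_root_row_nonzero: "\<exists>j. disp_root $ i $ j \<noteq> 0"
proof (rule ccontr)
  assume "\<not> ?thesis"
  then have "(disp_root ** transpose disp_root) $ i $ i = 0" by (simp add: matrix_matrix_mult_def)
  then show False using disp_mat_diag_pos[of i] by (simp add: disp_root)
qed

abbreviation limit_cdf :: "real^3 \<Rightarrow> real" where
  "limit_cdf \<equiv> gauss_prob disp_root"

lemma mem_S_set_iff: "z \<in> S_set (disp_mat p) \<epsilon> \<longleftrightarrow> 1 - \<epsilon> \<le> limit_cdf z"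
  by (simp add: S_set_def gauss_cdf_eq_gauss_prob disp_root_def)

abbreviation step_law :: "(real^3) measure" where
  "step_law \<equiv> finite_law p deviation"

lemma second_moment_step_law: "second_moment step_law = disp_mat p"
  by (simp add: vec_eq_iff second_moment_def disp_mat_def integral_finite_law less_imp_le[OF pos]
      mult.assoc)

lemma seq_cdf_eq_walk_cdf:
  "seq_cdf p n (real n *\<^sub>R ent_vec p + z) = measure (convolution_power step_law n) {..z}"
proof -
  have deviation_sum: "0 + (\<Sum>k<n. deviation (fst x k, snd x k))
      = seq_density p n x - real n *\<^sub>R ent_vec p" for x
    by (simp add: seq_density_def sum_subtractf sum_constant_scaleR del: sum_constant)
  have step: "borel_law step_law"
    by (rule borel_law_finite_law) (auto simp: less_imp_le[OF pos] total)
  have "measure (convolution_power step_law n) {..z}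
      = conv_op (convolution_power step_law n) (indicator {..z}) 0"
    by (simp add: borel_law.conv_op_indicator_atMost[OF borel_law_convolution_power[OF step]])
  also have "\<dots> = (\<Sum>x\<in>seq_pairs n.
      seq_prob p n x * indicator {..z} (seq_density p n x - real n *\<^sub>R ent_vec p))"
    by (subst conv_op_convolution_power_finite_law[OF _ total bdd_borel_indicator_atMost])
       (auto simp only: deviation_sum less_imp_le[OF pos])
  also have "\<dots> = seq_cdf p n (real n *\<^sub>R ent_vec p + z)"
    unfolding seq_cdf_def
    by (rule sum.mono_neutral_cong_right)
       (auto simp: finite_seq_pairs typical_def indicator_def diff_le_eq add.commute)
  finally show ?thesis ..
qed

abbreviation normalized_cdf :: "nat \<Rightarrow> real^3 \<Rightarrow> real" where
  "normalized_cdf n z \<equiv> seq_cdf p n (real n *\<^sub>R ent_vec p + sqrt n *\<^sub>R z)"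

lemma seq_cdf_normal_approx:
  obtains B where "B \<ge> 0"
    "\<And>n z. n \<ge> 1 \<Longrightarrow> \<bar>normalized_cdf n z - limit_cdf z\<bar> \<le> B / sqrt n"
proof -
  have "gauss_matched_law step_law disp_root"
    unfolding gauss_matched_law_def gauss_matched_law_axioms_def
    using third_moment_law_finite_law[of p deviation] sum_deviation
    by (auto simp: less_imp_le[OF pos] total integral_finite_law second_moment_step_law disp_root)
  then obtain B where B: "B \<ge> 0" "\<And>n z. \<bar>measure (convolution_power step_law n) {..z}
      - measure (gauss_law disp_root (real n)) {..z}\<bar> \<le> B / sqrt n"
    using gauss_matched_law.berry_esseen_orthants disp_mat_diag_pos
    by (metis less_numeral_extra(3) second_moment_step_law)
  have "\<bar>normalized_cdf n z - limit_cdf z\<bar> \<le> B / sqrt n" if "n \<ge> 1" for n z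
    using B(2)[of n "sqrt n *\<^sub>R z"] that by (simp add: seq_cdf_eq_walk_cdf measure_gauss_law_atMost)
  with B(1) show ?thesis by (rule that)
qed

section \<open>The rate regions\<close>

definition normalized_rate :: "nat \<Rightarrow> real \<Rightarrow> real \<Rightarrow> real^3" where
  "normalized_rate n R1 R2 = sqrt n *\<^sub>R (rate_vec R1 R2 - ent_vec p)"

lemma rate_vec_eq_normalized_rate:
  assumes "n \<ge> 1"
  shows "real n *\<^sub>R rate_vec R1 R2 + r *\<^sub>R 1
    = real n *\<^sub>R ent_vec p + sqrt n *\<^sub>R (normalized_rate n R1 R2 + (r / sqrt n) *\<^sub>R 1)"
  using assms by (simp add: normalized_rate_def scaleR_add_right scaleR_diff_right)

lemma rate_vec_eq_iff_normalized_rate: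
  assumes "n \<ge> 1"
  shows "rate_vec R1 R2 = ent_vec p + (1 / sqrt n) *\<^sub>R z + (r / n) *\<^sub>R 1
    \<longleftrightarrow> z = normalized_rate n R1 R2 - (r / sqrt n) *\<^sub>R 1"
proof -
  define s where "s = sqrt n"
  have s: "s > 0" "real n = s * s" using assms by (simp_all add: s_def)
  show ?thesis
    unfolding normalized_rate_def s_def[symmetric] s(2)
    using s(1) by (auto simp: vec_eq_iff field_simps)
qed

lemma mem_R_in_iff:
  "n \<ge> 1 \<Longrightarrow> (R1, R2) \<in> R_in p n \<epsilon>
    \<longleftrightarrow> 1 - \<epsilon> \<le> limit_cdf (normalized_rate n R1 R2 - (nu p * log 2 n / sqrt n) *\<^sub>R 1)"
  by (simp add: R_in_def rate_vec_eq_iff_normalized_rate mem_S_set_iff)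

lemma mem_R_out_iff:
  assumes "n \<ge> 1"
  shows "(R1, R2) \<in> R_out p n \<epsilon>
    \<longleftrightarrow> 1 - \<epsilon> \<le> limit_cdf (normalized_rate n R1 R2 + (log 2 n / sqrt n) *\<^sub>R 1)"
  using rate_vec_eq_iff_normalized_rate[OF assms, of R1 R2 _ "- log 2 n"]
  by (simp add: R_out_def mem_S_set_iff)

end

lemma eventually_divide_sqrt_le:
  assumes "c > 0"
  shows "\<forall>\<^sub>F n in sequentially. K / sqrt (real n) \<le> c"
proof -
  have "filterlim (\<lambda>n. sqrt (real n)) at_top sequentially"
    by (rule filterlim_compose[OF sqrt_at_top filterlim_real_sequentially])
  then have "((\<lambda>n. K / sqrt (real n)) \<longlongrightarrow> 0) sequentially"
    by (intro tendsto_divide_0[OF tendsto_const] filterlim_at_top_imp_at_infinity)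
  from order_tendstoD(2)[OF this assms] show ?thesis
    by eventually_elim simp
qed

lemma eventually_le_log2: "\<forall>\<^sub>F n in sequentially. K \<le> log 2 (real n)"
proof (rule eventually_sequentiallyI)
  fix n assume "nat \<lceil>2 powr K\<rceil> + 1 \<le> n"
  then have "2 powr K \<le> real n" "0 < n" by linarith+
  then show "K \<le> log 2 (real n)" by (simp add: le_log_iff)
qed

lemma powr_minus_half_log2:
  assumes "n \<ge> 1"
  shows "2 powr (- (log 2 (real n) / 2)) = 1 / sqrt n"
proof -
  have "2 powr (log 2 (real n) / 2) = (2 powr log 2 (real n)) powr (1 / 2)"
    unfolding powr_powr by simp
  also have "\<dots> = sqrt n"
    using assms by (simp add: powr_half_sqrt)
  finally show ?thesis by (simp add: powr_minus_divide)
qed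

lemma kappa_nonneg: "kappa p \<ge> 0"
proof -
  have "0 \<le> spec_norm (hessian H_cond1 p)"
    unfolding spec_norm_def by (intro onorm_pos_le matrix_vector_mul_bounded_linear)
  also have "\<dots> \<le> kappa p" unfolding kappa_def by (rule Max_ge) auto
  finally show ?thesis .
qed

lemma nu_ge: "nu p \<ge> 3/2"
  using kappa_nonneg[of p] by (simp add: nu_def)

context dependent_source
begin

lemma eventually_R_in_rates_nonneg:
  assumes "\<epsilon> < 1"
  shows "\<forall>\<^sub>F n in sequentially. \<forall>R1 R2. (R1, R2) \<in> R_in p n \<epsilon> \<longrightarrow> R1 \<ge> 0 \<and> R2 \<ge> 0"
proof -
  obtain a where "a \<ge> 0" and a: "\<And>z i. 1 - \<epsilon> \<le> limit_cdf z \<Longrightarrow> - a \<le> z $ i"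
    using gauss_prob_ge_imp_bounded_below[of "1 - \<epsilon>" disp_root] assms by auto
  have "\<forall>\<^sub>F n in sequentially. a / sqrt (real n) \<le> ent_vec p $ 1"
    "\<forall>\<^sub>F n in sequentially. a / sqrt (real n) \<le> ent_vec p $ 2"
    by (intro eventually_divide_sqrt_le ent_vec_pos)+
  moreover have "\<forall>\<^sub>F n in sequentially. n \<ge> 1" by (rule eventually_ge_at_top)
  ultimately show ?thesis
  proof (eventually_elim, intro allI impI)
    fix n R1 R2
    assume entropy: "a / sqrt (real n) \<le> ent_vec p $ 1" "a / sqrt (real n) \<le> ent_vec p $ 2"
      and n: "n \<ge> 1" and R: "(R1, R2) \<in> R_in p n \<epsilon>"
    have slack: "0 \<le> nu p * log 2 n / sqrt n" using nu_ge[of p] n by simp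
    have "- a \<le> (normalized_rate n R1 R2 - (nu p * log 2 n / sqrt n) *\<^sub>R 1) $ i" for i
      using R n by (intro a) (simp add: mem_R_in_iff)
    then have lower: "- a \<le> normalized_rate n R1 R2 $ i - nu p * log 2 n / sqrt n" for i
      by simp
    have "- a \<le> normalized_rate n R1 R2 $ i" for i
      using slack lower[of i] by linarith
    from divide_right_mono[OF this, of "sqrt n"]
    have "- a / sqrt n \<le> rate_vec R1 R2 $ i - ent_vec p $ i" for i
      using n by (simp add: normalized_rate_def)
    from this[of 1] this[of 2] show "R1 \<ge> 0 \<and> R2 \<ge> 0"
      using entropy by simp
  qed
qed

lemma eventually_limit_cdf_shift:
  assumes "0 < \<alpha>" "\<alpha> < 1" "K \<ge> 0"
  obtains L where "\<forall>\<^sub>F n in sequentially. \<forall>y z. \<bar>y - \<alpha>\<bar> \<le> K / sqrt n \<longrightarrow> y \<le> limit_cdf z \<longrightarrow>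
    y + K / sqrt n \<le> limit_cdf (z + (L / sqrt n) *\<^sub>R 1)"
proof -
  obtain \<rho> L where "\<rho> > 0"
    and shift: "\<And>x y z. \<lbrakk>0 \<le> x; x \<le> \<rho>; \<alpha> / 2 \<le> y; y + x \<le> (1 + \<alpha>) / 2; y \<le> limit_cdf z\<rbrakk> \<Longrightarrow>
      y + x \<le> limit_cdf (z + (L * x) *\<^sub>R 1)"
    by (rule gauss_prob_quantile_shift[OF disp_root_row_nonzero, of "\<alpha> / 2" "(1 + \<alpha>) / 2"])
       (use assms in \<open>auto intro: that\<close>)
  have "\<forall>\<^sub>F n in sequentially. K / sqrt (real n) \<le> min \<rho> (min (\<alpha> / 2) ((1 - \<alpha>) / 4))"
    using \<open>\<rho> > 0\<close> assms by (intro eventually_divide_sqrt_le) simp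
  then have "\<forall>\<^sub>F n in sequentially. \<forall>y z. \<bar>y - \<alpha>\<bar> \<le> K / sqrt n \<longrightarrow> y \<le> limit_cdf z \<longrightarrow>
    y + K / sqrt n \<le> limit_cdf (z + (L * K / sqrt n) *\<^sub>R 1)"
  proof eventually_elim
    case (elim n)
    show ?case
    proof (intro allI impI)
      fix y z assume y: "\<bar>y - \<alpha>\<bar> \<le> K / sqrt n" "y \<le> limit_cdf z"
      have "y + K / sqrt n \<le> limit_cdf (z + (L * (K / sqrt n)) *\<^sub>R 1)"
        using elim y \<open>K \<ge> 0\<close> unfolding min.bounded_iff by (intro shift) (simp, (linarith | argo)+)
      then show "y + K / sqrt n \<le> limit_cdf (z + (L * K / sqrt n) *\<^sub>R 1)" by simp
    qed
  qed
  then show ?thesis by (rule that)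
qed

lemma eventually_normalized_cdf_transfer:
  assumes \<epsilon>: "0 < \<epsilon>" "\<epsilon> < 1" and "K \<ge> 0"
  obtains L where "\<forall>\<^sub>F n in sequentially. \<forall>z.
    (1 - \<epsilon> \<le> limit_cdf z \<longrightarrow>
      1 - \<epsilon> + K / sqrt n \<le> normalized_cdf n (z + (L / sqrt n) *\<^sub>R 1)) \<and>
    (1 - \<epsilon> \<le> normalized_cdf n z + K / sqrt n \<longrightarrow>
      1 - \<epsilon> \<le> limit_cdf (z + (L / sqrt n) *\<^sub>R 1))"
proof -
  obtain B where "B \<ge> 0" and B: "\<And>n z. n \<ge> 1 \<Longrightarrow> \<bar>normalized_cdf n z - limit_cdf z\<bar> \<le> B / sqrt n"
    using seq_cdf_normal_approx by blast
  obtain L where "\<forall>\<^sub>F n in sequentially. \<forall>y z.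
      \<bar>y - (1 - \<epsilon>)\<bar> \<le> (B + K) / sqrt n \<longrightarrow> y \<le> limit_cdf z \<longrightarrow>
      y + (B + K) / sqrt n \<le> limit_cdf (z + (L / sqrt n) *\<^sub>R 1)"
    by (rule eventually_limit_cdf_shift[of "1 - \<epsilon>" "B + K"]) (use assms \<open>B \<ge> 0\<close> in auto)
  moreover have "\<forall>\<^sub>F n in sequentially. n \<ge> 1" by (rule eventually_ge_at_top)
  ultimately show ?thesis
  proof (intro that, eventually_elim, intro allI)
    fix n :: nat and z :: "real^3"
    assume shift: "\<forall>y z. \<bar>y - (1 - \<epsilon>)\<bar> \<le> (B + K) / sqrt n \<longrightarrow> y \<le> limit_cdf z \<longrightarrow>
        y + (B + K) / sqrt n \<le> limit_cdf (z + (L / sqrt n) *\<^sub>R 1)"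
      and n: "n \<ge> 1"
    have slack: "(B + K) / sqrt n = B / sqrt n + K / sqrt n" "0 \<le> B / sqrt n + K / sqrt n"
      using \<open>K \<ge> 0\<close> \<open>B \<ge> 0\<close> by (simp_all add: add_divide_distrib)
    show "(1 - \<epsilon> \<le> limit_cdf z \<longrightarrow>
        1 - \<epsilon> + K / sqrt n \<le> normalized_cdf n (z + (L / sqrt n) *\<^sub>R 1)) \<and>
      (1 - \<epsilon> \<le> normalized_cdf n z + K / sqrt n \<longrightarrow>
        1 - \<epsilon> \<le> limit_cdf (z + (L / sqrt n) *\<^sub>R 1))"
      using B[OF n, of z] B[OF n, of "z + (L / sqrt n) *\<^sub>R 1"] shift[rule_format, of "1 - \<epsilon>" z]
        shift[rule_format, of "1 - \<epsilon> - (B + K) / sqrt n" z] slack(2)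
      unfolding slack(1) by linarith
  qed
qed

lemma eventually_R_in_subset_SW_region:
  assumes \<epsilon>: "0 < \<epsilon>" "\<epsilon> < 1"
  shows "\<forall>\<^sub>F n in sequentially. R_in p n \<epsilon> \<subseteq> SW_region p n \<epsilon>"
proof -
  obtain L where "\<forall>\<^sub>F n in sequentially. \<forall>z. 1 - \<epsilon> \<le> limit_cdf z \<longrightarrow>
      1 - \<epsilon> + 3 / sqrt n \<le> normalized_cdf n (z + (L / sqrt n) *\<^sub>R 1)"
    using eventually_normalized_cdf_transfer[OF \<epsilon>, of 3]
    by (auto simp: all_conj_distrib eventually_conj_iff)
  moreover have "\<forall>\<^sub>F n in sequentially. L \<le> log 2 (real n)" by (rule eventually_le_log2)
  moreover have "\<forall>\<^sub>F n in sequentially. n \<ge> 1" by (rule eventually_ge_at_top)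
  moreover note eventually_R_in_rates_nonneg[OF \<epsilon>(2)]
  ultimately show ?thesis
  proof eventually_elim
    case (elim n)
    note transfer = elim(1)[rule_format] and log_ge = elim(2) and n = elim(3)
    have "(R1, R2) \<in> SW_region p n \<epsilon>" if R: "(R1, R2) \<in> R_in p n \<epsilon>" for R1 R2
    proof -
      have "1 - \<epsilon> \<le> limit_cdf (normalized_rate n R1 R2 - (nu p * log 2 n / sqrt n) *\<^sub>R 1)"
        using R n by (simp add: mem_R_in_iff)
      note transfer[OF this]
      also have "normalized_rate n R1 R2 - (nu p * log 2 n / sqrt n) *\<^sub>R 1 + (L / sqrt n) *\<^sub>R 1
          = normalized_rate n R1 R2 + ((L - nu p * log 2 n) / sqrt n) *\<^sub>R 1"
        by (simp add: diff_divide_distrib scaleR_diff_left)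
      also note rate_vec_eq_normalized_rate[OF n, symmetric]
      also have "seq_cdf p n (real n *\<^sub>R rate_vec R1 R2 + (L - nu p * log 2 n) *\<^sub>R 1)
          \<le> seq_cdf p n (real n *\<^sub>R rate_vec R1 R2 - (log 2 n / 2) *\<^sub>R 1)"
      proof (rule seq_cdf_mono)
        have "1 * log 2 n \<le> (nu p - 1 / 2) * log 2 n"
          using nu_ge[of p] n by (intro mult_right_mono) auto
        then show "real n *\<^sub>R rate_vec R1 R2 + (L - nu p * log 2 n) *\<^sub>R 1
            \<le> real n *\<^sub>R rate_vec R1 R2 - (log 2 n / 2) *\<^sub>R 1"
          using log_ge by (simp add: less_eq_vec_def algebra_simps)
      qed
      finally have "sw_achievable p n \<epsilon> R1 R2"
        using elim(4) R by (intro achievability_bound[where \<gamma>="log 2 n / 2"])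
          (auto simp: powr_minus_half_log2[OF n])
      then show ?thesis by (simp add: SW_region_def)
    qed
    then show ?case by (rule subrelI)
  qed
qed

lemma eventually_SW_region_subset_R_out:
  assumes \<epsilon>: "0 < \<epsilon>" "\<epsilon> < 1"
  shows "\<forall>\<^sub>F n in sequentially. SW_region p n \<epsilon> \<subseteq> R_out p n \<epsilon>"
proof -
  obtain L where "\<forall>\<^sub>F n in sequentially.
      \<forall>z. 1 - \<epsilon> \<le> normalized_cdf n z + 3 / sqrt n \<longrightarrow>
      1 - \<epsilon> \<le> limit_cdf (z + (L / sqrt n) *\<^sub>R 1)"
    using eventually_normalized_cdf_transfer[OF \<epsilon>, of 3]
    by (auto simp: all_conj_distrib eventually_conj_iff)
  moreover have "\<forall>\<^sub>F n in sequentially. 2 * (2 + L) \<le> log 2 (real n)" by (rule eventually_le_log2)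
  moreover have "\<forall>\<^sub>F n in sequentially. n \<ge> 1" by (rule eventually_ge_at_top)
  ultimately show ?thesis
  proof eventually_elim
    case (elim n)
    note transfer = elim(1)[rule_format] and log_ge = elim(2) and n = elim(3)
    define r where "r = 2 + log 2 n / 2"
    have "(R1, R2) \<in> R_out p n \<epsilon>" if R: "(R1, R2) \<in> SW_region p n \<epsilon>" for R1 R2
    proof -
      have "1 - \<epsilon> \<le> seq_cdf p n (real n *\<^sub>R rate_vec R1 R2 + r *\<^sub>R 1) + 3 * 2 powr (- (log 2 n / 2))"
        using R unfolding r_def by (intro converse_bound) (simp add: SW_region_def)
      then have "1 - \<epsilon> \<le> limit_cdf (normalized_rate n R1 R2 + (r / sqrt n) *\<^sub>R 1
          + (L / sqrt n) *\<^sub>R 1)"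
        unfolding rate_vec_eq_normalized_rate[OF n] powr_minus_half_log2[OF n]
        by (intro transfer) simp
      also have "\<dots> \<le> limit_cdf (normalized_rate n R1 R2 + (log 2 n / sqrt n) *\<^sub>R 1)"
      proof (rule gauss_prob_mono)
        have "(r + L) / sqrt n \<le> log 2 n / sqrt n"
          using log_ge by (intro divide_right_mono) (auto simp: r_def)
        then show "normalized_rate n R1 R2 + (r / sqrt n) *\<^sub>R 1 + (L / sqrt n) *\<^sub>R 1
            \<le> normalized_rate n R1 R2 + (log 2 n / sqrt n) *\<^sub>R 1"
          by (simp add: less_eq_vec_def flip: add_divide_distrib)
      qed
      finally show ?thesis by (simp add: mem_R_out_iff[OF n])
    qed
    then show ?case by (rule subrelI)
  qed
qed

end

theorem theorem1:
  fixes p :: "'a::finite \<times> 'b::finite \<Rightarrow> real" and \<epsilon> :: real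
  assumes "\<forall>x. p x > 0"
    and "(\<Sum>x\<in>UNIV. p x) = 1"
    and "\<not> independent_pmf p"
    and "0 < \<epsilon>" and "\<epsilon> < 1"
  shows "\<exists>N. \<forall>n\<ge>N. R_in p n \<epsilon> \<subseteq> SW_region p n \<epsilon> \<and> SW_region p n \<epsilon> \<subseteq> R_out p n \<epsilon>"
proof -
  interpret dependent_source p
    using assms by unfold_locales auto
  have "\<forall>\<^sub>F n in sequentially. R_in p n \<epsilon> \<subseteq> SW_region p n \<epsilon> \<and> SW_region p n \<epsilon> \<subseteq> R_out p n \<epsilon>"
    using assms(4,5)
    by (intro eventually_conj eventually_R_in_subset_SW_region eventually_SW_region_subset_R_out)
  then show ?thesis by (simp add: eventually_sequentially)
qed

end
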